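(* Let $p$ be a prime, $k$ a positive integer, $t\in\mathbb{Z}/p^k\mathbb{Z}$, and $Q$ an $n\times n$ symmetric integer matrix. Then there is an algorithm that computes the total number, the number of primitive, and the number of non-primitive $p^k$-representations of $t$ by $Q$, using $O(n^{1+\omega}\log k+nk^3+n\log p)$ ring operations over $\mathbb{Z}/p^k\mathbb{Z}$.
   Context: A $p^k$-representation of $t$ by $Q$ is a vector $x\in(\mathbb{Z}/p^k\mathbb{Z})^n$ with $x^{T}Qx\equiv t \pmod{p^k}$. A vector $v\in(\mathbb{Z}/p^k\mathbb{Z})^n$ is primitive if some coordinate $v_i$ satisfies $\gcd(v_i,p)=1$, and non-primitive otherwise. Complexity is measured in ring operations: additions, multiplications, inversions in $\mathbb{Z}/p^k\mathbb{Z}$ and operations on integers each count as $O(1)$. $\omega$ is a constant such that multiplying two $n\times n$ matrices over $\mathbb{Z}/p^k\mathbb{Z}$ takes $O(n^\omega)$ ring operations. *)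

theory Defs
  imports
    "HOL-Number_Theory.Modular_Inverse"
    "Jordan_Normal_Form.Matrix"
begin

section \<open>Representations by a quadratic form modulo a prime power\<close>

text \<open>
  Elements of \<open>\<int>/p\<^sup>k\<int>\<close> are given by their canonical representatives in \<open>{0..<p\<^sup>k}\<close>.
\<close>

definition zmod_vecs :: "nat \<Rightarrow> nat \<Rightarrow> nat \<Rightarrow> int vec set" where
  "zmod_vecs p k n = {x \<in> carrier_vec n. \<forall>i<n. x $ i \<in> {0..<int p ^ k}}"

definition representations :: "nat \<Rightarrow> nat \<Rightarrow> nat \<Rightarrow> int mat \<Rightarrow> int \<Rightarrow> int vec set" where
  "representations p k n Q t =
     {x \<in> zmod_vecs p k n. [x \<bullet> (Q *\<^sub>v x) = t] (mod (int p ^ k))}"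

definition primitive :: "nat \<Rightarrow> int vec \<Rightarrow> bool" where
  "primitive p v \<longleftrightarrow> (\<exists>i<dim_vec v. gcd (v $ i) (int p) = 1)"


section \<open>A unit-cost random access machine over the integers and \<open>\<int>/m\<int>\<close>\<close>

text \<open>
  Programs are built from integer operations and from the ring operations of \<open>\<int>/m\<int>\<close>, where the
  modulus \<open>m\<close> is a parameter of the execution and not of the program: one program serves all
  rings. Every cell holds an integer; a ring element is stored as its representative in
  \<open>{0..<m}\<close>. Besides the ring and integer operations, every constant, variable access, array
  access, assignment and test costs one unit as well.
\<close>

datatype binop =
    IAdd | ISub | IMul | IDiv | IMod | ILess | IEq
  | RAdd | RMul

datatype expr =
    Num int
  | Var string
  | Arr string expr
  | Op binop expr expr
  | RInv expr

datatype com =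
    Skip
  | Assign string expr
  | Store string expr expr
  | Seq com com
  | Cond expr com com
  | While expr com

record mem =
  scalar :: "string \<Rightarrow> int"
  arr :: "string \<Rightarrow> int \<Rightarrow> int"

text \<open>
  \<open>IDiv\<close> and \<open>IMod\<close> are floored integer division and its remainder, with
  \<open>a div 0 = 0\<close> and \<open>a mod 0 = a\<close>; comparisons yield 0 or 1. Inversion of a non-unit yields 0,
  by the convention of \<open>modular_inverse\<close>.
\<close>

primrec apply_binop :: "int \<Rightarrow> binop \<Rightarrow> int \<Rightarrow> int \<Rightarrow> int" where
  "apply_binop m IAdd a b = a + b"
| "apply_binop m ISub a b = a - b"
| "apply_binop m IMul a b = a * b"
| "apply_binop m IDiv a b = a div b"
| "apply_binop m IMod a b = a mod b"
| "apply_binop m ILess a b = (if a < b then 1 else 0)"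
| "apply_binop m IEq a b = (if a = b then 1 else 0)"
| "apply_binop m RAdd a b = (a + b) mod m"
| "apply_binop m RMul a b = (a * b) mod m"

primrec eval_expr :: "int \<Rightarrow> mem \<Rightarrow> expr \<Rightarrow> int" where
  "eval_expr m s (Num c) = c"
| "eval_expr m s (Var x) = scalar s x"
| "eval_expr m s (Arr a e) = arr s a (eval_expr m s e)"
| "eval_expr m s (Op f e1 e2) = apply_binop m f (eval_expr m s e1) (eval_expr m s e2)"
| "eval_expr m s (RInv e) = modular_inverse m (eval_expr m s e)"

primrec cost :: "expr \<Rightarrow> nat" where
  "cost (Num c) = 1"
| "cost (Var x) = 1"
| "cost (Arr a e) = 1 + cost e"
| "cost (Op f e1 e2) = 1 + cost e1 + cost e2"
| "cost (RInv e) = 1 + cost e"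

definition set_scalar :: "string \<Rightarrow> int \<Rightarrow> mem \<Rightarrow> mem" where
  "set_scalar x v s = s\<lparr>scalar := (scalar s)(x := v)\<rparr>"

definition set_arr :: "string \<Rightarrow> int \<Rightarrow> int \<Rightarrow> mem \<Rightarrow> mem" where
  "set_arr a i v s = s\<lparr>arr := (arr s)(a := (arr s a)(i := v))\<rparr>"

text \<open>
  \<open>exec m c s T s'\<close>: with modulus \<open>m\<close>, program \<open>c\<close> started in memory \<open>s\<close> terminates in memory
  \<open>s'\<close> after \<open>T\<close> operations.
\<close>

inductive exec :: "int \<Rightarrow> com \<Rightarrow> mem \<Rightarrow> nat \<Rightarrow> mem \<Rightarrow> bool" for m where
  Skip: "exec m Skip s 1 s"
| Assign: "exec m (Assign x e) s (1 + cost e) (set_scalar x (eval_expr m s e) s)"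
| Store: "exec m (Store a i e) s (1 + cost i + cost e)
            (set_arr a (eval_expr m s i) (eval_expr m s e) s)"
| Seq: "exec m c1 s T1 s' \<Longrightarrow> exec m c2 s' T2 s'' \<Longrightarrow> exec m (Seq c1 c2) s (T1 + T2) s''"
| CondTrue: "eval_expr m s b \<noteq> 0 \<Longrightarrow> exec m c1 s T s' \<Longrightarrow>
               exec m (Cond b c1 c2) s (1 + cost b + T) s'"
| CondFalse: "eval_expr m s b = 0 \<Longrightarrow> exec m c2 s T s' \<Longrightarrow>
               exec m (Cond b c1 c2) s (1 + cost b + T) s'"
| WhileFalse: "eval_expr m s b = 0 \<Longrightarrow> exec m (While b c) s (1 + cost b) s"
| WhileTrue: "eval_expr m s b \<noteq> 0 \<Longrightarrow> exec m c s T1 s' \<Longrightarrow> exec m (While b c) s' T2 s'' \<Longrightarrow>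
               exec m (While b c) s (1 + cost b + T1 + T2) s''"

inductive_cases exec_SkipE: "exec m Skip s T s'"
inductive_cases exec_AssignE: "exec m (Assign x e) s T s'"
inductive_cases exec_StoreE: "exec m (Store a i e) s T s'"
inductive_cases exec_SeqE: "exec m (Seq c1 c2) s T s'"
inductive_cases exec_CondE: "exec m (Cond b c1 c2) s T s'"
inductive_cases exec_WhileE: "exec m (While b c) s T s'"

lemma exec_deterministic:
  assumes "exec m c s T s'" and "exec m c s U u'"
  shows "U = T \<and> u' = s'"
  using assms
proof (induction arbitrary: U u' rule: exec.induct)
  case Skip
  then show ?case by (auto elim: exec_SkipE)
next
  case Assign
  then show ?case by (auto elim: exec_AssignE)
next
  case Store
  then show ?case by (auto elim: exec_StoreE)
next
  case (Seq c1 s T1 s' c2 T2 s'')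
  from Seq.prems show ?case by (rule exec_SeqE) (metis Seq.IH)
next
  case (CondTrue s b c1 T s' c2)
  from CondTrue.prems show ?case by (rule exec_CondE) (auto simp: CondTrue.hyps dest: CondTrue.IH)
next
  case (CondFalse s b c2 T s' c1)
  from CondFalse.prems show ?case by (rule exec_CondE) (auto simp: CondFalse.hyps dest: CondFalse.IH)
next
  case (WhileFalse s b c)
  from WhileFalse.prems show ?case by (rule exec_WhileE) (simp_all add: WhileFalse.hyps)
next
  case (WhileTrue s b c T1 s' T2 s'')
  from WhileTrue.prems WhileTrue.hyps(1) obtain U1 v U2
    where "exec m c s U1 v" "exec m (While b c) v U2 u'" "U = 1 + cost b + U1 + U2"
    by (auto elim: exec_WhileE)
  with WhileTrue.IH show ?case by metis
qed


section \<open>Inputs\<close>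

definition row_major :: "nat \<Rightarrow> int mat \<Rightarrow> int \<Rightarrow> int" where
  "row_major n M j =
     (if 0 \<le> j \<and> j < int (n * n) then M $$ (nat j div n, nat j mod n) else 0)"

definition count_input :: "nat \<Rightarrow> nat \<Rightarrow> nat \<Rightarrow> int mat \<Rightarrow> int \<Rightarrow> mem" where
  "count_input p k n Q t =
     \<lparr>scalar = (\<lambda>_. 0)(''p'' := int p, ''k'' := int k, ''n'' := int n, ''t'' := t),
      arr = (\<lambda>_ _. 0)(''Q'' := row_major n Q)\<rparr>"

definition matmul_input :: "nat \<Rightarrow> nat \<Rightarrow> nat \<Rightarrow> int mat \<Rightarrow> int mat \<Rightarrow> mem" where
  "matmul_input p k n A B =
     \<lparr>scalar = (\<lambda>_. 0)(''p'' := int p, ''k'' := int k, ''n'' := int n),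
      arr = (\<lambda>_ _. 0)(''A'' := row_major n A, ''B'' := row_major n B)\<rparr>"

definition zmod_mats :: "nat \<Rightarrow> nat \<Rightarrow> nat \<Rightarrow> int mat set" where
  "zmod_mats p k n = {M \<in> carrier_mat n n. \<forall>i<n. \<forall>j<n. M $$ (i, j) \<in> {0..<int p ^ k}}"

text \<open>
  \<open>\<omega>\<close> is a feasible exponent of matrix multiplication: a single program multiplies any two
  \<open>n \<times> n\<close> matrices over any \<open>\<int>/p\<^sup>k\<int>\<close>, leaving the product in array \<open>C\<close>, with \<open>O(n\<^sup>\<omega>)\<close>
  operations.
\<close>

definition matmul_exponent :: "real \<Rightarrow> bool" where
  "matmul_exponent \<omega> \<longleftrightarrow>
     (\<exists>prog K. \<forall>p k n A B.
        prime p \<longrightarrow> 1 \<le> k \<longrightarrow> 1 \<le> n \<longrightarrow> A \<in> zmod_mats p k n \<longrightarrow> B \<in> zmod_mats p k n \<longrightarrow>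
        (\<exists>T s. exec (int p ^ k) prog (matmul_input p k n A B) T s \<and>
               (\<forall>i<n. \<forall>j<n. arr s ''C'' (int (i * n + j)) = (A * B) $$ (i, j) mod int p ^ k) \<and>
               real T \<le> K * real n powr \<omega>))"

end

theory Submission
  imports Defs "HOL-Number_Theory.Number_Theory" "HOL-Library.FuncSet"
begin

text \<open>
  A multiplication program has to write all \<open>n * n\<close> cells of its result, so a feasible exponent is
  at least 2 and cubic elimination fits into the budget.

  Pivots are chosen in the order of their \<open>p\<close>-adic valuation. An entry of minimal valuation on the
  diagonal is split off by completing the square; if there is none, an off-diagonal entry of minimal
  valuation gives a \<open>2 \<times> 2\<close> block that can be inverted up to a power of \<open>p\<close>, for \<open>p = 2\<close> as well as for
  odd \<open>p\<close>. The valuation only grows, so \<open>n + k\<close> searches suffice.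

  For a sum \<open>Q\<close> of such blocks let \<open>F m Q t\<close> be the number of zeros of \<open>Q x + t\<close> modulo \<open>p ^ m\<close>, and \<open>E m Q t\<close>
  the number of those zeros at which all variables with a unit coefficient are divisible by \<open>p\<close>.
  Dividing by \<open>p\<close> expresses \<open>E m\<close> through \<open>F (m - 1)\<close> of another sum of blocks. The zeros counted by
  \<open>F m - E m\<close> are smooth, so Hensel lifting multiplies their number by \<open>p ^ (n - 1)\<close> from \<open>m\<close> to
  \<open>m + 1\<close> as soon as \<open>m \<ge> 1\<close> (\<open>m \<ge> 3\<close> for \<open>p = 2\<close>). Hence \<open>F m\<close> is determined by counts modulo \<open>p\<close>,
  which follow from the quadratic characters of the coefficients, or by counts modulo 8, which are
  tabulated. Nonprimitive representations are counted in the same way, since \<open>Q (p * y) = p\<^sup>2 * Q y\<close>.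
\<close>

text \<open>Operations on integers of any size cost one unit, so counts are carried as exact
  integers. Counting with multiplicity is then harmless: dummy variables and the raised exponent
  multiply the answer by known powers of p, which exact divisions remove at the end.

  The recursion does not branch: F at level m of one sum of blocks refers to F at level m - 1 of a
  single other sum, with t divided by p. Unrolled, it is a loop with a running weight and an
  accumulator. What complicates it is that lifting starts from F c - E c at a base level c, and E c
  is itself a count one level lower, of the next sum of blocks. So every round needs F at both
  levels c and c - 1. For odd p these are levels 1 and 0, the latter being trivial; for p = 2 they
  are levels 3 and 2, and level 2 is read off the table modulo 8.

  The base level 3 for p = 2 comes from the derivative of a quadratic polynomial being even: raising
  a value by 2^m takes a step of 2^(m-1), whose square vanishes modulo 2^(m+1) only from m = 3
  on.\<close>

section \<open>Sums over intervals of residues\<close>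

lemma sum_int_prod:
  fixes a b :: int and h :: "int \<Rightarrow> 'a::comm_monoid_add"
  assumes "0 \<le> a" "0 \<le> b"
  shows "(\<Sum>y\<in>{0..<a*b}. h y) = (\<Sum>q\<in>{0..<a}. \<Sum>r\<in>{0..<b}. h (q * b + r))"
proof (cases "b = 0")
  case False
  with assms have b: "b > 0" by simp
  have "(\<Sum>q\<in>{0..<a}. \<Sum>r\<in>{0..<b}. h (q * b + r)) = (\<Sum>(q,r)\<in>{0..<a}\<times>{0..<b}. h (q * b + r))"
    by (simp add: sum.cartesian_product)
  also have "\<dots> = (\<Sum>y\<in>{0..<a*b}. h y)"
  proof (rule sum.reindex_bij_witness[where i = "\<lambda>y. (y div b, y mod b)" and j = "\<lambda>(q,r). q * b + r"])
    fix x assume "x \<in> {0..<a}\<times>{0..<b}"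
    then obtain q r where x: "x = (q,r)" "0 \<le> q" "q < a" "0 \<le> r" "r < b" by auto
    have "q * b + r < q * b + b" using x by simp
    also have "\<dots> = (q+1) * b" by (simp add: algebra_simps)
    also have "\<dots> \<le> a * b" using x b by (intro mult_right_mono) auto
    finally show "(case x of (q,r) \<Rightarrow> q * b + r) \<in> {0..<a*b}" using x b by auto
    show "((case x of (q,r) \<Rightarrow> q * b + r) div b, (case x of (q,r) \<Rightarrow> q * b + r) mod b) = x"
      using x b by auto
  next
    fix y assume y: "y \<in> {0..<a*b}"
    show "(case (y div b, y mod b) of (q,r) \<Rightarrow> q * b + r) = y" by simp
    have "y div b * b \<le> y" using b by (metis mult.commute mult_div_mod_eq add.commute pos_mod_sign le_add_same_cancel2)
    with y have "y div b * b < a * b" by auto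
    with b have "y div b < a" by simp
    then show "(y div b, y mod b) \<in> {0..<a}\<times>{0..<b}" using y b by (auto simp: pos_imp_zdiv_nonneg_iff)
  qed auto
  finally show ?thesis by simp
qed simp

lemma sum_int_periodic:
  fixes a b :: int and h :: "int \<Rightarrow> int"
  assumes "0 \<le> a" "0 \<le> b" and per: "\<And>y. h (y + b) = h y"
  shows "(\<Sum>y\<in>{0..<a*b}. h y) = a * (\<Sum>y\<in>{0..<b}. h y)"
proof -
  have pn: "h (y + int n * b) = h y" for y n
  proof (induction n)
    case (Suc n)
    have "h (y + int (Suc n) * b) = h ((y + int n * b) + b)" by (simp add: algebra_simps)
    then show ?case using Suc per by simp
  qed simp
  have "h (q * b + r) = h r" if "0 \<le> q" for q r
    using pn[of r "nat q"] that by (simp add: add.commute)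
  then have "(\<Sum>q\<in>{0..<a}. \<Sum>r\<in>{0..<b}. h (q * b + r)) = (\<Sum>q\<in>{0..<a}. \<Sum>r\<in>{0..<b}. h r)"
    by (intro sum.cong) auto
  then show ?thesis using sum_int_prod[OF assms(1,2), of h] assms(1) by simp
qed

lemma sum_int_multiples:
  fixes a b :: int and h :: "int \<Rightarrow> 'a::comm_monoid_add"
  assumes "0 \<le> a" "0 < b"
  shows "(\<Sum>y\<in>{0..<a*b}. if b dvd y then h y else 0) = (\<Sum>y\<in>{0..<a}. h (b * y))"
proof -
  have "(\<Sum>r\<in>{0..<b}. if b dvd (q * b + r) then h (q * b + r) else 0) = h (b * q)" for q
  proof -
    have "(\<Sum>r\<in>{0..<b}. if b dvd (q * b + r) then h (q * b + r) else 0)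
        = (\<Sum>r\<in>{0..<b}. if r = 0 then h (q * b + r) else 0)"
      by (intro sum.cong refl) (auto simp: dvd_add_right_iff dest: zdvd_imp_le)
    also have "\<dots> = h (b * q)" using assms by (simp add: mult.commute)
    finally show ?thesis .
  qed
  then show ?thesis using sum_int_prod[of a b "\<lambda>y. if b dvd y then h y else 0"] assms by simp
qed

text \<open>Translation permutes the residues; this absorbs the linear terms when a square is
  completed.\<close>

lemma sum_int_shift:
  fixes M :: int and h :: "int \<Rightarrow> 'a::comm_monoid_add"
  assumes M: "0 < M" and per: "\<And>v v'. [v = v'] (mod M) \<Longrightarrow> h v = h v'"
  shows "(\<Sum>y\<in>{0..<M}. h (y + d)) = (\<Sum>y\<in>{0..<M}. h y)"
proof (rule sum.reindex_bij_witness[where i = "\<lambda>y. (y - d) mod M" and j = "\<lambda>y. (y + d) mod M"])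
  fix y assume y: "y \<in> {0..<M}"
  show "((y + d) mod M - d) mod M = y" using y by (simp add: mod_diff_left_eq)
  show "((y - d) mod M + d) mod M = y" using y by (simp add: mod_add_left_eq)
  show "(y + d) mod M \<in> {0..<M}" "(y - d) mod M \<in> {0..<M}" using M by auto
  show "h ((y + d) mod M) = h (y + d)" by (rule per) (simp add: cong_def)
qed

section \<open>Sums over a list of binary quadratic blocks\<close>

type_synonym block = "int \<times> int \<times> int"

fun bval :: "block \<Rightarrow> int \<Rightarrow> int \<Rightarrow> int" where
  "bval (a, b, c) y z = a * y * y + 2 * b * y * z + c * z * z"

text \<open>The final function \<open>g\<close> and the start value \<open>v\<close> are arguments
  so that \<open>g\<close> can itself be the sum over the variables not yet treated; this is what
  makes lists of blocks composable. The predicate \<pi> selects the admissible values of each pair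
  of variables.\<close>

fun bsum :: "(block \<Rightarrow> int \<Rightarrow> int \<Rightarrow> bool) \<Rightarrow> int \<Rightarrow> block list \<Rightarrow> (int \<Rightarrow> int) \<Rightarrow> int \<Rightarrow> int" where
  "bsum \<pi> M [] g v = g v"
| "bsum \<pi> M (B # L) g v =
     (\<Sum>y\<in>{0..<M}. \<Sum>z\<in>{0..<M}. if \<pi> B y z then bsum \<pi> M L g (v + bval B y z) else 0)"

definition free :: "block \<Rightarrow> int \<Rightarrow> int \<Rightarrow> bool" where
  "free B y z = True"

text \<open>With \<open>free\<close> this is F m of the overview, with \<open>low p\<close> it is E
  m, over two variables per block. Representations of t correspond to the start value
  \<open>- t\<close>.\<close>

definition cnt :: "int \<Rightarrow> (block \<Rightarrow> int \<Rightarrow> int \<Rightarrow> bool) \<Rightarrow> nat \<Rightarrow> block list \<Rightarrow> int \<Rightarrow> int" where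
  "cnt p \<pi> m L t = bsum \<pi> (p ^ m) L (\<lambda>v. of_bool (p ^ m dvd v)) t"

lemma cnt_Nil: "cnt p \<pi> m [] t = of_bool (p ^ m dvd t)"
  by (simp add: cnt_def)

lemma cnt_Cons: "cnt p \<pi> m (B # L) t =
    (\<Sum>y\<in>{0..<p^m}. \<Sum>z\<in>{0..<p^m}. if \<pi> B y z then cnt p \<pi> m L (t + bval B y z) else 0)"
  by (simp add: cnt_def cong: if_cong)

lemma bval_cong: "[y = y'] (mod M) \<Longrightarrow> [z = z'] (mod M) \<Longrightarrow> [bval B y z = bval B y' z'] (mod M)"
  by (cases B) (auto intro!: cong_add cong_mult)

lemma bsum_cong_start:
  assumes "\<And>v v'. [v = v'] (mod M) \<Longrightarrow> g v = g v'" and "[v = v'] (mod M)"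
  shows "bsum \<pi> M L g v = bsum \<pi> M L g v'"
  using assms(2)
proof (induction L arbitrary: v v')
  case (Cons B L)
  have "bsum \<pi> M L g (v + x) = bsum \<pi> M L g (v' + x)" for x
    by (rule Cons.IH) (intro cong_add Cons.prems cong_refl)
  then show ?case by (simp cong: if_cong)
qed (simp add: assms(1))

lemma cnt_cong:
  assumes "[t = t'] (mod p ^ m)"
  shows "cnt p \<pi> m L t = cnt p \<pi> m L t'"
  unfolding cnt_def by (rule bsum_cong_start[OF _ assms]) (auto simp: of_bool_def dest: cong_dvd_iff)

lemma bsum_append:
  "bsum free M (L @ L') g v = bsum free M L (bsum free M L' g) v"
  by (induction L arbitrary: v) (auto simp: free_def)

lemma bsum_Cons_free: "bsum free M (B # L) g v =
  (\<Sum>y\<in>{0..<M}. \<Sum>z\<in>{0..<M}. bsum free M L g (v + bval B y z))"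
  by (simp add: free_def)

lemma sum_pair_periodic:
  fixes a b :: int and h :: "int \<Rightarrow> int \<Rightarrow> int"
  assumes "0 \<le> a" "0 \<le> b" and "\<And>y z. h (y + b) z = h y z" and "\<And>y z. h y (z + b) = h y z"
  shows "(\<Sum>y\<in>{0..<a*b}. \<Sum>z\<in>{0..<a*b}. h y z) = a\<^sup>2 * (\<Sum>y\<in>{0..<b}. \<Sum>z\<in>{0..<b}. h y z)"
proof -
  have "(\<Sum>y\<in>{0..<a*b}. \<Sum>z\<in>{0..<a*b}. h y z) = (\<Sum>y\<in>{0..<a*b}. a * (\<Sum>z\<in>{0..<b}. h y z))"
    using assms by (intro sum.cong refl sum_int_periodic) auto
  also have "\<dots> = a * (\<Sum>y\<in>{0..<b}. a * (\<Sum>z\<in>{0..<b}. h y z))"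
    using assms by (intro sum_int_periodic) auto
  finally show ?thesis by (simp add: sum_distrib_left power2_eq_square mult_ac)
qed

definition locally_periodic :: "int \<Rightarrow> (block \<Rightarrow> int \<Rightarrow> int \<Rightarrow> bool) \<Rightarrow> bool" where
  "locally_periodic p \<pi> \<longleftrightarrow> (\<forall>B y y' z z'. [y = y'] (mod p) \<longrightarrow> [z = z'] (mod p) \<longrightarrow> \<pi> B y z = \<pi> B y' z')"

lemma locally_periodicD:
  "locally_periodic p \<pi> \<Longrightarrow> [y = y'] (mod p) \<Longrightarrow> [z = z'] (mod p) \<Longrightarrow> \<pi> B y z = \<pi> B y' z'"
  unfolding locally_periodic_def by blast

lemma locally_periodic_free: "locally_periodic p free"
  by (simp add: locally_periodic_def free_def)

text \<open>The values \<open>t + j * p ^ m\<close> are the lifts of t to the next level, and for a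
  point that is a zero modulo \<open>p ^ m\<close> exactly one of them gives a zero modulo
  \<open>p ^ Suc m\<close>. Each of the \<open>2 * length L\<close> variables has p lifts, which
  \<pi> cannot tell apart because it only sees residues modulo p and m is at least 1.\<close>

lemma cnt_lift:
  assumes p: "p > 1" and m: "m \<ge> 1" and \<pi>: "locally_periodic p \<pi>"
  shows "(\<Sum>j\<in>{0..<p}. cnt p \<pi> (Suc m) L (t + j * p ^ m)) = p ^ (2 * length L) * cnt p \<pi> m L t"
proof (induction L arbitrary: t)
  case Nil
  show ?case
  proof (cases "p ^ m dvd t")
    case True
    then obtain u where u: "t = p ^ m * u" by auto
    have "p ^ Suc m dvd t + j * p ^ m \<longleftrightarrow> p dvd (u + j)" for j
    proof -
      have "t + j * p ^ m = p ^ m * (u + j)" by (simp add: u algebra_simps)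
      moreover have "p ^ Suc m = p ^ m * p" by simp
      ultimately show ?thesis using p by (simp del: power_Suc)
    qed
    then have "(\<Sum>j\<in>{0..<p}. cnt p \<pi> (Suc m) [] (t + j * p ^ m)) = (\<Sum>j\<in>{0..<p}. of_bool (p dvd (j + u)))"
      by (simp add: cnt_Nil add.commute del: power_Suc)
    also have "\<dots> = (\<Sum>j\<in>{0..<p}. of_bool (p dvd j))"
      using p by (intro sum_int_shift[where h = "\<lambda>j. of_bool (p dvd j)"]) (auto simp: cong_dvd_iff)
    also have "\<dots> = (\<Sum>j\<in>{0..<p}. if j = 0 then 1 else 0)"
      by (intro sum.cong refl) (auto dest: zdvd_imp_le)
    also have "\<dots> = 1" using p by simp
    finally show ?thesis using True by (simp add: cnt_Nil)
  next
    case False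
    then have "\<not> p ^ Suc m dvd t + j * p ^ m" for j
      by (meson dvd_add_left_iff dvd_trans dvd_triv_right le_imp_power_dvd lessI less_imp_le)
    with False show ?thesis by (simp add: cnt_Nil del: power_Suc)
  qed
next
  case (Cons B L)
  let ?D = "{0..<p ^ Suc m}"
  have "(\<Sum>j\<in>{0..<p}. cnt p \<pi> (Suc m) (B # L) (t + j * p ^ m))
      = (\<Sum>j\<in>{0..<p}. \<Sum>y\<in>?D. \<Sum>z\<in>?D. if \<pi> B y z then cnt p \<pi> (Suc m) L (t + j * p ^ m + bval B y z) else 0)"
    by (simp add: cnt_Cons del: power_Suc)
  also have "\<dots> = (\<Sum>y\<in>?D. \<Sum>j\<in>{0..<p}. \<Sum>z\<in>?D. if \<pi> B y z then cnt p \<pi> (Suc m) L (t + j * p ^ m + bval B y z) else 0)"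
    by (rule sum.swap)
  also have "\<dots> = (\<Sum>y\<in>?D. \<Sum>z\<in>?D. \<Sum>j\<in>{0..<p}. if \<pi> B y z then cnt p \<pi> (Suc m) L (t + j * p ^ m + bval B y z) else 0)"
    by (intro sum.cong refl sum.swap)
  also have "\<dots> = (\<Sum>y\<in>?D. \<Sum>z\<in>?D. if \<pi> B y z then p ^ (2 * length L) * cnt p \<pi> m L (t + bval B y z) else 0)"
  proof (intro sum.cong refl)
    fix y z
    show "(\<Sum>j\<in>{0..<p}. if \<pi> B y z then cnt p \<pi> (Suc m) L (t + j * p ^ m + bval B y z) else 0)
      = (if \<pi> B y z then p ^ (2 * length L) * cnt p \<pi> m L (t + bval B y z) else 0)"
      using Cons.IH[of "t + bval B y z"] by (simp add: ac_simps del: power_Suc)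
  qed
  also have "\<dots> = p\<^sup>2 * (\<Sum>y\<in>{0..<p^m}. \<Sum>z\<in>{0..<p^m}. if \<pi> B y z then p ^ (2 * length L) * cnt p \<pi> m L (t + bval B y z) else 0)"
  proof -
    have pm: "p dvd p ^ m" using m by (simp add: dvd_power)
    have c1: "[x + p ^ m = x] (mod p)" for x
      using pm by (simp add: cong_iff_dvd_diff)
    have c2: "[x + p ^ m = x] (mod p ^ m)" for x by (simp add: cong_def)
    have "(if \<pi> B (y + p^m) z then p ^ (2 * length L) * cnt p \<pi> m L (t + bval B (y + p^m) z) else 0)
        = (if \<pi> B y z then p ^ (2 * length L) * cnt p \<pi> m L (t + bval B y z) else 0)" for y z
    proof -
      have "cnt p \<pi> m L (t + bval B (y + p^m) z) = cnt p \<pi> m L (t + bval B y z)"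
        by (intro cnt_cong cong_add cong_refl bval_cong c2)
      then show ?thesis using locally_periodicD[OF \<pi> c1 cong_refl, of B y z] by simp
    qed
    moreover have "(if \<pi> B y (z + p^m) then p ^ (2 * length L) * cnt p \<pi> m L (t + bval B y (z + p^m)) else 0)
        = (if \<pi> B y z then p ^ (2 * length L) * cnt p \<pi> m L (t + bval B y z) else 0)" for y z
    proof -
      have "cnt p \<pi> m L (t + bval B y (z + p^m)) = cnt p \<pi> m L (t + bval B y z)"
        by (intro cnt_cong cong_add cong_refl bval_cong c2)
      then show ?thesis using locally_periodicD[OF \<pi> cong_refl c1, of B y z] by simp
    qed
    ultimately show ?thesis using p by (simp add: sum_pair_periodic)
  qed
  also have "\<dots> = p ^ (2 * length (B # L)) * cnt p \<pi> m (B # L) t"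
  proof -
    have "(\<Sum>y\<in>{0..<p^m}. \<Sum>z\<in>{0..<p^m}. if \<pi> B y z then p ^ (2 * length L) * cnt p \<pi> m L (t + bval B y z) else 0)
      = p ^ (2 * length L) * cnt p \<pi> m (B # L) t"
      unfolding cnt_Cons sum_distrib_left by (intro sum.cong refl) simp
    then show ?thesis by (simp add: power_add power2_eq_square)
  qed
  finally show ?case .
qed

section \<open>Zeros at which the unit variables are divisible by p\<close>

text \<open>The variables with a unit coefficient are multiples of \<open>p\<close>.\<close>

fun low :: "int \<Rightarrow> block \<Rightarrow> int \<Rightarrow> int \<Rightarrow> bool" where
  "low p (a, b, c) y z =
     (if \<not> p dvd b then p dvd y \<and> p dvd z else if \<not> p dvd a then p dvd y else True)"

text \<open>The effect of replacing those variables by \<open>p\<close> times themselves and dividing the form by \<open>p\<close>.\<close>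

fun shift_block :: "int \<Rightarrow> block \<Rightarrow> block" where
  "shift_block p (a, b, c) =
     (if p dvd a \<and> p dvd b then (a div p, b div p, c div p) else (p * a, p * b, p * c))"

text \<open>A variable that is not forced to be divisible by p ranges over one level more than in
  the shifted count, which is a factor p. In a unary block with unit coefficient the dummy is such a
  variable, in a block divisible by p both are.\<close>

fun low_factor :: "int \<Rightarrow> block \<Rightarrow> int" where
  "low_factor p (a, b, c) = (if \<not> p dvd b then 1 else if \<not> p dvd a then p else p\<^sup>2)"

fun scale_block :: "int \<Rightarrow> block \<Rightarrow> block" where
  "scale_block q (a, b, c) = (q * a, q * b, q * c)"

text \<open>The two shapes that pivoting produces: a unary block, possibly zero, and
  \<open>p ^ w\<close> times a block with unit off-diagonal entry and diagonal entries divisible by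
  p. Without the power, the latter is \<open>2 * b' * y * z\<close> modulo p, and its determinant is
  a unit for every p, including 2.\<close>

fun good_block :: "int \<Rightarrow> block \<Rightarrow> bool" where
  "good_block p (a, b, c) \<longleftrightarrow> b = 0 \<and> c = 0 \<or>
     (\<exists>w a' b' c'. a = p ^ w * (p * a') \<and> b = p ^ w * b' \<and> c = p ^ w * (p * c') \<and> \<not> p dvd b')"

lemma bval_scale: "bval (scale_block q B) y z = q * bval B y z"
  by (cases B) (simp add: algebra_simps)

lemma good_scale_block: "good_block p B \<Longrightarrow> good_block p (scale_block (p ^ e) B)"
proof (cases B)
  case (fields a b c)
  assume g: "good_block p B"
  show ?thesis
  proof (cases "b = 0 \<and> c = 0")
    case False
    then obtain w a' b' c' where "a = p ^ w * (p * a')" "b = p ^ w * b'" "c = p ^ w * (p * c')" "\<not> p dvd b'"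
      using g fields by auto
    then have "p ^ e * a = p ^ (e + w) * (p * a') \<and> p ^ e * b = p ^ (e + w) * b' \<and> p ^ e * c = p ^ (e + w) * (p * c')"
      by (simp add: power_add mult_ac)
    then show ?thesis using fields \<open>\<not> p dvd b'\<close> by (auto simp del: mult_eq_0_iff)
  qed (simp add: fields)
qed

text \<open>In the first two cases the variables that matter become p times themselves; this
  multiplies the block by p^2, and the division by p leaves one factor p. In the third case nothing
  is substituted and the division takes place in the coefficients.\<close>

lemma shift_block_cases:
  assumes g: "good_block p B" and p: "p > 1"
  obtains (binary) a b c where "B = (a, b, c)" "\<not> p dvd b" "p dvd a" "p dvd c"
       "shift_block p B = scale_block p B" "low_factor p B = 1"
     | (unary) a where "B = (a, 0, 0)" "\<not> p dvd a"
       "shift_block p B = scale_block p B" "low_factor p B = p"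
     | (divisible) a b c where "B = (p * a, p * b, p * c)" "shift_block p B = (a, b, c)" "low_factor p B = p\<^sup>2"
proof (cases B)
  case (fields a b c)
  show thesis
  proof (cases "p dvd b")
    case False
    then obtain w a' b' c' where w: "a = p ^ w * (p * a')" "b = p ^ w * b'" "c = p ^ w * (p * c')"
      using g fields by auto
    show thesis by (rule binary[OF fields False]) (use w fields False in auto)
  next
    case b: True
    show thesis
    proof (cases "p dvd a")
      case False
      then have "b = 0 \<and> c = 0" using g fields by auto
      then show thesis using unary[of a] fields False by auto
    next
      case a: True
      then have "p dvd c" using g fields by auto
      with a b obtain a' b' c' where "a = p * a'" "b = p * b'" "c = p * c'" by (metis dvd_def)
      then show thesis using divisible[of a' b' c'] fields p by simp
    qed
  qed
qed

lemma good_shift_block: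
  assumes g: "good_block p B" and p: "p > 1"
  shows "good_block p (shift_block p B)"
  using g p
proof (cases rule: shift_block_cases)
  case (binary a b c)
  then show ?thesis using good_scale_block[OF g, of 1] by simp
next
  case (unary a)
  then show ?thesis using good_scale_block[OF g, of 1] by simp
next
  case (divisible a b c)
  show ?thesis
  proof (cases "b = 0 \<and> c = 0")
    case False
    then obtain w a' b' c' where w: "p * a = p ^ w * (p * a')" "p * b = p ^ w * b'"
        "p * c = p ^ w * (p * c')" "\<not> p dvd b'"
      using g divisible p by auto
    have "w \<noteq> 0" using w(2,4) by (metis dvd_triv_left mult_1 power_0)
    then obtain u where "w = Suc u" by (cases w) auto
    with w p have "a = p ^ u * (p * a')" "b = p ^ u * b'" "c = p ^ u * (p * c')" by (simp_all add: mult.assoc)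
    with w(4) divisible show ?thesis by auto
  qed (use divisible in simp)
qed

lemma cnt_low:
  assumes p: "p > 1" and good: "\<forall>B\<in>set L. good_block p B"
  shows "cnt p (low p) (Suc m) L t =
    (if p dvd t then prod_list (map (low_factor p) L) * cnt p free m (map (shift_block p) L) (t div p) else 0)"
  using good
proof (induction L arbitrary: t)
  case Nil
  have "p ^ Suc m dvd t \<longleftrightarrow> p ^ m dvd t div p" if "p dvd t"
    using that p by auto
  moreover have "\<not> p ^ Suc m dvd t" if "\<not> p dvd t"
    using that by (metis dvd_mult_left power_Suc)
  ultimately show ?case by (auto simp: cnt_Nil simp del: power_Suc)
next
  case (Cons B L)
  define F where "F = prod_list (map (low_factor p) L)"
  define C where "C = (\<lambda>v. cnt p free m (map (shift_block p) L) v)"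
  have IH: "cnt p (low p) (Suc m) L (t + p * x) = (if p dvd t then F * C (t div p + x) else 0)" for x
  proof -
    have "(t + p * x) div p = t div p + x" using p by simp
    then show ?thesis using Cons.IH[of "t + p * x"] Cons.prems
      by (auto simp: F_def C_def dvd_add_left_iff)
  qed
  have S1: "(\<Sum>y\<in>{0..<p ^ Suc m}. if p dvd y then h y else 0) = (\<Sum>y\<in>{0..<p^m}. h (p * y))"
    for h :: "int \<Rightarrow> int" using sum_int_multiples[of "p^m" p h] p by (simp add: mult.commute)
  have per: "C (v + bval B' (y + p ^ m) z) = C (v + bval B' y z)"
    "C (v + bval B' y (z + p ^ m)) = C (v + bval B' y z)" for v B' y z
    unfolding C_def by (intro cnt_cong cong_add bval_cong cong_refl; simp add: cong_def)+
  have R: "cnt p free m (map (shift_block p) (B # L)) (t div p)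
      = (\<Sum>y\<in>{0..<p^m}. \<Sum>z\<in>{0..<p^m}. C (t div p + bval (shift_block p B) y z))"
    by (simp add: cnt_Cons C_def free_def)
  have "good_block p B" using Cons.prems by simp
  then show ?case using p
  proof (cases rule: shift_block_cases)
    case (binary a b c)
    have "cnt p (low p) (Suc m) (B # L) t
      = (\<Sum>y\<in>{0..<p ^ Suc m}. if p dvd y then (\<Sum>z\<in>{0..<p ^ Suc m}. if p dvd z then
           cnt p (low p) (Suc m) L (t + bval B y z) else 0) else 0)"
      unfolding cnt_Cons using binary by (intro sum.cong refl) auto
    also have "\<dots> = (\<Sum>y\<in>{0..<p ^ m}. \<Sum>z\<in>{0..<p ^ m}. cnt p (low p) (Suc m) L (t + bval B (p * y) (p * z)))"
      by (simp only: S1)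
    also have "\<dots> = (\<Sum>y\<in>{0..<p ^ m}. \<Sum>z\<in>{0..<p ^ m}. cnt p (low p) (Suc m) L (t + p * bval (shift_block p B) y z))"
      using binary by (intro sum.cong refl) (simp add: algebra_simps)
    finally show ?thesis using binary unfolding IH R
      by (simp add: sum_distrib_left F_def)
  next
    case (unary a)
    have "cnt p (low p) (Suc m) (B # L) t
      = (\<Sum>y\<in>{0..<p ^ Suc m}. if p dvd y then (\<Sum>z\<in>{0..<p ^ Suc m}.
           cnt p (low p) (Suc m) L (t + bval B y z)) else 0)"
      unfolding cnt_Cons using unary by (intro sum.cong refl) auto
    also have "\<dots> = (\<Sum>y\<in>{0..<p ^ m}. \<Sum>z\<in>{0..<p ^ Suc m}. cnt p (low p) (Suc m) L (t + bval B (p * y) z))"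
      by (simp only: S1)
    also have "\<dots> = (\<Sum>y\<in>{0..<p ^ m}. \<Sum>z\<in>{0..<p * p ^ m}. cnt p (low p) (Suc m) L (t + p * bval (shift_block p B) y z))"
      using unary by (intro sum.cong refl) (simp_all add: algebra_simps)
    \<comment> \<open>The dummy variable z still runs modulo \<open>p ^ Suc m\<close>; its p periods
      give the factor p.\<close>
    also have "\<dots> = (\<Sum>y\<in>{0..<p ^ m}. p * (\<Sum>z\<in>{0..<p ^ m}. cnt p (low p) (Suc m) L (t + p * bval (shift_block p B) y z)))"
      using p by (intro sum.cong refl sum_int_periodic) (simp_all add: IH per)
    finally show ?thesis using unary unfolding IH R
      by (simp add: sum_distrib_left F_def mult_ac)
  next
    case (divisible a b c)
    have "cnt p (low p) (Suc m) (B # L) t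
      = (\<Sum>y\<in>{0..<p * p ^ m}. \<Sum>z\<in>{0..<p * p ^ m}. cnt p (low p) (Suc m) L (t + p * bval (shift_block p B) y z))"
      unfolding cnt_Cons using divisible by (intro sum.cong) (simp_all add: algebra_simps)
    also have "\<dots> = p\<^sup>2 * (\<Sum>y\<in>{0..<p ^ m}. \<Sum>z\<in>{0..<p ^ m}. cnt p (low p) (Suc m) L (t + p * bval (shift_block p B) y z))"
      using p by (intro sum_pair_periodic) (simp_all add: IH per)
    finally show ?thesis using divisible unfolding IH R
      by (simp add: sum_distrib_left F_def mult_ac)
  qed
qed

lemma locally_periodic_low: "locally_periodic p (low p)"
  unfolding locally_periodic_def by (auto simp: cong_dvd_iff)

section \<open>Hensel lifting of the remaining zeros\<close>

text \<open>Hensel's lemma for one variable: the substitution \<open>y \<mapsto> y + \<delta> y\<close> permutes the residues and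
  adds \<open>p ^ m\<close> to the quadratic polynomial.\<close>

lemma hensel_unary:
  fixes p \<alpha> \<beta> \<gamma> :: int and h :: "int \<Rightarrow> int"
  assumes p: "prime p" and m: "m \<ge> 1" "p = 2 \<Longrightarrow> m \<ge> 3"
    and \<psi>: "\<And>y y'. [y = y'] (mod p) \<Longrightarrow> \<psi> y = \<psi> y'"
    and unit: "\<And>y. \<psi> y \<Longrightarrow> \<not> p dvd \<alpha> * y + \<beta>"
    and h: "\<And>v v'. [v = v'] (mod p ^ Suc m) \<Longrightarrow> h v = h v'"
  shows "(\<Sum>y\<in>{0..<p ^ Suc m}. if \<psi> y then h (\<alpha> * y * y + 2 * \<beta> * y + \<gamma> + p ^ m) else 0)
       = (\<Sum>y\<in>{0..<p ^ Suc m}. if \<psi> y then h (\<alpha> * y * y + 2 * \<beta> * y + \<gamma>) else 0)"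
proof -
  have p1: "p > 1" using p prime_gt_1_int by auto
  define q where "q = (\<lambda>y. \<alpha> * y * y + 2 * \<beta> * y + \<gamma>)"
  \<comment> \<open>The exponent e is what makes the substitution injective: \<delta> is divisible
    by \<open>p ^ e\<close> and is determined by y modulo \<open>p ^ e\<close>.\<close>
  obtain \<delta> e where \<delta>: "\<And>y. p ^ e dvd \<delta> y" "1 \<le> e \<and> e \<le> m" "\<And>y y'. [y = y'] (mod p ^ e) \<Longrightarrow> [\<delta> y = \<delta> y'] (mod p ^ Suc m)"
      "\<And>y. \<psi> y \<Longrightarrow> [q (y + \<delta> y) = q y + p ^ m] (mod p ^ Suc m)"
  proof (cases "p = 2")
    case True
    then have m3: "m \<ge> 3" using m by simp
    \<comment> \<open>The derivative is twice an odd number, so the step \<open>2 ^ (m - 1)\<close>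
      adds \<open>2 ^ m\<close>. The quadratic term contains \<open>2 ^ (2 * m - 2)\<close>, a
      multiple of \<open>2 ^ Suc m\<close> because m is at least 3.\<close>
    have H: "[q (y + 2 ^ (m - 1)) = q y + 2 ^ m] (mod 2 ^ Suc m)" if "\<psi> y" for y
    proof -
      have "odd (\<alpha> * y + \<beta>)" using unit[OF that] True by simp
      then obtain r where r: "\<alpha> * y + \<beta> = 2 * r + 1" by (rule oddE)
      have s: "(2::int) ^ m = 2 * 2 ^ (m - 1)" using m3 by (cases m) auto
      obtain n where n: "m = n + 3" using m3 by (metis add.commute le_Suc_ex)
      have "q (y + 2 ^ (m - 1)) - (q y + 2 ^ m) = 2 * 2 ^ (m - 1) * (\<alpha> * y + \<beta>) - 2 ^ m + \<alpha> * 2 ^ (m - 1) * 2 ^ (m - 1)"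
        by (simp add: q_def algebra_simps)
      also have "\<dots> = 2 ^ Suc m * (r + \<alpha> * 2 ^ n)"
        unfolding r n by (simp add: algebra_simps power_add)
      finally show ?thesis by (simp add: cong_iff_dvd_diff)
    qed
    show thesis
    proof (rule that[of "m - 1" "\<lambda>_. 2 ^ (m - 1)"])
      show "p ^ (m - 1) dvd 2 ^ (m - 1)" for y :: int by (simp only: True dvd_refl)
      show "1 \<le> m - 1 \<and> m - 1 \<le> m" using m3 by linarith
      show "[q (y + 2 ^ (m - 1)) = q y + p ^ m] (mod p ^ Suc m)" if "\<psi> y" for y
        using H[OF that] by (simp only: True)
    qed (rule cong_refl)
  next
    case False
    \<comment> \<open>The Newton correction: the inverse of the derivative modulo p. Reducing y
      modulo p first makes c depend on the residue class only. The quadratic term contains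
      \<open>p ^ (2 * m)\<close> and vanishes because m is at least 1.\<close>
    define c where "c = (\<lambda>y. modular_inverse p (2 * (\<alpha> * (y mod p) + \<beta>)))"
    show thesis
    proof (rule that[of m "\<lambda>y. p ^ m * c y"])
      fix y y' :: int assume "[y = y'] (mod p ^ m)"
      moreover have "p dvd p ^ m" using m(1) by (intro dvd_power) simp
      ultimately have "[y = y'] (mod p)" by (rule cong_dvd_modulus)
      then have "c y = c y'" by (simp add: c_def cong_def)
      then show "[p ^ m * c y = p ^ m * c y'] (mod p ^ Suc m)" by simp
    next
      fix y assume "\<psi> y"
      then have nd: "\<not> p dvd \<alpha> * y + \<beta>" by (rule unit)
      have cg: "[2 * (\<alpha> * (y mod p) + \<beta>) = 2 * (\<alpha> * y + \<beta>)] (mod p)"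
        by (intro cong_mult cong_add cong_refl) (simp add: cong_def)
      have "\<not> p dvd 2" using False p1 zdvd_imp_le[of p 2] by auto
      then have "\<not> p dvd 2 * (\<alpha> * y + \<beta>)" using nd p by (simp only: prime_dvd_mult_iff simp_thms)
      then have "\<not> p dvd 2 * (\<alpha> * (y mod p) + \<beta>)" using cong_dvd_iff[OF cg] by simp
      then have "coprime (2 * (\<alpha> * (y mod p) + \<beta>)) p" using p by (simp add: coprime_commute prime_imp_coprime)
      then have "[2 * (\<alpha> * (y mod p) + \<beta>) * c y = 1] (mod p)" unfolding c_def by (rule cong_modular_inverse1)
      moreover have "[2 * (\<alpha> * (y mod p) + \<beta>) * c y = 2 * (\<alpha> * y + \<beta>) * c y] (mod p)"
        by (intro cong_mult cg cong_refl)
      ultimately have "[2 * (\<alpha> * y + \<beta>) * c y = 1] (mod p)" by (metis cong_sym cong_trans)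
      then obtain r where r: "2 * (\<alpha> * y + \<beta>) * c y - 1 = p * r" by (auto simp: cong_iff_dvd_diff)
      obtain n where n: "m = Suc n" using m(1) by (cases m) auto
      have "q (y + p ^ m * c y) - (q y + p ^ m) = p ^ m * (2 * (\<alpha> * y + \<beta>) * c y - 1) + \<alpha> * (p ^ m * c y) * (p ^ m * c y)"
        by (simp add: q_def algebra_simps)
      also have "\<dots> = p ^ Suc m * (r + \<alpha> * c y * c y * p ^ n)"
        unfolding r n by (simp add: algebra_simps)
      finally show "[q (y + p ^ m * c y) = q y + p ^ m] (mod p ^ Suc m)" by (simp add: cong_iff_dvd_diff)
    qed (use m in auto)
  qed
  define Y where "Y = {0..<p ^ Suc m} \<inter> Collect \<psi>"
  define \<sigma> where "\<sigma> = (\<lambda>y. (y + \<delta> y) mod p ^ Suc m)"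
  have PM: "p ^ Suc m > 0" using p1 by simp
  have pe: "p dvd p ^ e" using \<delta>(2) by (simp add: dvd_power)
  have em: "p ^ e dvd p ^ Suc m" using \<delta>(2) by (simp add: le_imp_power_dvd)
  have sub: "\<sigma> ` Y \<subseteq> Y"
  proof
    fix x assume "x \<in> \<sigma> ` Y"
    then obtain y where y: "y \<in> Y" "x = \<sigma> y" by auto
    have "[\<sigma> y = y + \<delta> y] (mod p)"
      unfolding \<sigma>_def using dvd_trans[OF pe em] by (simp add: cong_def mod_mod_cancel del: power_Suc)
    moreover have "[y + \<delta> y = y] (mod p)" using \<delta>(1)[of y] pe by (metis add_diff_cancel_left' cong_iff_dvd_diff dvd_trans)
    ultimately have "[\<sigma> y = y] (mod p)" by (rule cong_trans)
    with \<psi>[OF this] y PM show "x \<in> Y" by (simp add: Y_def \<sigma>_def)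
  qed
  \<comment> \<open>\<sigma> y determines y modulo \<open>p ^ e\<close>, hence \<delta> y, hence
    y.\<close>
  have inj: "inj_on \<sigma> Y"
  proof (rule inj_onI)
    fix y y' assume yy: "y \<in> Y" "y' \<in> Y" "\<sigma> y = \<sigma> y'"
    then have c: "[y + \<delta> y = y' + \<delta> y'] (mod p ^ Suc m)" by (simp add: \<sigma>_def cong_def)
    then have "[y + \<delta> y = y' + \<delta> y'] (mod p ^ e)" using em cong_dvd_modulus by blast
    moreover have "[y + \<delta> y = y] (mod p ^ e)" "[y' + \<delta> y' = y'] (mod p ^ e)"
      using \<delta>(1) by (simp_all add: cong_iff_dvd_diff)
    ultimately have "[y = y'] (mod p ^ e)" by (metis cong_sym cong_trans)
    then have "[\<delta> y = \<delta> y'] (mod p ^ Suc m)" by (rule \<delta>(3))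
    with c have "[y + \<delta> y - \<delta> y = y' + \<delta> y' - \<delta> y'] (mod p ^ Suc m)" by (rule cong_diff)
    then show "y = y'" using yy by (simp add: Y_def cong_def)
  qed
  have im: "\<sigma> ` Y = Y" by (rule endo_inj_surj[OF finite_subset[of _ "{0..<p ^ Suc m}"] sub inj]) (auto simp: Y_def)
  have "(\<Sum>y\<in>Y. h (q y)) = (\<Sum>y\<in>\<sigma> ` Y. h (q y))" using im by simp
  also have "\<dots> = (\<Sum>y\<in>Y. h (q (\<sigma> y)))" by (simp add: sum.reindex[OF inj])
  also have "\<dots> = (\<Sum>y\<in>Y. h (q y + p ^ m))"
  proof (rule sum.cong[OF refl], rule h)
    fix y assume "y \<in> Y"
    have "[\<sigma> y = y + \<delta> y] (mod p ^ Suc m)" by (simp add: \<sigma>_def cong_def)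
    then have "[q (\<sigma> y) = q (y + \<delta> y)] (mod p ^ Suc m)"
      unfolding q_def by (intro cong_add cong_mult cong_refl)
    with \<delta>(4)[of y] \<open>y \<in> Y\<close> show "[q (\<sigma> y) = q y + p ^ m] (mod p ^ Suc m)"
      unfolding Y_def by (auto intro: cong_trans)
  qed
  finally show ?thesis
    by (simp add: Y_def q_def sum.If_cases del: power_Suc)
qed

text \<open>Outside \<open>low\<close> one variable can be moved while the other is fixed. In a
  binary block half the derivative in y is \<open>a * y + b * z\<close>, a unit whenever z is one,
  since p divides a. So pairs with z a unit are moved in y, and the other ones, with z divisible by
  p and y a unit, are moved in z.\<close>

lemma hensel_block:
  fixes p :: int and h :: "int \<Rightarrow> int"
  assumes p: "prime p" and m: "m \<ge> 1" "p = 2 \<Longrightarrow> m \<ge> 3" and good: "good_block p B"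
    and h: "\<And>v v'. [v = v'] (mod p ^ Suc m) \<Longrightarrow> h v = h v'"
  shows "(\<Sum>y\<in>{0..<p ^ Suc m}. \<Sum>z\<in>{0..<p ^ Suc m}. if \<not> low p B y z then h (bval B y z + p ^ m) else 0)
       = (\<Sum>y\<in>{0..<p ^ Suc m}. \<Sum>z\<in>{0..<p ^ Suc m}. if \<not> low p B y z then h (bval B y z) else 0)"
proof -
  have p1: "p > 1" using p prime_gt_1_int by auto
  let ?D = "{0..<p ^ Suc m}"
  from good p1 show ?thesis
  proof (cases rule: shift_block_cases)
    case (binary a b c)
    have nb: "\<not> p dvd b * y" "\<not> p dvd b * y" if "\<not> p dvd y" for y
      using that binary p by (auto simp: prime_dvd_mult_iff)
    have split: "(\<Sum>y\<in>?D. \<Sum>z\<in>?D. if \<not> low p B y z then h (bval B y z + x) else 0)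
      = (\<Sum>z\<in>?D. if \<not> p dvd z then \<Sum>y\<in>?D. if True then h (a * y * y + 2 * (b * z) * y + c * z * z + x) else 0 else 0)
      + (\<Sum>y\<in>?D. if \<not> p dvd y then \<Sum>z\<in>?D. if p dvd z then h (c * z * z + 2 * (b * y) * z + a * y * y + x) else 0 else 0)" for x
    proof -
      have "(\<Sum>y\<in>?D. \<Sum>z\<in>?D. if \<not> low p B y z then h (bval B y z + x) else 0)
        = (\<Sum>y\<in>?D. \<Sum>z\<in>?D. (if \<not> p dvd z then h (bval B y z + x) else 0)
            + (if \<not> p dvd y then if p dvd z then h (bval B y z + x) else 0 else 0))"
        using binary by (intro sum.cong refl) auto
      also have "\<dots> = (\<Sum>y\<in>?D. \<Sum>z\<in>?D. if \<not> p dvd z then h (bval B y z + x) else 0)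
        + (\<Sum>y\<in>?D. \<Sum>z\<in>?D. if \<not> p dvd y then if p dvd z then h (bval B y z + x) else 0 else 0)"
        by (simp only: sum.distrib)
      also have "(\<Sum>y\<in>?D. \<Sum>z\<in>?D. if \<not> p dvd z then h (bval B y z + x) else 0)
        = (\<Sum>z\<in>?D. \<Sum>y\<in>?D. if \<not> p dvd z then h (bval B y z + x) else 0)" by (rule sum.swap)
      also have "\<dots> = (\<Sum>z\<in>?D. if \<not> p dvd z then \<Sum>y\<in>?D. if True then h (a * y * y + 2 * (b * z) * y + c * z * z + x) else 0 else 0)"
        using binary by (intro sum.cong refl) (auto simp: algebra_simps)
      also have "(\<Sum>y\<in>?D. \<Sum>z\<in>?D. if \<not> p dvd y then if p dvd z then h (bval B y z + x) else 0 else 0)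
        = (\<Sum>y\<in>?D. if \<not> p dvd y then \<Sum>z\<in>?D. if p dvd z then h (c * z * z + 2 * (b * y) * z + a * y * y + x) else 0 else 0)"
        using binary by (intro sum.cong refl) (auto simp: algebra_simps intro!: sum.cong)
      finally show ?thesis .
    qed
    have "(\<Sum>y\<in>?D. if True then h (a * y * y + 2 * (b * z) * y + c * z * z + p ^ m) else 0)
        = (\<Sum>y\<in>?D. if True then h (a * y * y + 2 * (b * z) * y + c * z * z) else 0)" if "\<not> p dvd z" for z
      using nb[OF that] binary(3) by (intro hensel_unary[OF p m _ _ h]) (auto simp: dvd_add_right_iff)
    moreover have "(\<Sum>z\<in>?D. if p dvd z then h (c * z * z + 2 * (b * y) * z + a * y * y + p ^ m) else 0)
        = (\<Sum>z\<in>?D. if p dvd z then h (c * z * z + 2 * (b * y) * z + a * y * y) else 0)" if "\<not> p dvd y" for y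
      using nb[OF that] binary(4) by (intro hensel_unary[OF p m _ _ h]) (auto simp: dvd_add_right_iff cong_dvd_iff)
    ultimately show ?thesis
      using split[of "p ^ m"] split[of 0] by (simp cong: if_cong del: power_Suc)
  next
    case (unary a)
    have sw: "(\<Sum>y\<in>?D. \<Sum>z\<in>?D. f y) = (\<Sum>z\<in>?D. \<Sum>y\<in>?D. f y)" for f :: "int \<Rightarrow> int"
      by (rule sum.swap)
    have "(\<Sum>y\<in>?D. if \<not> p dvd y then h (a * y * y + 2 * 0 * y + 0 + p ^ m) else 0)
        = (\<Sum>y\<in>?D. if \<not> p dvd y then h (a * y * y + 2 * 0 * y + 0) else 0)"
      using unary p by (intro hensel_unary[OF p m _ _ h]) (auto simp: prime_dvd_mult_iff cong_dvd_iff)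
    then have "(\<Sum>z\<in>?D. \<Sum>y\<in>?D. if \<not> p dvd y then h (a * y * y + p ^ m) else 0)
        = (\<Sum>z\<in>?D. \<Sum>y\<in>?D. if \<not> p dvd y then h (a * y * y) else 0)"
      by (simp only: mult_zero_left mult_zero_right add_0_right)
    then have "(\<Sum>y\<in>?D. \<Sum>z\<in>?D. if \<not> p dvd y then h (a * y * y + p ^ m) else 0)
        = (\<Sum>y\<in>?D. \<Sum>z\<in>?D. if \<not> p dvd y then h (a * y * y) else 0)"
      by (simp only: sw)
    then show ?thesis using unary by (simp only: bval.simps low.simps) (simp cong: if_cong del: power_Suc sum_constant)
  next
    case (divisible a b c)
    then show ?thesis by (simp del: power_Suc)
  qed
qed

text \<open>Points outside \<open>low\<close> split into X, where already the tail is outside, and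
  Y, where the tail is in \<open>low\<close> and the head is not. X is the induction hypothesis. In
  Y the head absorbs any multiple of \<open>p ^ m\<close>, so the count at level m + 1 is the
  average over the p lifts of t, which \<open>cnt_lift\<close> evaluates. The factor p on the left
  avoids a truncated subtraction in the exponent.\<close>

lemma hensel_step:
  assumes p: "prime p" and m: "m \<ge> 1" "p = 2 \<Longrightarrow> m \<ge> 3" and good: "\<forall>B\<in>set L. good_block p B"
  shows "p * (cnt p free (Suc m) L t - cnt p (low p) (Suc m) L t)
       = p ^ (2 * length L) * (cnt p free m L t - cnt p (low p) m L t)"
  using good
proof (induction L arbitrary: t)
  case (Cons B L)
  have p1: "p > 1" using p prime_gt_1_int by auto
  have gB: "good_block p B" using Cons.prems by simp
  define f where "f = (\<lambda>m. cnt p free m L)"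
  define e where "e = (\<lambda>m. cnt p (low p) m L)"
  define D where "D = (\<lambda>m::nat. {0..<p ^ m})"
  define X where "X = (\<lambda>m. \<Sum>y\<in>D m. \<Sum>z\<in>D m. f m (t + bval B y z) - e m (t + bval B y z))"
  define Y where "Y = (\<lambda>m. \<Sum>y\<in>D m. \<Sum>z\<in>D m. if \<not> low p B y z then e m (t + bval B y z) else 0)"
  have split: "cnt p free m (B # L) t - cnt p (low p) m (B # L) t = X m + Y m" for m
    unfolding cnt_Cons free_def[of B] sum_subtractf[symmetric] X_def Y_def sum.distrib[symmetric] f_def e_def D_def
    by (intro sum.cong refl) auto
  have pm: "[x + p ^ m = x] (mod p)" for x using m(1) by (simp add: cong_iff_dvd_diff dvd_power)
  have c2: "[x + p ^ m = x] (mod p ^ m)" for x by (simp add: cong_def)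
  have eper: "e m (t + bval B (y + p ^ m) z) = e m (t + bval B y z)"
     "e m (t + bval B y (z + p ^ m)) = e m (t + bval B y z)"
     "f m (t + bval B (y + p ^ m) z) = f m (t + bval B y z)"
     "f m (t + bval B y (z + p ^ m)) = f m (t + bval B y z)" for y z
    unfolding e_def f_def by (intro cnt_cong cong_add bval_cong cong_refl c2)+
  have lper: "low p B (y + p ^ m) z = low p B y z" "low p B y (z + p ^ m) = low p B y z" for y z
    using locally_periodicD[OF locally_periodic_low pm cong_refl]
      locally_periodicD[OF locally_periodic_low cong_refl pm] by blast+
  have "p * X (Suc m) = (\<Sum>y\<in>D (Suc m). \<Sum>z\<in>D (Suc m). p ^ (2 * length L) * (f m (t + bval B y z) - e m (t + bval B y z)))"
    unfolding X_def sum_distrib_left using Cons by (simp add: f_def e_def del: power_Suc)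
  also have "\<dots> = (\<Sum>y\<in>{0..<p * p ^ m}. \<Sum>z\<in>{0..<p * p ^ m}. p ^ (2 * length L) * (f m (t + bval B y z) - e m (t + bval B y z)))"
    by (simp add: D_def)
  also have "\<dots> = p\<^sup>2 * (\<Sum>y\<in>{0..<p ^ m}. \<Sum>z\<in>{0..<p ^ m}. p ^ (2 * length L) * (f m (t + bval B y z) - e m (t + bval B y z)))"
    using p1 by (intro sum_pair_periodic) (simp_all add: eper)
  finally have X: "p * X (Suc m) = p\<^sup>2 * p ^ (2 * length L) * X m"
    by (simp add: X_def D_def sum_distrib_left mult_ac)
  have Ysh: "Y (Suc m) = (\<Sum>y\<in>D (Suc m). \<Sum>z\<in>D (Suc m). if \<not> low p B y z then e (Suc m) (t + bval B y z + int j * p ^ m) else 0)" for j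
  proof (induction j)
    case (Suc j)
    have "(\<Sum>y\<in>{0..<p ^ Suc m}. \<Sum>z\<in>{0..<p ^ Suc m}. if \<not> low p B y z then (\<lambda>v. e (Suc m) (t + v + int j * p ^ m)) (bval B y z + p ^ m) else 0)
       = (\<Sum>y\<in>{0..<p ^ Suc m}. \<Sum>z\<in>{0..<p ^ Suc m}. if \<not> low p B y z then (\<lambda>v. e (Suc m) (t + v + int j * p ^ m)) (bval B y z) else 0)"
      by (rule hensel_block[OF p m gB]) (auto simp: e_def intro!: cnt_cong cong_add)
    then show ?case using Suc by (simp add: D_def algebra_simps del: power_Suc cong: if_cong)
  qed (simp add: Y_def cong: if_cong)
  have "p * Y (Suc m) = (\<Sum>j\<in>{0..<p}. Y (Suc m))" using p1 by simp
  also have "\<dots> = (\<Sum>j\<in>{0..<p}. \<Sum>y\<in>D (Suc m). \<Sum>z\<in>D (Suc m). if \<not> low p B y z then e (Suc m) (t + bval B y z + j * p ^ m) else 0)"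
  proof (rule sum.cong[OF refl])
    fix j assume "j \<in> {0..<p}"
    then show "Y (Suc m) = (\<Sum>y\<in>D (Suc m). \<Sum>z\<in>D (Suc m). if \<not> low p B y z then e (Suc m) (t + bval B y z + j * p ^ m) else 0)"
      using Ysh[of "nat j"] by (simp cong: if_cong)
  qed
  also have "\<dots> = (\<Sum>y\<in>D (Suc m). \<Sum>j\<in>{0..<p}. \<Sum>z\<in>D (Suc m). if \<not> low p B y z then e (Suc m) (t + bval B y z + j * p ^ m) else 0)"
    by (rule sum.swap)
  also have "\<dots> = (\<Sum>y\<in>D (Suc m). \<Sum>z\<in>D (Suc m). \<Sum>j\<in>{0..<p}. if \<not> low p B y z then e (Suc m) (t + bval B y z + j * p ^ m) else 0)"
    by (intro sum.cong refl sum.swap)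
  also have "\<dots> = (\<Sum>y\<in>D (Suc m). \<Sum>z\<in>D (Suc m). if \<not> low p B y z then p ^ (2 * length L) * e m (t + bval B y z) else 0)"
  proof (intro sum.cong refl)
    fix y z
    show "(\<Sum>j\<in>{0..<p}. if \<not> low p B y z then e (Suc m) (t + bval B y z + j * p ^ m) else 0)
      = (if \<not> low p B y z then p ^ (2 * length L) * e m (t + bval B y z) else 0)"
      using cnt_lift[OF p1 m(1) locally_periodic_low, of L "t + bval B y z"] by (simp add: e_def del: power_Suc)
  qed
  also have "\<dots> = (\<Sum>y\<in>{0..<p * p ^ m}. \<Sum>z\<in>{0..<p * p ^ m}. if \<not> low p B y z then p ^ (2 * length L) * e m (t + bval B y z) else 0)"
    by (simp add: D_def)
  also have "\<dots> = p\<^sup>2 * (\<Sum>y\<in>{0..<p ^ m}. \<Sum>z\<in>{0..<p ^ m}. if \<not> low p B y z then p ^ (2 * length L) * e m (t + bval B y z) else 0)"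
    using p1 by (intro sum_pair_periodic) (simp_all add: eper lper)
  also have "(\<Sum>y\<in>{0..<p ^ m}. \<Sum>z\<in>{0..<p ^ m}. if \<not> low p B y z then p ^ (2 * length L) * e m (t + bval B y z) else 0)
     = p ^ (2 * length L) * Y m"
    unfolding Y_def sum_distrib_left D_def by (intro sum.cong refl) simp
  finally have Y: "p * Y (Suc m) = p\<^sup>2 * p ^ (2 * length L) * Y m" by simp
  show ?case unfolding split distrib_left X Y by (simp add: algebra_simps power_add power2_eq_square)
qed (simp add: cnt_Nil)

lemma hensel_iterate:
  assumes p: "prime p" and m: "m \<ge> 1" "p = 2 \<Longrightarrow> m \<ge> 3" and good: "\<forall>B\<in>set L. good_block p B"
    and L: "L \<noteq> []"
  shows "cnt p free (m + j) L t - cnt p (low p) (m + j) L t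
       = p ^ ((2 * length L - 1) * j) * (cnt p free m L t - cnt p (low p) m L t)"
proof (induction j)
  case (Suc j)
  have p1: "p > 1" using p prime_gt_1_int by auto
  have "p * (cnt p free (m + Suc j) L t - cnt p (low p) (m + Suc j) L t)
      = p ^ (2 * length L) * (cnt p free (m + j) L t - cnt p (low p) (m + j) L t)"
    using hensel_step[OF p _ _ good, of "m + j" t] m by fastforce
  also have "p ^ (2 * length L) = p * p ^ (2 * length L - 1)"
    using L by (metis length_greater_0_conv nat_0_less_mult_iff pos2 power_minus_mult mult.commute)
  finally have "cnt p free (m + Suc j) L t - cnt p (low p) (m + Suc j) L t
      = p ^ (2 * length L - 1) * (cnt p free (m + j) L t - cnt p (low p) (m + j) L t)"
    using p1 by (simp only: mult.assoc mult_left_cancel)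
  moreover have "p ^ ((2 * length L - 1) * Suc j) = p ^ (2 * length L - 1) * p ^ ((2 * length L - 1) * j)"
    by (simp only: mult_Suc_right power_add)
  ultimately show ?case by (simp only: Suc.IH mult.assoc)
qed simp

text \<open>Zeros outside \<open>low\<close> lift from level c with the factor R; zeros inside, at
  either level, are given by \<open>cnt_low\<close>. Expressing the former as F c - E c brings in
  the count at level \<open>c - 1\<close> with the coefficient \<open>- R\<close>.\<close>

lemma cnt_recursion:
  fixes p t :: int and j :: nat
  assumes p: "prime p" and c: "c \<ge> 1" "p = 2 \<Longrightarrow> c \<ge> 3" and good: "\<forall>B\<in>set L. good_block p B"
    and L: "L \<noteq> []"
  defines "W \<equiv> (if p dvd t then prod_list (map (low_factor p) L) else 0)"
    and "R \<equiv> p ^ ((2 * length L - 1) * j)"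
    and "L' \<equiv> map (shift_block p) L"
  shows "cnt p free (c + j) L t
    = R * cnt p free c L t + W * (cnt p free (c + j - 1) L' (t div p) - R * cnt p free (c - 1) L' (t div p))"
proof -
  have p1: "p > 1" using p prime_gt_1_int by auto
  have E: "cnt p (low p) (c + i) L t = W * cnt p free (c + i - 1) L' (t div p)" for i
    using cnt_low[OF p1 good, of "c + i - 1" t] c(1) by (auto simp: W_def L'_def)
  show ?thesis using hensel_iterate[OF p c good L, of j t] E[of j] E[of 0]
    by (simp add: R_def algebra_simps)
qed

text \<open>Multiplying form, target and modulus by p does not change the condition, while every
  variable gains p lifts.\<close>

lemma cnt_scale:
  assumes "p > 1"
  shows "cnt p free (Suc m) (map (scale_block p) L) (p * t) = p ^ (2 * length L) * cnt p free m L t"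
proof (induction L arbitrary: t)
  case (Cons B L)
  have per: "cnt p free m L (v + bval B (y + p ^ m) z) = cnt p free m L (v + bval B y z)"
    "cnt p free m L (v + bval B y (z + p ^ m)) = cnt p free m L (v + bval B y z)" for v y z
    by (intro cnt_cong cong_add bval_cong cong_refl; simp add: cong_def)+
  have "cnt p free (Suc m) (map (scale_block p) (B # L)) (p * t)
    = (\<Sum>y\<in>{0..<p * p ^ m}. \<Sum>z\<in>{0..<p * p ^ m}. cnt p free (Suc m) (map (scale_block p) L) (p * (t + bval B y z)))"
    by (simp add: cnt_Cons free_def bval_scale algebra_simps)
  also have "\<dots> = p\<^sup>2 * (\<Sum>y\<in>{0..<p ^ m}. \<Sum>z\<in>{0..<p ^ m}. cnt p free (Suc m) (map (scale_block p) L) (p * (t + bval B y z)))"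
    using assms by (intro sum_pair_periodic) (simp_all only: Cons.IH per, simp_all)
  also have "\<dots> = p ^ (2 * length (B # L)) * cnt p free m (B # L) t"
    unfolding Cons.IH by (simp add: cnt_Cons free_def sum_distrib_left power2_eq_square mult_ac)
  finally show ?case .
qed (use assms in \<open>simp add: cnt_Nil\<close>)

lemma bsum_scale:
  "bsum free M L (\<lambda>v. g (q * v)) t = bsum free M (map (scale_block q) L) g (q * t)"
  by (induction L arbitrary: t) (simp_all add: free_def bval_scale algebra_simps)

section \<open>Quadratic characters and zeros modulo an odd prime\<close>

lemma dvd_less_imp_0: "p dvd x \<Longrightarrow> 0 \<le> x \<Longrightarrow> x < p \<Longrightarrow> x = (0::int)"
  using zdvd_imp_le[of p x] by linarith

lemma Legendre_cong: "[a = b] (mod p) \<Longrightarrow> Legendre a p = Legendre b p"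
  by (simp add: Legendre_def QuadRes_def cong_def)

lemma Legendre_0: "p dvd a \<Longrightarrow> Legendre a p = 0"
  by (simp add: Legendre_def cong_0_iff)

lemma Legendre_values: "Legendre a p \<in> {0, 1, -1}"
  by (simp add: Legendre_def)

context
  fixes p :: int
  assumes p: "prime p" and p2: "p \<noteq> 2"
begin

private lemma p3: "p \<ge> 3" using p p2 prime_ge_2_int[OF p] by linarith

lemma Legendre_power: "[Legendre a p = a ^ ((nat p - 1) div 2)] (mod p)"
  using euler_criterion[of "nat p" a] p p3 by simp

text \<open>Two of the values 0, 1, -1 differ by at most 2, which is less than p.\<close>

lemma Legendre_eqI: "x \<in> {0, 1, -1} \<Longrightarrow> [Legendre a p = x] (mod p) \<Longrightarrow> Legendre a p = x"
proof -
  assume x: "x \<in> {0, 1, -1}" and "[Legendre a p = x] (mod p)"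
  then have d: "p dvd Legendre a p - x" by (simp add: cong_iff_dvd_diff)
  have "\<bar>Legendre a p - x\<bar> < p" using x Legendre_values[of a p] p3 by auto
  with d have "Legendre a p - x = 0" using dvd_imp_le_int[of "Legendre a p - x" p] by auto
  then show ?thesis by simp
qed

lemma Legendre_mult: "Legendre (a * b) p = Legendre a p * Legendre b p"
proof (rule Legendre_eqI)
  have "[a ^ ((nat p - 1) div 2) * b ^ ((nat p - 1) div 2) = Legendre a p * Legendre b p] (mod p)"
    by (intro cong_mult cong_sym[OF Legendre_power])
  then show "[Legendre (a * b) p = Legendre a p * Legendre b p] (mod p)"
    using Legendre_power[of "a * b"] by (auto simp: power_mult_distrib intro: cong_trans)
qed (use Legendre_values[of a p] Legendre_values[of b p] in auto)

lemma Legendre_minus_1: "Legendre (-1) p = (if even ((nat p - 1) div 2) then 1 else -1)"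
  by (rule Legendre_eqI, simp) (use Legendre_power[of "-1"] in auto)

lemma square_roots_count: "(\<Sum>x\<in>{0..<p}. of_bool (p dvd x * x - t)) = 1 + Legendre t p"
proof -
  define S where "S = {x \<in> {0..<p}. p dvd x * x - t}"
  have "(\<Sum>x\<in>{0..<p}. of_bool (p dvd x * x - t)) = int (card S)"
    by (simp add: S_def sum.If_cases of_bool_def Int_def)
  also have "int (card S) = 1 + Legendre t p"
  proof (cases "\<exists>y. p dvd y * y - t")
    case False
    then have "\<not> QuadRes p t" by (simp add: QuadRes_def cong_iff_dvd_diff power2_eq_square)
    moreover have "\<not> p dvd t" using False[simplified, rule_format, of 0] by simp
    ultimately show ?thesis using False by (simp add: S_def Legendre_def cong_0_iff)
  next
    case True
    then obtain y0 where y0: "p dvd y0 * y0 - t" by auto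
    define y where "y = y0 mod p"
    have "[y * y = y0 * y0] (mod p)" unfolding y_def by (intro cong_mult) (simp_all add: cong_def)
    moreover have "[y0 * y0 = t] (mod p)" using y0 by (simp add: cong_iff_dvd_diff)
    ultimately have y: "[y * y = t] (mod p)" by (rule cong_trans)
    have yr: "0 \<le> y" "y < p" using p3 by (simp_all add: y_def)
    have mem: "x \<in> S \<longleftrightarrow> 0 \<le> x \<and> x < p \<and> (p dvd x - y \<or> p dvd x + y)" for x
    proof -
      have "p dvd x * x - t \<longleftrightarrow> [x * x = t] (mod p)" by (simp add: cong_iff_dvd_diff)
      also have "\<dots> \<longleftrightarrow> [x * x = y * y] (mod p)" using y by (meson cong_sym cong_trans)
      also have "\<dots> \<longleftrightarrow> p dvd (x - y) * (x + y)" by (simp add: cong_iff_dvd_diff algebra_simps)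
      finally show ?thesis using p by (auto simp: S_def prime_dvd_mult_iff)
    qed
    have QR: "QuadRes p t" using y by (auto simp: QuadRes_def power2_eq_square)
    show ?thesis
    proof (cases "y = 0")
      case True
      then have "S = {0}" using p3 by (auto simp: mem dest: dvd_less_imp_0)
      moreover have "[t = 0] (mod p)" using y True by (auto simp: cong_sym_eq)
      ultimately show ?thesis by (simp add: Legendre_def)
    next
      case False
      have "x \<in> S \<longleftrightarrow> x = y \<or> x = p - y" for x
      proof
        assume x: "x \<in> S"
        then have "p dvd x - y \<or> p dvd x + y" by (simp add: mem)
        then show "x = y \<or> x = p - y"
        proof
          assume "p dvd x - y"
          moreover have "\<bar>x - y\<bar> < p" using x yr by (auto simp: mem)
          ultimately show ?thesis using dvd_imp_le_int[of "x - y" p] by auto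
        next
          assume "p dvd x + y"
          then have "p dvd x + y - p" by simp
          moreover have "\<bar>x + y - p\<bar> < p" using x yr False by (auto simp: mem)
          ultimately show ?thesis using dvd_imp_le_int[of "x + y - p" p] by auto
        qed
      qed (use yr False in \<open>auto simp: mem\<close>)
      then have "S = {y, p - y}" by auto
      moreover have "y \<noteq> p - y"
      proof
        assume "y = p - y"
        then have "even p" by presburger
        then show False using prime_odd_int[OF p] p3 by simp
      qed
      moreover have "\<not> [t = 0] (mod p)"
      proof
        assume "[t = 0] (mod p)"
        then have "p dvd y * y" using y by (metis cong_0_iff cong_trans)
        then have "p dvd y" using p by (simp add: prime_dvd_mult_iff)
        then show False using yr False by (auto dest: dvd_less_imp_0)
      qed
      ultimately show ?thesis using QR by (simp add: Legendre_def)
    qed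
  qed
  finally show ?thesis .
qed

private lemma per: "[v = v'] (mod p) \<Longrightarrow> of_bool (p dvd v) = (of_bool (p dvd v') :: int)"
  by (auto simp: of_bool_def dest: cong_dvd_iff)

lemma zero_count:
  assumes "\<not> p dvd a"
  shows "(\<Sum>x\<in>{0..<p}. of_bool (p dvd a * x + c)) = (1 :: int)"
proof -
  have cop: "coprime a p" using prime_imp_coprime[OF p assms] by (subst coprime_commute)
  define x0 where "x0 = (- c * modular_inverse p a) mod p"
  have "[a * x0 = a * (- c * modular_inverse p a)] (mod p)" by (intro cong_mult) (simp_all add: x0_def cong_def)
  moreover have "[- c * (a * modular_inverse p a) = - c * 1] (mod p)"
    by (intro cong_mult cong_refl cong_modular_inverse1[OF cop])
  ultimately have "[a * x0 = - c] (mod p)" by (metis cong_trans mult.left_commute mult.right_neutral)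
  then have x0: "p dvd a * x0 + c" by (simp add: cong_iff_dvd_diff)
  have x0r: "0 \<le> x0" "x0 < p" using p3 by (simp_all add: x0_def)
  have "p dvd a * x + c \<longleftrightarrow> x = x0" if x: "x \<in> {0..<p}" for x
  proof
    assume "p dvd a * x + c"
    then have "p dvd (a * x + c) - (a * x0 + c)" using x0 by (rule dvd_diff)
    then have "p dvd a * (x - x0)" by (simp add: algebra_simps)
    then have "p dvd x - x0" using assms p by (simp add: prime_dvd_mult_iff)
    moreover have "\<bar>x - x0\<bar> < p" using x x0r by auto
    ultimately show "x = x0" using dvd_imp_le_int[of "x - x0" p] by auto
  qed (use x0 in simp)
  then have "(\<Sum>x\<in>{0..<p}. of_bool (p dvd a * x + c)) = (\<Sum>x\<in>{0..<p}. if x = x0 then 1 else (0::int))"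
    by (intro sum.cong refl) auto
  then show ?thesis using x0r by simp
qed

text \<open>Count the pairs (x, t) with x^2 = t modulo p: summed over x first this gives
  \<open>1 + Legendre t p\<close> for each t, summed over t first it gives 1 for each x.\<close>

lemma sum_Legendre: "(\<Sum>t\<in>{0..<p}. Legendre t p) = 0"
proof -
  have "(\<Sum>t\<in>{0..<p}. 1 + Legendre t p) = (\<Sum>t\<in>{0..<p}. \<Sum>x\<in>{0..<p}. of_bool (p dvd x * x - t))"
    by (simp add: square_roots_count)
  also have "\<dots> = (\<Sum>x\<in>{0..<p}. \<Sum>t\<in>{0..<p}. of_bool (p dvd (-1) * t + x * x))"
    by (subst sum.swap) simp
  also have "\<dots> = (\<Sum>x\<in>{0..<p}. 1)"
    using p3 by (intro sum.cong refl zero_count) (auto dest: dvd_less_imp_0)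
  finally show ?thesis by (simp add: sum.distrib)
qed

text \<open>Count the pairs with y^2 = x^2 + c. Replacing y by y + x cancels x^2 and leaves y^2 +
  2xy = c, which is linear in x: one solution for each nonzero y, and for y = 0 either all x or
  none.\<close>

lemma sum_Legendre_square_plus:
  "(\<Sum>x\<in>{0..<p}. Legendre (x * x + c) p) = p * of_bool (p dvd c) - 1"
proof -
  have nd2: "\<not> p dvd 2" using p3 by (auto dest: dvd_less_imp_0)
  have "(\<Sum>x\<in>{0..<p}. 1 + Legendre (x * x + c) p)
      = (\<Sum>x\<in>{0..<p}. \<Sum>y\<in>{0..<p}. of_bool (p dvd (y + x) * (y + x) - (x * x + c)))"
  proof (rule sum.cong[OF refl])
    fix x
    have "(\<Sum>y\<in>{0..<p}. of_bool (p dvd (y + x) * (y + x) - (x * x + c)))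
        = (\<Sum>y\<in>{0..<p}. of_bool (p dvd y * y - (x * x + c)) :: int)"
      using p3 by (intro sum_int_shift[where h = "\<lambda>y. of_bool (p dvd y * y - (x * x + c))"] per cong_diff cong_mult) auto
    then show "1 + Legendre (x * x + c) p = (\<Sum>y\<in>{0..<p}. of_bool (p dvd (y + x) * (y + x) - (x * x + c)))"
      by (simp add: square_roots_count)
  qed
  also have "\<dots> = (\<Sum>y\<in>{0..<p}. \<Sum>x\<in>{0..<p}. of_bool (p dvd (2 * y) * x + (y * y - c)))"
    by (subst sum.swap) (simp add: algebra_simps)
  also have "\<dots> = (\<Sum>y\<in>{0..<p}. if y = 0 then p * of_bool (p dvd c) else 1)"
  proof (rule sum.cong[OF refl])
    fix y assume y: "y \<in> {0..<p}"
    show "(\<Sum>x\<in>{0..<p}. of_bool (p dvd (2 * y) * x + (y * y - c))) = (if y = 0 then p * of_bool (p dvd c) else 1)"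
    proof (cases "y = 0")
      case False
      then have "\<not> p dvd y" using y by (auto dest: dvd_less_imp_0)
      then have "\<not> p dvd 2 * y" using nd2 p by (simp add: prime_dvd_mult_iff)
      then show ?thesis using False zero_count by simp
    qed (use p3 in simp)
  qed
  also have "\<dots> = p * of_bool (p dvd c) + (p - 1)"
  proof -
    have "(\<Sum>y\<in>{0..<p}. if y = 0 then p * of_bool (p dvd c) else 1)
        = (\<Sum>y\<in>{0..<p}. (if y = 0 then p * of_bool (p dvd c) - 1 else 0) + 1)" by (intro sum.cong) auto
    also have "\<dots> = p * of_bool (p dvd c) - 1 + p" using p3 by (simp add: sum.distrib)
    finally show ?thesis by simp
  qed
  finally show ?thesis using p3 by (simp add: sum.distrib)
qed

text \<open>Modulo an odd prime the number of zeros of \<open>Q x + t\<close> depends only on the class of \<open>t\<close> modulo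
  squares, hence has the form \<open>A + B * of_bool (p dvd t) + C * Legendre t p\<close>.\<close>

fun class_count :: "int \<times> int \<times> int \<Rightarrow> int \<Rightarrow> int" where
  "class_count (A, B, C) t = A + B * of_bool (p dvd t) + C * Legendre t p"

text \<open>The effect of one more block on the three coefficients. In the unary case indicator and
  character exchange roles: summed over \<open>a * y * y\<close>, the indicator of t produces a
  character and the character an indicator. The outer factor p there belongs to the dummy
  variable.\<close>

fun class_step :: "block \<Rightarrow> int \<times> int \<times> int \<Rightarrow> int \<times> int \<times> int" where
  "class_step (a, b, c) (A, B, C) =
    (if \<not> p dvd b then (p\<^sup>2 * A + (p - 1) * B, p * B, p * C)
     else if \<not> p dvd a then
       (p * (p * A + B - C * Legendre a p), p * (p * (C * Legendre a p)),
        p * (B * (Legendre (-1) p * Legendre a p)))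
     else (p\<^sup>2 * A, p\<^sup>2 * B, p\<^sup>2 * C))"

private lemma class_cong: "[t = t'] (mod p) \<Longrightarrow> class_count X t = class_count X t'"
  by (cases X) (simp add: per Legendre_cong)

text \<open>With i the inverse of a, \<open>t + a * y * y\<close> is
  \<open>a * (y * y + i * t)\<close> modulo p, and i has the same character as a. The indicator then
  counts square roots of \<open>- i * t\<close>, and the character sum is
  \<open>sum_Legendre_square_plus\<close>.\<close>

private lemma sum_class_square:
  assumes a: "\<not> p dvd a"
  shows "(\<Sum>y\<in>{0..<p}. class_count (A, B, C) (t + a * y * y))
    = class_count (p * A + B - C * Legendre a p, p * (C * Legendre a p), B * (Legendre (-1) p * Legendre a p)) t"
proof -
  have cop: "coprime a p" using prime_imp_coprime[OF p a] by (subst coprime_commute)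
  define i where "i = modular_inverse p a"
  have i: "[a * i = 1] (mod p)" unfolding i_def by (rule cong_modular_inverse1[OF cop])
  have ni: "\<not> p dvd i"
  proof
    assume "p dvd i"
    then have "p dvd a * i" by simp
    then have "p dvd 1" using cong_dvd_iff[OF i] by simp
    then show False using p3 by simp
  qed
  have La: "Legendre i p = Legendre a p"
  proof -
    have "Legendre a p * Legendre i p = Legendre 1 p" using Legendre_cong[OF i] by (simp add: Legendre_mult)
    moreover have "Legendre 1 p = 1"
      using p3 by (auto simp: Legendre_def QuadRes_def cong_0_iff dest: dvd_less_imp_0 intro!: exI[of _ 1])
    ultimately show ?thesis using Legendre_values[of a p] Legendre_values[of i p] by auto
  qed
  have eq: "[t + a * y * y = a * (y * y + i * t)] (mod p)" for y
  proof -
    have "[a * y * y + (a * i) * t = a * y * y + 1 * t] (mod p)" by (intro cong_add cong_mult cong_refl i)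
    then show ?thesis by (simp add: algebra_simps cong_sym)
  qed
  have B: "(\<Sum>y\<in>{0..<p}. of_bool (p dvd t + a * y * y)) = 1 + Legendre (-1) p * Legendre a p * Legendre t p"
  proof -
    have "(\<Sum>y\<in>{0..<p}. of_bool (p dvd t + a * y * y)) = (\<Sum>y\<in>{0..<p}. of_bool (p dvd y * y - (-1) * i * t) :: int)"
    proof (rule sum.cong[OF refl])
      fix y
      have "p dvd t + a * y * y \<longleftrightarrow> p dvd y * y + i * t"
        using cong_dvd_iff[OF eq] a p by (simp add: prime_dvd_mult_iff)
      then show "of_bool (p dvd t + a * y * y) = (of_bool (p dvd y * y - (-1) * i * t) :: int)" by simp
    qed
    also have "\<dots> = 1 + Legendre (-1 * i * t) p" by (rule square_roots_count)
    finally show ?thesis by (simp only: Legendre_mult La)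
  qed
  have C: "(\<Sum>y\<in>{0..<p}. Legendre (t + a * y * y) p) = Legendre a p * (p * of_bool (p dvd t) - 1)"
  proof -
    have "(\<Sum>y\<in>{0..<p}. Legendre (t + a * y * y) p) = (\<Sum>y\<in>{0..<p}. Legendre a p * Legendre (y * y + i * t) p)"
      by (intro sum.cong refl) (metis Legendre_cong[OF eq] Legendre_mult)
    then show ?thesis using ni p
      by (simp add: sum_Legendre_square_plus prime_dvd_mult_iff flip: sum_distrib_left)
  qed
  have "(\<Sum>y\<in>{0..<p}. class_count (A, B, C) (t + a * y * y))
    = p * A + B * (\<Sum>y\<in>{0..<p}. of_bool (p dvd t + a * y * y)) + C * (\<Sum>y\<in>{0..<p}. Legendre (t + a * y * y) p)"
    using p3 by (simp add: sum.distrib sum_distrib_left del: of_bool_eq)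
  then show ?thesis unfolding B C by (simp add: algebra_simps)
qed

text \<open>\<open>t + a * z\<close> runs through all residues, so the character sums to 0 and the
  indicator to 1.\<close>

private lemma sum_class_linear:
  assumes a: "\<not> p dvd a"
  shows "(\<Sum>z\<in>{0..<p}. class_count (A, B, C) (t + a * z)) = p * A + B"
proof -
  have cop: "coprime a p" using prime_imp_coprime[OF p a] by (subst coprime_commute)
  define i where "i = modular_inverse p a"
  have i: "[a * i = 1] (mod p)" unfolding i_def by (rule cong_modular_inverse1[OF cop])
  have "(\<Sum>z\<in>{0..<p}. Legendre (a * z + t) p) = (\<Sum>z\<in>{0..<p}. Legendre (a * (z + i * t)) p)"
  proof (rule sum.cong[OF refl], rule Legendre_cong)
    fix z
    have "[a * z + 1 * t = a * z + (a * i) * t] (mod p)" by (intro cong_add cong_mult cong_refl cong_sym[OF i])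
    then show "[a * z + t = a * (z + i * t)] (mod p)" by (simp add: algebra_simps)
  qed
  also have "\<dots> = (\<Sum>z\<in>{0..<p}. Legendre (a * z) p)"
    using p3 by (intro sum_int_shift[where h = "\<lambda>z. Legendre (a * z) p"] Legendre_cong cong_mult) auto
  also have "\<dots> = 0" by (simp add: Legendre_mult sum_Legendre flip: sum_distrib_left)
  finally have "(\<Sum>z\<in>{0..<p}. Legendre (t + a * z) p) = 0" by (simp add: add.commute)
  moreover have "(\<Sum>z\<in>{0..<p}. of_bool (p dvd t + a * z)) = (1::int)"
    using zero_count[OF a, of t] by (simp add: add.commute)
  moreover have "(\<Sum>z\<in>{0..<p}. class_count (A, B, C) (t + a * z))
    = p * A + B * (\<Sum>z\<in>{0..<p}. of_bool (p dvd t + a * z)) + C * (\<Sum>z\<in>{0..<p}. Legendre (t + a * z) p)"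
    using p3 by (simp add: sum.distrib sum_distrib_left del: of_bool_eq)
  ultimately show ?thesis by simp
qed

lemma class_count_step:
  assumes good: "good_block p (a, b, c)"
  shows "(\<Sum>y\<in>{0..<p}. \<Sum>z\<in>{0..<p}. class_count X (t + bval (a, b, c) y z)) = class_count (class_step (a, b, c) X) t"
proof -
  have p1: "p > 1" using p3 by simp
  obtain A B C where X: "X = (A, B, C)" by (cases X)
  from good p1 show ?thesis
  proof (cases rule: shift_block_cases)
    case (binary a' b' c')
    \<comment> \<open>Modulo p the block is \<open>2 * b * y * z\<close>: the row y = 0 contributes
      p times the count at t, and every other row is linear in z and contributes
      \<open>p * A + B\<close>.\<close>
    have "(\<Sum>z\<in>{0..<p}. class_count X (t + bval (a, b, c) y z))
        = (if y = 0 then p * class_count X t - (p * A + B) else 0) + (p * A + B)" if y: "y \<in> {0..<p}" for y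
    proof -
      have "[t + bval (a, b, c) y z = t + 2 * b * y * z] (mod p)" for z
        using binary by (simp add: cong_iff_dvd_diff)
      then have *: "class_count X (t + bval (a, b, c) y z) = class_count X (t + 2 * b * y * z)" for z
        by (rule class_cong)
      show ?thesis
      proof (cases "y = 0")
        case True
        then show ?thesis using * p1 by simp
      next
        case False
        then have "\<not> p dvd y" using y by (auto dest: dvd_less_imp_0)
        moreover have "\<not> p dvd 2" using p3 by (auto dest: dvd_less_imp_0)
        ultimately have "\<not> p dvd 2 * b * y" using binary p by (simp add: prime_dvd_mult_iff)
        from sum_class_linear[OF this, of A B C t] show ?thesis
          unfolding * unfolding X using False by (simp only: if_False add_0_left)
      qed
    qed
    then have "(\<Sum>y\<in>{0..<p}. \<Sum>z\<in>{0..<p}. class_count X (t + bval (a, b, c) y z))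
       = (\<Sum>y\<in>{0..<p}. (if y = 0 then p * class_count X t - (p * A + B) else 0) + (p * A + B))"
      by (intro sum.cong refl) blast
    also have "\<dots> = p * class_count X t - (p * A + B) + p * (p * A + B)"
      using p1 by (simp add: sum.distrib)
    finally show ?thesis using binary by (simp add: X algebra_simps power2_eq_square)
  next
    case (unary a')
    then have na: "\<not> p dvd a" by simp
    have "(\<Sum>y\<in>{0..<p}. \<Sum>z\<in>{0..<p}. class_count X (t + bval (a, b, c) y z))
        = (\<Sum>z\<in>{0..<p}. \<Sum>y\<in>{0..<p}. class_count X (t + a * y * y))"
      using unary by (subst sum.swap) simp
    also have "\<dots> = p * (\<Sum>y\<in>{0..<p}. class_count X (t + a * y * y))" using p1 by simp
    finally have "(\<Sum>y\<in>{0..<p}. \<Sum>z\<in>{0..<p}. class_count X (t + bval (a, b, c) y z))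
      = p * class_count (p * A + B - C * Legendre a p, p * (C * Legendre a p), B * (Legendre (-1) p * Legendre a p)) t"
      unfolding X sum_class_square[OF na] .
    then show ?thesis using unary unfolding X by (simp only: class_count.simps class_step.simps) (simp add: algebra_simps)
  next
    case (divisible a' b' c')
    have "[t + bval (a, b, c) y z = t] (mod p)" for y z
      using divisible by (simp add: cong_iff_dvd_diff)
    then have "class_count X (t + bval (a, b, c) y z) = class_count X t" for y z by (rule class_cong)
    then show ?thesis using divisible p1 by (simp add: X power2_eq_square algebra_simps)
  qed
qed

text \<open>The fold starts from (0, 1, 0) because the empty sum of blocks has its zero exactly when
  p divides t.\<close>

lemma cnt_class:
  assumes "\<forall>B\<in>set L. good_block p B"
  shows "cnt p free (Suc 0) L t = class_count (foldr class_step L (0, 1, 0)) t"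
  using assms
proof (induction L arbitrary: t)
  case (Cons B L)
  obtain a b c where "B = (a, b, c)" by (cases B)
  with Cons show ?case
    using class_count_step[of a b c "foldr class_step L (0, 1, 0)" t]
    by (simp add: cnt_Cons free_def del: class_step.simps bval.simps)
qed (simp add: cnt_Nil)

end

section \<open>Splitting off pivots of a symmetric matrix\<close>

definition qform :: "nat set \<Rightarrow> (nat \<Rightarrow> nat \<Rightarrow> int) \<Rightarrow> (nat \<Rightarrow> int) \<Rightarrow> int" where
  "qform S M x = (\<Sum>l\<in>S. \<Sum>m\<in>S. M l m * x l * x m)"

text \<open>The test function g stays arbitrary because the two kinds of representations need
  different ones: divisibility of v - t, and of p^2 v - t.\<close>

definition form_sum :: "int \<Rightarrow> nat set \<Rightarrow> (nat \<Rightarrow> nat \<Rightarrow> int) \<Rightarrow> (int \<Rightarrow> int) \<Rightarrow> int \<Rightarrow> int" where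
  "form_sum P S M g v = (\<Sum>x\<in>S \<rightarrow>\<^sub>E {0..<P}. g (v + qform S M x))"

definition periodic :: "int \<Rightarrow> (int \<Rightarrow> int) \<Rightarrow> bool" where
  "periodic P g \<longleftrightarrow> (\<forall>v v'. [v = v'] (mod P) \<longrightarrow> g v = g v')"

lemma periodicD: "periodic P g \<Longrightarrow> [v = v'] (mod P) \<Longrightarrow> g v = g v'"
  by (simp add: periodic_def)

lemma sum_PiE_insert:
  assumes "i \<notin> S"
  shows "(\<Sum>x\<in>insert i S \<rightarrow>\<^sub>E D. h x) = (\<Sum>y\<in>D. \<Sum>x\<in>S \<rightarrow>\<^sub>E D. h (x(i := y)))"
proof -
  have "(\<Sum>x\<in>insert i S \<rightarrow>\<^sub>E D. h x) = (\<Sum>(y, x)\<in>D \<times> (S \<rightarrow>\<^sub>E D). h (x(i := y)))"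
    unfolding PiE_insert_eq
    by (subst sum.reindex[OF inj_combinator[OF assms]]) (simp add: case_prod_beta o_def)
  then show ?thesis by (simp add: sum.cartesian_product)
qed

lemma qform_cong:
  assumes "\<And>l m. l \<in> S \<Longrightarrow> m \<in> S \<Longrightarrow> [M l m = M' l m] (mod P)"
  shows "[qform S M x = qform S M' x] (mod P)"
  unfolding qform_def by (intro cong_sum cong_mult cong_refl assms)

lemma form_sum_cong:
  assumes "periodic P g" "\<And>l m. l \<in> S \<Longrightarrow> m \<in> S \<Longrightarrow> [M l m = M' l m] (mod P)"
  shows "form_sum P S M g v = form_sum P S M' g v"
  unfolding form_sum_def
  by (intro sum.cong refl periodicD[OF assms(1)] cong_add cong_refl qform_cong assms(2))

lemma qform_fun_upd: "i \<notin> S \<Longrightarrow> qform S M (x(i := y)) = qform S M x"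
  unfolding qform_def by (intro sum.cong refl) auto

lemma qform_insert:
  assumes "finite S" "i \<notin> S"
  shows "qform (insert i S) M x
    = M i i * x i * x i + (\<Sum>l\<in>S. (M i l + M l i) * x l) * x i + qform S M x"
  using assms by (simp add: qform_def sum.distrib sum_distrib_left sum_distrib_right algebra_simps)

lemma qform_rank_one:
  "qform S (\<lambda>l m. u l * w m) x = (\<Sum>l\<in>S. u l * x l) * (\<Sum>m\<in>S. w m * x m)"
  by (simp add: qform_def sum_product algebra_simps)

lemma qform_linear:
  "qform S (\<lambda>l m. M l m - c * N l m) x = qform S M x - c * qform S N x"
  "qform S (\<lambda>l m. M l m + N l m) x = qform S M x + qform S N x"
  "qform S (\<lambda>l m. c * N l m) x = c * qform S N x"
  by (simp_all add: qform_def sum_distrib_left sum.distrib sum_subtractf algebra_simps)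

lemma bsum_mult: "bsum free P L (\<lambda>v. c * f v) v = c * bsum free P L f v"
  by (induction L arbitrary: v) (simp_all add: bsum_Cons_free sum_distrib_left del: bsum.simps(2))

text \<open>Completing the square: the new variable is \<open>y + e * (\<Sum>l\<in>S. w l * x l)\<close>.\<close>

lemma eliminate_unary:
  assumes P: "P > 0" and g: "periodic P g" and S: "finite S" "i \<notin> S"
    and sym: "\<And>l. l \<in> S \<Longrightarrow> M l i = M i l"
    and w: "\<And>l. l \<in> S \<Longrightarrow> M i l = q * w l" and u: "M i i = q * u"
    and e: "[u * e = 1] (mod P)"
    and M': "\<And>l m. l \<in> S \<Longrightarrow> m \<in> S \<Longrightarrow> [M' l m = M l m - q * (e * (w l * w m))] (mod P)"
  shows "form_sum P (insert i S) M g v = (\<Sum>y\<in>{0..<P}. form_sum P S M' g (v + M i i * y * y))"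
proof -
  let ?D = "{0..<P}"
  define \<omega> where "\<omega> = (\<lambda>x. \<Sum>l\<in>S. w l * x l)"
  \<comment> \<open>From \<open>u * e = 1\<close> the square
    \<open>q * u * (y + e * \<omega> x)^2\<close> equals \<open>q * u * y^2 + 2 * q * y * \<omega> x
    + q * e * (\<omega> x)^2\<close> modulo P; its last term is the one subtracted in M'.\<close>
  have key: "g (v + qform (insert i S) M (x(i := y)))
     = g (v + M i i * (y + e * \<omega> x) * (y + e * \<omega> x) + qform S M' x)" for x y
  proof (rule periodicD[OF g])
    obtain r where "u * e - 1 = P * r" using e by (auto simp: cong_iff_dvd_diff)
    then have r: "u * e = 1 + P * r" by simp
    have lin: "(\<Sum>l\<in>S. (M i l + M l i) * (x(i := y)) l) = 2 * q * \<omega> x"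
      unfolding \<omega>_def sum_distrib_left using S sym w by (intro sum.cong refl) auto
    have "[qform S M' x = qform S (\<lambda>l m. M l m - (q * e) * (w l * w m)) x] (mod P)"
      using M' by (intro qform_cong) (simp add: mult.assoc)
    then have A: "[qform S M' x = qform S M x - q * e * (\<omega> x * \<omega> x)] (mod P)"
      by (simp only: qform_linear qform_rank_one \<omega>_def)
    have B: "M i i * (y + e * \<omega> x) * (y + e * \<omega> x) - q * e * (\<omega> x * \<omega> x)
       = q * u * y * y + 2 * q * y * \<omega> x + P * (2 * q * r * y * \<omega> x + q * e * r * \<omega> x * \<omega> x)"
    proof -
      have "M i i * (y + e * \<omega> x) * (y + e * \<omega> x)
        = q * u * y * y + 2 * q * (u * e) * y * \<omega> x + q * (u * e) * e * \<omega> x * \<omega> x"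
        by (simp add: u algebra_simps)
      also have "\<dots> = q * u * y * y + 2 * q * (1 + P * r) * y * \<omega> x + q * (1 + P * r) * e * \<omega> x * \<omega> x"
        by (simp only: r)
      finally show ?thesis by (simp add: algebra_simps)
    qed
    have "v + qform (insert i S) M (x(i := y)) = v + q * u * y * y + 2 * q * y * \<omega> x + qform S M x"
      using S lin by (simp add: qform_insert qform_fun_upd u)
    also have "[\<dots> = v + (M i i * (y + e * \<omega> x) * (y + e * \<omega> x) - q * e * (\<omega> x * \<omega> x)) + qform S M x] (mod P)"
      unfolding B cong_iff_dvd_diff
      by (rule dvdI[where k = "- (2 * q * r * y * \<omega> x + q * e * r * \<omega> x * \<omega> x)"]) (simp add: algebra_simps)
    also have "v + (M i i * (y + e * \<omega> x) * (y + e * \<omega> x) - q * e * (\<omega> x * \<omega> x)) + qform S M x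
        = v + M i i * (y + e * \<omega> x) * (y + e * \<omega> x) + (qform S M x - q * e * (\<omega> x * \<omega> x))" by simp
    also have "[\<dots> = v + M i i * (y + e * \<omega> x) * (y + e * \<omega> x) + qform S M' x] (mod P)"
      by (intro cong_add cong_refl cong_sym[OF A])
    finally show "[v + qform (insert i S) M (x(i := y))
      = v + M i i * (y + e * \<omega> x) * (y + e * \<omega> x) + qform S M' x] (mod P)" .
  qed
  have "form_sum P (insert i S) M g v
     = (\<Sum>y\<in>?D. \<Sum>x\<in>S \<rightarrow>\<^sub>E ?D. g (v + M i i * (y + e * \<omega> x) * (y + e * \<omega> x) + qform S M' x))"
    unfolding form_sum_def sum_PiE_insert[OF S(2)] key ..
  also have "\<dots> = (\<Sum>x\<in>S \<rightarrow>\<^sub>E ?D. \<Sum>y\<in>?D. g (v + M i i * (y + e * \<omega> x) * (y + e * \<omega> x) + qform S M' x))"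
    by (rule sum.swap)
  \<comment> \<open>For fixed x the offset \<open>e * \<omega> x\<close> is a constant, and
    translation does not change the sum over all residues y.\<close>
  also have "\<dots> = (\<Sum>x\<in>S \<rightarrow>\<^sub>E ?D. \<Sum>y\<in>?D. g (v + M i i * y * y + qform S M' x))"
    by (intro sum.cong refl sum_int_shift[OF P, where h = "\<lambda>y. g (v + M i i * y * y + qform S M' x)" for x]
         periodicD[OF g] cong_add cong_mult cong_refl)
  also have "\<dots> = (\<Sum>y\<in>?D. \<Sum>x\<in>S \<rightarrow>\<^sub>E ?D. g (v + M i i * y * y + qform S M' x))"
    by (rule sum.swap)
  finally show ?thesis by (simp only: form_sum_def)
qed

text \<open>Completing the square in two variables. The offsets (\<alpha>, \<beta>) are the inverse
  of the matrix with rows (a, b) and (b, c) applied to the linear forms (\<omega>, \<omega>'), with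
  d the inverse of its determinant; M' is the Schur complement. The common factor q is never
  inverted.\<close>

lemma eliminate_binary:
  assumes P: "P > 0" and g: "periodic P g" and S: "finite S" "i \<notin> S" "j \<notin> S" "i \<noteq> j"
    and sym: "\<And>l. l \<in> S \<Longrightarrow> M l i = M i l" "\<And>l. l \<in> S \<Longrightarrow> M l j = M j l" "M j i = M i j"
    and w: "\<And>l. l \<in> S \<Longrightarrow> M i l = q * w l" "\<And>l. l \<in> S \<Longrightarrow> M j l = q * w' l"
    and abc: "M i i = q * a" "M i j = q * b" "M j j = q * c"
    and d: "[(a * c - b * b) * d = 1] (mod P)"
    and M': "\<And>l m. l \<in> S \<Longrightarrow> m \<in> S \<Longrightarrow> [M' l m = M l m - q * (c * d * (w l * w m)
         + - (b * d) * (w l * w' m + w' l * w m) + a * d * (w' l * w' m))] (mod P)"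
  shows "form_sum P (insert i (insert j S)) M g v
    = (\<Sum>y\<in>{0..<P}. \<Sum>z\<in>{0..<P}. form_sum P S M' g (v + bval (M i i, M i j, M j j) y z))"
proof -
  let ?D = "{0..<P}"
  define \<omega> where "\<omega> = (\<lambda>x. \<Sum>l\<in>S. w l * x l)"
  define \<omega>' where "\<omega>' = (\<lambda>x. \<Sum>l\<in>S. w' l * x l)"
  define \<alpha> where "\<alpha> = (\<lambda>x. d * (c * \<omega> x - b * \<omega>' x))"
  define \<beta> where "\<beta> = (\<lambda>x. d * (a * \<omega>' x - b * \<omega> x))"
  let ?B = "bval (M i i, M i j, M j j)"
  have key: "g (v + qform (insert i (insert j S)) M (x(j := z, i := y)))
     = g (v + ?B (y + \<alpha> x) (z + \<beta> x) + qform S M' x)" for x y z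
  proof (rule periodicD[OF g])
    obtain r where "(a * c - b * b) * d - 1 = P * r" using d by (auto simp: cong_iff_dvd_diff)
    then have r: "(a * c - b * b) * d = 1 + P * r" by simp
    define R where "R = c * d * (\<omega> x * \<omega> x) + - (b * d) * (\<omega> x * \<omega>' x + \<omega>' x * \<omega> x) + a * d * (\<omega>' x * \<omega>' x)"
    define x' where "x' = x(j := z, i := y)"
    have lini: "(\<Sum>l\<in>S. (M i l + M l i) * x' l) = 2 * q * \<omega> x"
      unfolding \<omega>_def sum_distrib_left x'_def using S sym w by (intro sum.cong refl) auto
    have linj: "(\<Sum>l\<in>S. (M j l + M l j) * x' l) = 2 * q * \<omega>' x"
      unfolding \<omega>'_def sum_distrib_left x'_def using S sym w by (intro sum.cong refl) auto
    have "[qform S M' x = qform S (\<lambda>l m. M l m - q * (c * d * (w l * w m)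
         + - (b * d) * (w l * w' m + w' l * w m) + a * d * (w' l * w' m))) x] (mod P)"
      using M' by (rule qform_cong)
    then have A: "[qform S M' x = qform S M x - q * R] (mod P)"
      by (simp only: qform_linear qform_rank_one \<omega>_def \<omega>'_def R_def)
    have ab: "a * \<alpha> x + b * \<beta> x = ((a * c - b * b) * d) * \<omega> x" "b * \<alpha> x + c * \<beta> x = ((a * c - b * b) * d) * \<omega>' x"
      by (simp_all add: \<alpha>_def \<beta>_def algebra_simps)
    have R2: "R = \<alpha> x * \<omega> x + \<beta> x * \<omega>' x" by (simp add: R_def \<alpha>_def \<beta>_def algebra_simps)
    have B: "?B (y + \<alpha> x) (z + \<beta> x) - q * R
       = ?B y z + 2 * q * y * \<omega> x + 2 * q * z * \<omega>' x
         + P * (r * q * (2 * y * \<omega> x + 2 * z * \<omega>' x + R))"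
    proof -
      have "?B (y + \<alpha> x) (z + \<beta> x) = ?B y z + 2 * q * y * (a * \<alpha> x + b * \<beta> x) + 2 * q * z * (b * \<alpha> x + c * \<beta> x)
         + q * (\<alpha> x * (a * \<alpha> x + b * \<beta> x) + \<beta> x * (b * \<alpha> x + c * \<beta> x))"
        by (simp add: abc algebra_simps)
      then show ?thesis unfolding ab r R2 by (simp add: algebra_simps)
    qed
    have "v + qform (insert i (insert j S)) M x' = v + ?B y z + 2 * q * y * \<omega> x + 2 * q * z * \<omega>' x + qform S M x"
    proof -
      have "qform S M x' = qform S M x" using S by (simp add: x'_def qform_fun_upd)
      moreover have "x' i = y" "x' j = z" using S by (simp_all add: x'_def)
      ultimately show ?thesis using S sym(3) lini linj
        by (simp add: qform_insert algebra_simps)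
    qed
    also have "[\<dots> = v + (?B (y + \<alpha> x) (z + \<beta> x) - q * R) + qform S M x] (mod P)"
      unfolding B cong_iff_dvd_diff
      by (rule dvdI[where k = "- (r * q * (2 * y * \<omega> x + 2 * z * \<omega>' x + R))"]) (simp add: algebra_simps)
    also have "v + (?B (y + \<alpha> x) (z + \<beta> x) - q * R) + qform S M x
        = v + ?B (y + \<alpha> x) (z + \<beta> x) + (qform S M x - q * R)" by simp
    also have "[\<dots> = v + ?B (y + \<alpha> x) (z + \<beta> x) + qform S M' x] (mod P)"
      by (intro cong_add cong_refl cong_sym[OF A])
    finally show "[v + qform (insert i (insert j S)) M (x(j := z, i := y))
      = v + ?B (y + \<alpha> x) (z + \<beta> x) + qform S M' x] (mod P)" unfolding x'_def .
  qed
  have per: "[y = y'] (mod P) \<Longrightarrow> [z = z'] (mod P) \<Longrightarrow> g (v + ?B y z + t) = g (v + ?B y' z' + t)" for y y' z z' t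
    by (intro periodicD[OF g] cong_add cong_refl bval_cong)
  have shz: "(\<Sum>z\<in>?D. g (v + ?B y (z + s) + t)) = (\<Sum>z\<in>?D. g (v + ?B y z + t))" for y s t
    by (rule sum_int_shift[OF P, where h = "\<lambda>z. g (v + ?B y z + t)"]) (rule per[OF cong_refl])
  have shy: "(\<Sum>y\<in>?D. \<Sum>z\<in>?D. g (v + ?B (y + s) z + t)) = (\<Sum>y\<in>?D. \<Sum>z\<in>?D. g (v + ?B y z + t))" for s t
    by (rule sum_int_shift[OF P, where h = "\<lambda>y. \<Sum>z\<in>?D. g (v + ?B y z + t)"])
      (intro sum.cong refl per cong_refl)
  have iS: "i \<notin> insert j S" using S by simp
  have "form_sum P (insert i (insert j S)) M g v
     = (\<Sum>y\<in>?D. \<Sum>z\<in>?D. \<Sum>x\<in>S \<rightarrow>\<^sub>E ?D. g (v + ?B (y + \<alpha> x) (z + \<beta> x) + qform S M' x))"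
    unfolding form_sum_def sum_PiE_insert[OF iS] sum_PiE_insert[OF S(3)] key ..
  also have "\<dots> = (\<Sum>y\<in>?D. \<Sum>x\<in>S \<rightarrow>\<^sub>E ?D. \<Sum>z\<in>?D. g (v + ?B (y + \<alpha> x) (z + \<beta> x) + qform S M' x))"
    by (intro sum.cong refl sum.swap)
  also have "\<dots> = (\<Sum>y\<in>?D. \<Sum>x\<in>S \<rightarrow>\<^sub>E ?D. \<Sum>z\<in>?D. g (v + ?B (y + \<alpha> x) z + qform S M' x))"
    by (simp only: shz)
  also have "\<dots> = (\<Sum>x\<in>S \<rightarrow>\<^sub>E ?D. \<Sum>y\<in>?D. \<Sum>z\<in>?D. g (v + ?B (y + \<alpha> x) z + qform S M' x))"
    by (rule sum.swap)
  also have "\<dots> = (\<Sum>x\<in>S \<rightarrow>\<^sub>E ?D. \<Sum>y\<in>?D. \<Sum>z\<in>?D. g (v + ?B y z + qform S M' x))"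
    by (simp only: shy)
  also have "\<dots> = (\<Sum>y\<in>?D. \<Sum>x\<in>S \<rightarrow>\<^sub>E ?D. \<Sum>z\<in>?D. g (v + ?B y z + qform S M' x))"
    by (rule sum.swap)
  also have "\<dots> = (\<Sum>y\<in>?D. \<Sum>z\<in>?D. \<Sum>x\<in>S \<rightarrow>\<^sub>E ?D. g (v + ?B y z + qform S M' x))"
    by (intro sum.cong refl sum.swap)
  finally show ?thesis by (simp only: form_sum_def)
qed

text \<open>A unary pivot is stored as the block \<open>(a, 0, 0)\<close> with a dummy second variable, and a binary
  pivot is followed by a zero block, so that every index of the matrix accounts for one block.\<close>

definition decomposed ::
  "int \<Rightarrow> nat set \<Rightarrow> (nat \<Rightarrow> nat \<Rightarrow> int) \<Rightarrow> block list \<Rightarrow> nat set \<Rightarrow> (nat \<Rightarrow> nat \<Rightarrow> int) \<Rightarrow> bool" where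
  "decomposed P I Q L S M \<longleftrightarrow>
     (\<forall>g v. periodic P g \<longrightarrow> P ^ length L * form_sum P I Q g v = bsum free P L (form_sum P S M g) v)"

lemma decomposed_init:
  assumes "\<And>l m. l \<in> I \<Longrightarrow> m \<in> I \<Longrightarrow> [M l m = Q l m] (mod P)"
  shows "decomposed P I Q [] I M"
  using form_sum_cong[OF _ assms] by (simp add: decomposed_def)

lemma decomposed_append:
  assumes "decomposed P I Q L S M"
    and "\<And>g v. periodic P g \<Longrightarrow> P ^ length B * form_sum P S M g v = bsum free P B (form_sum P S' M' g) v"
  shows "decomposed P I Q (L @ B) S' M'"
  unfolding decomposed_def
proof (intro allI impI)
  fix g v assume g: "periodic P g"
  have "P ^ length (L @ B) * form_sum P I Q g v = P ^ length B * bsum free P L (form_sum P S M g) v"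
    using assms(1) g by (simp add: decomposed_def power_add mult_ac)
  also have "\<dots> = bsum free P L (\<lambda>v. P ^ length B * form_sum P S M g v) v" by (simp add: bsum_mult)
  also have "\<dots> = bsum free P (L @ B) (form_sum P S' M' g) v"
    by (simp add: bsum_append assms(2)[OF g])
  finally show "P ^ length (L @ B) * form_sum P I Q g v = bsum free P (L @ B) (form_sum P S' M' g) v" .
qed

lemma decomposed_unary:
  assumes dec: "decomposed P I Q L (insert i S) M" and P: "P > 0" and S: "finite S" "i \<notin> S"
    and sym: "\<And>l. l \<in> S \<Longrightarrow> M l i = M i l"
    and w: "\<And>l. l \<in> S \<Longrightarrow> M i l = q * w l" and u: "M i i = q * u"
    and e: "[u * e = 1] (mod P)"
    and M': "\<And>l m. l \<in> S \<Longrightarrow> m \<in> S \<Longrightarrow> [M' l m = M l m - q * (e * (w l * w m))] (mod P)"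
  shows "decomposed P I Q (L @ [(M i i, 0, 0)]) S M'"
proof (rule decomposed_append[OF dec])
  fix g v assume "periodic P g"
  have "form_sum P (insert i S) M g v = (\<Sum>y\<in>{0..<P}. form_sum P S M' g (v + M i i * y * y))" for v
    by (intro eliminate_unary[where w = w and q = q and u = u and e = e]; fact)
  then show "P ^ length [(M i i, 0, 0)] * form_sum P (insert i S) M g v
    = bsum free P [(M i i, 0, 0)] (form_sum P S M' g) v"
    using P by (simp add: bsum_Cons_free sum_distrib_left del: bsum.simps(2))
qed

text \<open>Two blocks, hence four variables, stand for two indices; the two variables of the zero
  block are dummies and supply the factor \<open>P ^ 2\<close>.\<close>

lemma decomposed_binary:
  assumes dec: "decomposed P I Q L (insert i (insert j S)) M" and P: "P > 0"
    and S: "finite S" "i \<notin> S" "j \<notin> S" "i \<noteq> j"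
    and sym: "\<And>l. l \<in> S \<Longrightarrow> M l i = M i l" "\<And>l. l \<in> S \<Longrightarrow> M l j = M j l" "M j i = M i j"
    and w: "\<And>l. l \<in> S \<Longrightarrow> M i l = q * w l" "\<And>l. l \<in> S \<Longrightarrow> M j l = q * w' l"
    and abc: "M i i = q * a" "M i j = q * b" "M j j = q * c"
    and d: "[(a * c - b * b) * d = 1] (mod P)"
    and M': "\<And>l m. l \<in> S \<Longrightarrow> m \<in> S \<Longrightarrow> [M' l m = M l m - q * (c * d * (w l * w m)
         + - (b * d) * (w l * w' m + w' l * w m) + a * d * (w' l * w' m))] (mod P)"
  shows "decomposed P I Q (L @ [(M i i, M i j, M j j), (0, 0, 0)]) S M'"
proof (rule decomposed_append[OF dec])
  fix g v assume "periodic P g"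
  have "form_sum P (insert i (insert j S)) M g v
    = (\<Sum>y\<in>{0..<P}. \<Sum>z\<in>{0..<P}. form_sum P S M' g (v + bval (M i i, M i j, M j j) y z))" for v
    by (intro eliminate_binary[where w = w and w' = w' and q = q and a = a and b = b and c = c and d = d]; fact)
  then show "P ^ length [(M i i, M i j, M j j), (0, 0, 0)] * form_sum P (insert i (insert j S)) M g v
    = bsum free P [(M i i, M i j, M j j), (0, 0, 0)] (form_sum P S M' g) v"
    using P by (simp add: bsum_Cons_free sum_distrib_left mult.assoc del: bsum.simps(2))
qed

text \<open>On the vanishing rest the form is constant. Each remaining index contributes P values on
  the left and P * P pairs of its zero block on the right, so again one factor P per index balances
  the two sides.\<close>

lemma decomposed_zero:
  assumes dec: "decomposed P I Q L S M" and P: "P > 0" and S: "finite S"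
    and zero: "\<And>l m. l \<in> S \<Longrightarrow> m \<in> S \<Longrightarrow> M l m = 0" and g: "periodic P g"
  shows "P ^ (length L + card S) * form_sum P I Q g v = bsum free P (L @ replicate (card S) (0, 0, 0)) g v"
proof -
  have "form_sum P S M g v = P ^ card S * g v" for v
    using P zero S by (simp add: form_sum_def qform_def card_PiE)
  moreover have "bsum free P (replicate N (0, 0, 0)) g v = P ^ (N + N) * g v" for N v
    using P by (induction N arbitrary: v) (simp_all add: bsum_Cons_free mult_ac del: bsum.simps(2))
  ultimately have *: "P ^ length (replicate (card S) (0::int, 0::int, 0::int)) * form_sum P S M g v
      = bsum free P (replicate (card S) (0, 0, 0)) g v" for v
    by (simp add: power_add)
  have "P ^ (length L + card S) * form_sum P I Q g v = P ^ card S * bsum free P L (form_sum P S M g) v"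
    using dec g by (simp add: decomposed_def power_add mult_ac)
  also have "\<dots> = bsum free P L (\<lambda>v. P ^ card S * form_sum P S M g v) v" by (simp add: bsum_mult)
  finally show ?thesis using * by (simp add: bsum_append)
qed

section \<open>From representations to sums over blocks\<close>

lemma scalar_prod_mult_mat_vec:
  assumes "Q \<in> carrier_mat n n" "x \<in> carrier_vec n"
  shows "x \<bullet> (Q *\<^sub>v x) = qform {..<n} (\<lambda>l m. Q $$ (l, m)) (\<lambda>i. x $ i)"
proof -
  have "x \<bullet> (Q *\<^sub>v x) = (\<Sum>l<n. x $ l * (\<Sum>m<n. Q $$ (l, m) * x $ m))"
    using assms by (simp add: scalar_prod_def lessThan_atLeast0 row_def)
  then show ?thesis by (simp add: qform_def sum_distrib_left mult_ac)
qed

lemma qform_restrict: "qform S M (restrict x S) = qform S M x"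
  unfolding qform_def by (intro sum.cong refl) simp

lemma qform_cong_arg:
  assumes "\<And>i. i \<in> S \<Longrightarrow> [x i = y i] (mod m)"
  shows "[qform S M x = qform S M y] (mod m)"
  unfolding qform_def using assms by (intro cong_sum cong_mult cong_refl) auto

lemma qform_mult: "qform S M (\<lambda>i. c * x i) = c\<^sup>2 * qform S M x"
  by (simp add: qform_def sum_distrib_left power2_eq_square mult_ac)

lemma finite_zmod_vecs: "finite (zmod_vecs p k n)"
proof (rule finite_subset)
  show "zmod_vecs p k n \<subseteq> vec n ` ({..<n} \<rightarrow>\<^sub>E {0..<int p ^ k})"
  proof
    fix x assume "x \<in> zmod_vecs p k n"
    then have "x = vec n (restrict (\<lambda>i. x $ i) {..<n})" "restrict (\<lambda>i. x $ i) {..<n} \<in> {..<n} \<rightarrow>\<^sub>E {0..<int p ^ k}"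
      by (auto simp: zmod_vecs_def)
    then show "x \<in> vec n ` ({..<n} \<rightarrow>\<^sub>E {0..<int p ^ k})" by blast
  qed
qed (simp add: finite_PiE)

lemma finite_representations: "finite (representations p k n Q t)"
  using finite_zmod_vecs by (simp add: representations_def)

lemma card_representations:
  assumes Q: "Q \<in> carrier_mat n n"
  shows "int (card (representations p k n Q t))
    = form_sum (int p ^ k) {..<n} (\<lambda>l m. Q $$ (l, m)) (\<lambda>v. of_bool (int p ^ k dvd v)) (- t)"
proof -
  let ?P = "int p ^ k" let ?q = "qform {..<n} (\<lambda>l m. Q $$ (l, m))"
  have "int (card (representations p k n Q t)) = (\<Sum>x\<in>zmod_vecs p k n. of_bool (?P dvd - t + ?q (\<lambda>i. x $ i)))"
  proof -
    have "representations p k n Q t = {x \<in> zmod_vecs p k n. ?P dvd - t + ?q (\<lambda>i. x $ i)}"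
      using Q by (auto simp: representations_def zmod_vecs_def scalar_prod_mult_mat_vec cong_iff_dvd_diff)
    then show ?thesis using finite_zmod_vecs[of p k n] by (simp add: Int_def)
  qed
  also have "\<dots> = (\<Sum>x\<in>{..<n} \<rightarrow>\<^sub>E {0..<?P}. of_bool (?P dvd - t + ?q x))"
  proof -
    have qr: "?q (\<lambda>i. if i < n then x i else undefined) = ?q x" for x
    using qform_restrict[of "{..<n}" _ x] by (simp add: restrict_def)
    show ?thesis
      by (rule sum.reindex_bij_witness[where i = "vec n" and j = "\<lambda>x. restrict (\<lambda>i. x $ i) {..<n}"])
      (auto simp: zmod_vecs_def qr PiE_iff extensional_def restrict_def fun_eq_iff)
  qed
  finally show ?thesis by (simp add: form_sum_def)
qed

lemma sum_PiE_periodic: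
  fixes a b :: int
  assumes S: "finite S" and a: "0 \<le> a" and b: "0 \<le> b"
    and h: "\<And>x y. (\<And>i. i \<in> S \<Longrightarrow> [x i = y i] (mod b)) \<Longrightarrow> h x = (h y :: int)"
  shows "(\<Sum>x\<in>S \<rightarrow>\<^sub>E {0..<a*b}. h x) = a ^ card S * (\<Sum>x\<in>S \<rightarrow>\<^sub>E {0..<b}. h x)"
  using S h
proof (induction S arbitrary: h)
  case (insert i S)
  have "(\<Sum>x\<in>insert i S \<rightarrow>\<^sub>E {0..<a*b}. h x) = (\<Sum>y\<in>{0..<a*b}. \<Sum>x\<in>S \<rightarrow>\<^sub>E {0..<a*b}. h (x(i := y)))"
    by (rule sum_PiE_insert[OF insert.hyps(2)])
  also have "\<dots> = (\<Sum>y\<in>{0..<a*b}. a ^ card S * (\<Sum>x\<in>S \<rightarrow>\<^sub>E {0..<b}. h (x(i := y))))"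
    by (intro sum.cong refl insert.IH insert.prems) auto
  also have "\<dots> = a * (\<Sum>y\<in>{0..<b}. a ^ card S * (\<Sum>x\<in>S \<rightarrow>\<^sub>E {0..<b}. h (x(i := y))))"
  proof (rule sum_int_periodic[OF a b])
    have "h (x(i := y + b)) = h (x(i := y))" for x y
      by (rule insert.prems) (simp add: cong_def)
    then show "a ^ card S * (\<Sum>x\<in>S \<rightarrow>\<^sub>E {0..<b}. h (x(i := y + b)))
      = a ^ card S * (\<Sum>x\<in>S \<rightarrow>\<^sub>E {0..<b}. h (x(i := y)))" for y by simp
  qed
  also have "\<dots> = a ^ card (insert i S) * (\<Sum>y\<in>{0..<b}. \<Sum>x\<in>S \<rightarrow>\<^sub>E {0..<b}. h (x(i := y)))"
    using insert.hyps by (simp add: sum_distrib_left mult.assoc)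
  finally show ?case by (simp only: sum_PiE_insert[OF insert.hyps(2)])
qed simp

lemma not_primitive_iff:
  assumes "prime p" "x \<in> carrier_vec n"
  shows "\<not> primitive p x \<longleftrightarrow> (\<forall>i<n. int p dvd x $ i)"
proof -
  have "gcd y (int p) = 1 \<longleftrightarrow> \<not> int p dvd y" for y
    using assms(1) prime_imp_coprime[of "int p" y]
    by (auto simp: coprime_iff_gcd_eq_1 gcd.commute dest: not_prime_unit elim!: dvdE)
  then show ?thesis using assms(2) by (auto simp: primitive_def)
qed

text \<open>Nonprimitive vectors are p y with y determined modulo p^(k-1). Letting y run modulo p^k
  instead, so that the sum over the original form can be used, counts every one of them p^n
  times.\<close>

lemma card_nonprimitive_representations:
  assumes Q: "Q \<in> carrier_mat n n" and p: "prime p" and k: "1 \<le> k"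
  shows "int p ^ n * int (card {x \<in> representations p k n Q t. \<not> primitive p x})
    = form_sum (int p ^ k) {..<n} (\<lambda>l m. Q $$ (l, m)) (\<lambda>v. of_bool (int p ^ k dvd - t + (int p)\<^sup>2 * v)) 0"
proof -
  let ?P = "int p ^ k" let ?q = "qform {..<n} (\<lambda>l m. Q $$ (l, m))"
  define R where "R = int p ^ (k - 1)"
  have P: "?P = int p * R" using k by (cases k) (simp_all add: R_def)
  have p0: "int p > 0" using p prime_gt_0_nat by simp
  have R0: "R > 0" using p0 by (simp add: R_def)
  let ?h = "\<lambda>x. of_bool (?P dvd - t + (int p)\<^sup>2 * ?q x) :: int"
  let ?N = "{x \<in> zmod_vecs p k n. (\<forall>i<n. int p dvd x $ i) \<and> ?P dvd - t + ?q (\<lambda>i. x $ i)}"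
  have eqN: "{x \<in> representations p k n Q t. \<not> primitive p x} = ?N"
    using Q not_primitive_iff[OF p, of _ n]
    by (auto simp: representations_def zmod_vecs_def scalar_prod_mult_mat_vec cong_iff_dvd_diff)
  have "int (card ?N) = int (card {x \<in> {..<n} \<rightarrow>\<^sub>E {0..<R}. ?P dvd - t + (int p)\<^sup>2 * ?q x})"
  proof (rule arg_cong[where f = int], rule bij_betw_same_card[OF bij_betw_byWitness[where f = "\<lambda>x. \<lambda>i\<in>{..<n}. x $ i div int p" and f' = "\<lambda>x. vec n (\<lambda>i. int p * x i)"]])
    show "\<forall>x\<in>?N. vec n (\<lambda>i. int p * (\<lambda>i\<in>{..<n}. x $ i div int p) i) = x"
      by (auto simp: zmod_vecs_def)
    show "\<forall>x\<in>{x \<in> {..<n} \<rightarrow>\<^sub>E {0..<R}. ?P dvd - t + (int p)\<^sup>2 * ?q x}.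
        (\<lambda>i\<in>{..<n}. vec n (\<lambda>i. int p * x i) $ i div int p) = x"
      using p0 by (auto simp: PiE_iff extensional_def restrict_def fun_eq_iff)
    show "(\<lambda>x. \<lambda>i\<in>{..<n}. x $ i div int p) ` ?N \<subseteq> {x \<in> {..<n} \<rightarrow>\<^sub>E {0..<R}. ?P dvd - t + (int p)\<^sup>2 * ?q x}"
    proof (intro image_subsetI)
      fix x assume x: "x \<in> ?N"
      have "?q (\<lambda>i. x $ i) = ?q (\<lambda>i. int p * (x $ i div int p))"
        unfolding qform_def using x by (intro sum.cong refl) auto
      then have "?q (\<lambda>i. x $ i) = (int p)\<^sup>2 * ?q (\<lambda>i\<in>{..<n}. x $ i div int p)"
        by (simp add: qform_mult qform_restrict)
      moreover have "x $ i div int p < R" "0 \<le> x $ i div int p" if "i < n" for i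
      proof -
        have "x $ i < int p * R" "0 \<le> x $ i" using x that by (auto simp: zmod_vecs_def P)
        moreover have "x $ i = int p * (x $ i div int p)" using x that by auto
        ultimately have "int p * (x $ i div int p) < int p * R" by simp
        then show "x $ i div int p < R" using p0 by simp
        show "0 \<le> x $ i div int p" using \<open>0 \<le> x $ i\<close> p0 by (simp add: pos_imp_zdiv_nonneg_iff)
      qed
      ultimately show "(\<lambda>i\<in>{..<n}. x $ i div int p) \<in> {x \<in> {..<n} \<rightarrow>\<^sub>E {0..<R}. ?P dvd - t + (int p)\<^sup>2 * ?q x}"
        using x by auto
    qed
    show "(\<lambda>x. vec n (\<lambda>i. int p * x i)) ` {x \<in> {..<n} \<rightarrow>\<^sub>E {0..<R}. ?P dvd - t + (int p)\<^sup>2 * ?q x} \<subseteq> ?N"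
    proof (intro image_subsetI)
      fix x assume x: "x \<in> {x \<in> {..<n} \<rightarrow>\<^sub>E {0..<R}. ?P dvd - t + (int p)\<^sup>2 * ?q x}"
      have "?q (\<lambda>i. vec n (\<lambda>i. int p * x i) $ i) = ?q (\<lambda>i. int p * x i)"
        unfolding qform_def by (intro sum.cong refl) auto
      then show "vec n (\<lambda>i. int p * x i) \<in> ?N"
        using x p0 by (auto simp: zmod_vecs_def P qform_mult PiE_iff)
    qed
  qed
  also have "\<dots> = (\<Sum>x\<in>{..<n} \<rightarrow>\<^sub>E {0..<R}. ?h x)"
    by (simp add: finite_PiE Int_def)
  finally have N: "int (card ?N) = (\<Sum>x\<in>{..<n} \<rightarrow>\<^sub>E {0..<R}. ?h x)" .
  \<comment> \<open>Changing the value of the form at y by a multiple of p^(k-1) changes p^2 times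
    it by a multiple of p^(k+1), so the summand has period p^(k-1).\<close>
  have "(\<Sum>x\<in>{..<n} \<rightarrow>\<^sub>E {0..<int p * R}. ?h x) = int p ^ card {..<n} * (\<Sum>x\<in>{..<n} \<rightarrow>\<^sub>E {0..<R}. ?h x)"
  proof (rule sum_PiE_periodic)
    fix x y :: "nat \<Rightarrow> int" assume "\<And>i. i \<in> {..<n} \<Longrightarrow> [x i = y i] (mod R)"
    then have "[?q x = ?q y] (mod R)" by (rule qform_cong_arg)
    then have "R dvd ?q x - ?q y" by (simp add: cong_iff_dvd_diff)
    then have "?P dvd (int p)\<^sup>2 * (?q x - ?q y)" unfolding P power2_eq_square mult.assoc
      by (intro mult_dvd_mono dvd_refl dvd_mult)
    then have "[- t + (int p)\<^sup>2 * ?q x = - t + (int p)\<^sup>2 * ?q y] (mod ?P)"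
      by (simp add: cong_iff_dvd_diff right_diff_distrib)
    from cong_dvd_iff[OF this] show "?h x = ?h y" by simp
  qed (use p0 R0 in auto)
  then show ?thesis unfolding eqN N by (simp add: form_sum_def P)
qed

lemma bsum_start: "bsum free P L (\<lambda>v. g (s + v)) v = bsum free P L g (s + v)"
  by (induction L arbitrary: v) (simp_all add: bsum_Cons_free add.assoc del: bsum.simps(2))

text \<open>Raising the exponent to \<open>k + 2 \<ge> 3\<close> keeps the recursion uniform in \<open>k\<close> also for \<open>p = 2\<close>.\<close>

lemma cnt_representations:
  assumes p: "prime p" and k: "1 \<le> k" and Q: "Q \<in> carrier_mat n n" and L: "length L = n"
    and dec: "\<And>g v. periodic (int p ^ k) g \<Longrightarrow>
      (int p ^ k) ^ n * form_sum (int p ^ k) {..<n} (\<lambda>l m. Q $$ (l, m)) g v = bsum free (int p ^ k) L g v"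
  defines "D \<equiv> int p ^ (4 * n) * (int p ^ k) ^ n"
  shows "cnt (int p) free (k + 2) (map (scale_block ((int p)\<^sup>2)) L) (- ((int p)\<^sup>2 * t))
      = D * int (card (representations p k n Q t))" (is ?A)
    and "cnt (int p) free (k + 2) (map (scale_block ((int p) ^ 4)) L) (- ((int p)\<^sup>2 * t))
      = D * int p ^ n * int (card {x \<in> representations p k n Q t. \<not> primitive p x})" (is ?B)
proof -
  let ?P = "int p ^ k"
  have p1: "int p > 1" using p prime_gt_1_nat by simp
  \<comment> \<open>Each of the two factors p is removed by \<open>cnt_scale\<close> at the price of
    \<open>2 * length L'\<close> lifted variables.\<close>
  have scale2: "cnt (int p) free (k + 2) (map (scale_block ((int p)\<^sup>2)) L') ((int p)\<^sup>2 * t')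
     = int p ^ (4 * length L') * cnt (int p) free k L' t'" for L' t'
  proof -
    have "scale_block ((int p)\<^sup>2) B = scale_block (int p) (scale_block (int p) B)" for B
      by (cases B) (simp add: power2_eq_square mult_ac)
    then have "map (scale_block ((int p)\<^sup>2)) L' = map (scale_block (int p)) (map (scale_block (int p)) L')"
      by simp
    moreover have "k + 2 = Suc (Suc k)" "(int p)\<^sup>2 * t' = int p * (int p * t')"
      by (simp_all add: power2_eq_square)
    ultimately have "cnt (int p) free (k + 2) (map (scale_block ((int p)\<^sup>2)) L') ((int p)\<^sup>2 * t')
      = cnt (int p) free (Suc (Suc k)) (map (scale_block (int p)) (map (scale_block (int p)) L')) (int p * (int p * t'))"
      by (simp only:)
    also have "\<dots> = int p ^ (2 * length L') * (int p ^ (2 * length L') * cnt (int p) free k L' t')"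
      by (simp only: cnt_scale[OF p1] length_map)
    finally show ?thesis by (simp add: power_add[symmetric] mult.assoc[symmetric])
  qed
  have per1: "periodic ?P (\<lambda>v. of_bool (?P dvd v))"
    by (auto simp: periodic_def of_bool_def dest: cong_dvd_iff)
  have per2: "periodic ?P (\<lambda>v. of_bool (?P dvd - t + (int p)\<^sup>2 * v))"
    unfolding periodic_def
  proof (intro allI impI)
    fix v v' assume "[v = v'] (mod ?P)"
    then have "[- t + (int p)\<^sup>2 * v = - t + (int p)\<^sup>2 * v'] (mod ?P)"
      by (intro cong_add cong_mult cong_refl)
    from cong_dvd_iff[OF this] show "of_bool (?P dvd - t + (int p)\<^sup>2 * v) = of_bool (?P dvd - t + (int p)\<^sup>2 * v')"
      by simp
  qed
  have "?P ^ n * int (card (representations p k n Q t)) = cnt (int p) free k L (- t)"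
    unfolding card_representations[OF Q] dec[OF per1] cnt_def ..
  then show ?A using scale2[of L "- t"] by (simp add: L D_def mult_ac)
  have "?P ^ n * (int p ^ n * int (card {x \<in> representations p k n Q t. \<not> primitive p x}))
    = bsum free ?P L (\<lambda>v. of_bool (?P dvd - t + (int p)\<^sup>2 * v)) 0"
    unfolding card_nonprimitive_representations[OF Q p k] dec[OF per2] ..
  also have "\<dots> = bsum free ?P (map (scale_block ((int p)\<^sup>2)) L) (\<lambda>v. of_bool (?P dvd - t + v)) ((int p)\<^sup>2 * 0)"
    by (rule bsum_scale)
  also have "\<dots> = cnt (int p) free k (map (scale_block ((int p)\<^sup>2)) L) (- t)"
    using bsum_start[of ?P _ "\<lambda>v. of_bool (?P dvd v)" "- t" 0] by (simp add: cnt_def)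
  finally have N: "?P ^ n * (int p ^ n * int (card {x \<in> representations p k n Q t. \<not> primitive p x}))
    = cnt (int p) free k (map (scale_block ((int p)\<^sup>2)) L) (- t)" .
  \<comment> \<open>One p^2 comes from evaluating the form at p y, the other raises the exponent
    from k to k + 2.\<close>
  have "map (scale_block ((int p) ^ 4)) L = map (scale_block ((int p)\<^sup>2)) (map (scale_block ((int p)\<^sup>2)) L)"
  proof -
    have "scale_block ((int p) ^ 4) B = scale_block ((int p)\<^sup>2) (scale_block ((int p)\<^sup>2) B)" for B
      by (cases B) (simp add: power2_eq_square power4_eq_xxxx mult_ac)
    then show ?thesis by simp
  qed
  then show ?B using scale2[of "map (scale_block ((int p)\<^sup>2)) L" "- t"] N
    by (simp add: L D_def mult_ac del: map_map)
qed

section \<open>Base counts and the invariant of the counting loop\<close>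

lemma cnt_0: "cnt p free 0 L t = 1"
  by (induction L arbitrary: t) (simp_all add: cnt_Nil cnt_Cons free_def)

text \<open>For p = 2 the correction term needs a count modulo 4, but the table is modulo 8; t and t
  + 4 are the two lifts of t.\<close>

lemma cnt_2_from_3:
  "4 ^ length L * cnt 2 free 2 L t = cnt 2 free 3 L t + cnt 2 free 3 L (t + 4)"
proof -
  have "{0..<2::int} = {0, 1}" by auto
  moreover have "(2::int) ^ (2 * length L) = 4 ^ length L" by (simp add: power_mult)
  ultimately show ?thesis
    using cnt_lift[of 2 2 free L t] by (simp add: locally_periodic_free numeral_3_eq_3[symmetric])
qed

text \<open>With \<open>r\<close> rounds to go, \<open>R\<close> is the lifting factor of the coming round and \<open>R'\<close> that of the previous
  one; the term with \<open>R'\<close> cancels the zeros that the previous round has counted already.\<close>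

definition count_inv :: "int \<Rightarrow> nat \<Rightarrow> int \<Rightarrow> nat \<Rightarrow> block list \<Rightarrow> int \<Rightarrow> int \<Rightarrow> int \<Rightarrow> int \<Rightarrow> int \<Rightarrow> bool" where
  "count_inv p c N r L \<tau> W R R' acc \<longleftrightarrow>
     (\<forall>B\<in>set L. good_block p B) \<and>
     acc + W * (cnt p free (c + r - 1) L \<tau> - R' * cnt p free (c - 1) L \<tau>) = N \<and>
     (if r = 0 then R' = 1 else R = p ^ ((2 * length L - 1) * (r - 1)))"

text \<open>\<open>cnt_recursion\<close> trades the count at level \<open>c + r\<close> for one a
  level lower. Its negative term has the same shape as the one with R', so R is the next R'. If p
  does not divide \<tau>, the weight becomes 0 and later rounds add nothing.\<close>

lemma count_inv_step:
  assumes inv: "count_inv p c N (Suc r) L \<tau> W R R' acc"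
    and p: "prime p" and c: "c \<ge> 1" "p = 2 \<Longrightarrow> c \<ge> 3" and L: "L \<noteq> []"
  shows "count_inv p c N r (map (shift_block p) L) (\<tau> div p)
     (if p dvd \<tau> then W * prod_list (map (low_factor p) L) else 0)
     (R div p ^ (2 * length L - 1)) R (acc + W * (R * cnt p free c L \<tau> - R' * cnt p free (c - 1) L \<tau>))"
proof -
  have p1: "p > 1" using p prime_gt_1_int by auto
  have good: "\<forall>B\<in>set L. good_block p B" and R: "R = p ^ ((2 * length L - 1) * r)"
    and N: "acc + W * (cnt p free (c + r) L \<tau> - R' * cnt p free (c - 1) L \<tau>) = N"
    using inv by (simp_all add: count_inv_def)
  have rec: "cnt p free (c + r) L \<tau> = R * cnt p free c L \<tau> + (if p dvd \<tau> then prod_list (map (low_factor p) L) else 0) *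
     (cnt p free (c + r - 1) (map (shift_block p) L) (\<tau> div p) - R * cnt p free (c - 1) (map (shift_block p) L) (\<tau> div p))"
    unfolding R by (rule cnt_recursion[OF p c good L])
  have "\<forall>B\<in>set (map (shift_block p) L). good_block p B"
    using good good_shift_block p1 by auto
  moreover have "if r = 0 then R = 1 else R div p ^ (2 * length L - 1) = p ^ ((2 * length (map (shift_block p) L) - 1) * (r - 1))"
    using p1 by (cases r) (simp_all add: R power_add)
  ultimately show ?thesis
    using N rec unfolding count_inv_def by (auto simp: algebra_simps)
qed

text \<open>For r = 0 both counts in the bracket are at level \<open>c - 1\<close> and R' is 1, so
  the bracket vanishes.\<close>

lemma count_inv_final: "count_inv p c N 0 L \<tau> W R R' acc \<Longrightarrow> acc = N"
  by (auto simp: count_inv_def)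

section \<open>Reasoning about programs\<close>

text \<open>A total-correctness triple with B as an upper bound on the cost, not the exact cost, so
  that bounds can be rounded up freely.\<close>

definition runs :: "int \<Rightarrow> com \<Rightarrow> nat \<Rightarrow> mem \<Rightarrow> (mem \<Rightarrow> bool) \<Rightarrow> bool" where
  "runs m c B s R \<longleftrightarrow> (\<exists>T s'. exec m c s T s' \<and> T \<le> B \<and> R s')"

primrec svars :: "com \<Rightarrow> string set" where
  "svars Skip = {}"
| "svars (Assign x e) = {x}"
| "svars (Store a i e) = {}"
| "svars (Seq c d) = svars c \<union> svars d"
| "svars (Cond b c d) = svars c \<union> svars d"
| "svars (While b c) = svars c"

primrec avars :: "com \<Rightarrow> string set" where
  "avars Skip = {}"
| "avars (Assign x e) = {}"
| "avars (Store a i e) = {a}"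
| "avars (Seq c d) = avars c \<union> avars d"
| "avars (Cond b c d) = avars c \<union> avars d"
| "avars (While b c) = avars c"

text \<open>Instantiated with the syntactically assigned variables and arrays, it lets each
  specification state only what a program computes; everything else is carried over by
  \<open>frame\<close>.\<close>

definition frame :: "string set \<Rightarrow> string set \<Rightarrow> mem \<Rightarrow> mem \<Rightarrow> bool" where
  "frame X Y s s' \<longleftrightarrow> (\<forall>x. x \<notin> X \<longrightarrow> scalar s' x = scalar s x) \<and> (\<forall>a. a \<notin> Y \<longrightarrow> arr s' a = arr s a)"

lemma frame_scalar: "frame X Y s s' \<Longrightarrow> x \<notin> X \<Longrightarrow> scalar s' x = scalar s x"
  and frame_arr: "frame X Y s s' \<Longrightarrow> a \<notin> Y \<Longrightarrow> arr s' a = arr s a"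
  by (simp_all add: frame_def)

lemma frame_refl: "frame X Y s s"
  by (simp add: frame_def)

lemma frame_trans: "frame X Y s s' \<Longrightarrow> frame X' Y' s' s'' \<Longrightarrow> frame (X \<union> X') (Y \<union> Y') s s''"
  by (simp add: frame_def)

lemma scalar_set [simp]:
  "scalar (set_scalar x v s) = (scalar s)(x := v)"
  "arr (set_scalar x v s) = arr s"
  "scalar (set_arr a i v s) = scalar s"
  "arr (set_arr a i v s) = (arr s)(a := (arr s a)(i := v))"
  by (simp_all add: set_scalar_def set_arr_def)

lemma exec_frame: "exec m c s T s' \<Longrightarrow> frame (svars c) (avars c) s s'"
  by (induction rule: exec.induct) (auto simp: frame_def)

lemma runs_frame: "runs m c B s R \<Longrightarrow> runs m c B s (\<lambda>s'. R s' \<and> frame (svars c) (avars c) s s')"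
  unfolding runs_def using exec_frame by blast

lemma runs_mono: "runs m c B s R \<Longrightarrow> B \<le> B' \<Longrightarrow> (\<And>s'. R s' \<Longrightarrow> R' s') \<Longrightarrow> runs m c B' s R'"
  unfolding runs_def by (meson order_trans)

lemma runs_Seq:
  assumes "runs m c B s (\<lambda>s'. runs m d B' s' R)"
  shows "runs m (Seq c d) (B + B') s R"
proof -
  obtain T s' where 1: "exec m c s T s'" "T \<le> B" "runs m d B' s' R"
    using assms by (auto simp: runs_def)
  then obtain T' s'' where 2: "exec m d s' T' s''" "T' \<le> B'" "R s''" by (auto simp: runs_def)
  show ?thesis unfolding runs_def using exec.Seq[OF 1(1) 2(1)] 1 2 by (meson add_mono)
qed

lemma runs_Seq_frame:
  assumes "runs m c B s R'"
    and "\<And>s'. R' s' \<Longrightarrow> frame (svars c) (avars c) s s' \<Longrightarrow> runs m d B' s' R"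
  shows "runs m (Seq c d) (B + B') s R"
  by (rule runs_Seq) (rule runs_mono[OF runs_frame[OF assms(1)]], use assms(2) in auto)

lemma runs_Cond:
  assumes "eval_expr m s b \<noteq> 0 \<Longrightarrow> runs m c B s R" and "eval_expr m s b = 0 \<Longrightarrow> runs m d B s R"
  shows "runs m (Cond b c d) (1 + cost b + B) s R"
proof (cases "eval_expr m s b = 0")
  case True
  from assms(2)[OF this] obtain T s' where "exec m d s T s'" "T \<le> B" "R s'" by (auto simp: runs_def)
  with exec.CondFalse[OF True this(1), of c] show ?thesis
    unfolding runs_def by (intro exI[of _ "1 + cost b + T"] exI[of _ s']) auto
next
  case False
  from assms(1)[OF this] obtain T s' where "exec m c s T s'" "T \<le> B" "R s'" by (auto simp: runs_def)
  with exec.CondTrue[OF False this(1), of d] show ?thesis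
    unfolding runs_def by (intro exI[of _ "1 + cost b + T"] exI[of _ s']) auto
qed

text \<open>Loop-free programs are evaluated by the function \<open>run\<close>, which lets the
  simplifier compute their effect; only loops need invariants.\<close>

primrec straight :: "com \<Rightarrow> bool" where
  "straight Skip = True"
| "straight (Assign x e) = True"
| "straight (Store a i e) = True"
| "straight (Seq c d) = (straight c \<and> straight d)"
| "straight (Cond b c d) = (straight c \<and> straight d)"
| "straight (While b c) = False"

text \<open>The costs of both branches of a conditional are added: a bound that depends on the
  program text alone.\<close>

primrec ccost :: "com \<Rightarrow> nat" where
  "ccost Skip = 1"
| "ccost (Assign x e) = 1 + cost e"
| "ccost (Store a i e) = 1 + cost i + cost e"
| "ccost (Seq c d) = ccost c + ccost d"
| "ccost (Cond b c d) = 1 + cost b + (ccost c + ccost d)"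
| "ccost (While b c) = 0"

primrec run :: "int \<Rightarrow> com \<Rightarrow> mem \<Rightarrow> mem" where
  "run m Skip s = s"
| "run m (Assign x e) s = set_scalar x (eval_expr m s e) s"
| "run m (Store a i e) s = set_arr a (eval_expr m s i) (eval_expr m s e) s"
| "run m (Seq c d) s = run m d (run m c s)"
| "run m (Cond b c d) s = (if eval_expr m s b \<noteq> 0 then run m c s else run m d s)"
| "run m (While b c) s = s"

lemma runs_run: "straight c \<Longrightarrow> runs m c (ccost c) s (\<lambda>s'. s' = run m c s)"
proof (induction c arbitrary: s)
  case (Seq c d)
  then show ?case by (auto intro!: runs_Seq intro: runs_mono)
next
  case (Cond b c d)
  have "runs m c (ccost c + ccost d) s (\<lambda>s'. s' = run m c s)"
    "runs m d (ccost c + ccost d) s (\<lambda>s'. s' = run m d s)"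
    by (rule runs_mono[where B = "ccost c"], use Cond in auto)
      (rule runs_mono[where B = "ccost d"], use Cond in auto)
  then show ?case by (simp only: ccost.simps) (rule runs_Cond, auto)
qed (auto simp: runs_def intro: exec.Skip exec.Assign exec.Store)

lemma runs_straight: "straight c \<Longrightarrow> R (run m c s) \<Longrightarrow> runs m c (ccost c) s R"
  using runs_mono[OF runs_run order_refl] by blast

definition For :: "string \<Rightarrow> string \<Rightarrow> com \<Rightarrow> com" where
  "For i b c = Seq (Assign i (Num 0))
     (While (Op ILess (Var i) (Var b)) (Seq c (Assign i (Op IAdd (Var i) (Num 1)))))"

lemma svars_For [simp]: "svars (For i b c) = insert i (svars c)"
  and avars_For [simp]: "avars (For i b c) = avars c"
  by (auto simp: For_def)

lemma runs_While_true:
  assumes "eval_expr m s b \<noteq> 0" and "runs m c B s (\<lambda>s'. runs m (While b c) B' s' R)"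
  shows "runs m (While b c) (1 + cost b + B + B') s R"
proof -
  obtain T s' where 1: "exec m c s T s'" "T \<le> B" "runs m (While b c) B' s' R"
    using assms by (auto simp: runs_def)
  then obtain T' s'' where 2: "exec m (While b c) s' T' s''" "T' \<le> B'" "R s''" by (auto simp: runs_def)
  from exec.WhileTrue[OF assms(1) 1(1) 2(1)] 1 2 show ?thesis
    unfolding runs_def by (intro exI[of _ "1 + cost b + T + T'"] exI[of _ s'']) auto
qed

lemma runs_While_false:
  assumes "eval_expr m s b = 0" and "R s"
  shows "runs m (While b c) (1 + cost b) s R"
  unfolding runs_def using exec.WhileFalse[OF assms(1)] assms(2) by blast

text \<open>The invariant for j is demanded after the counter has been set to j, hence
  \<open>set_scalar\<close> in the premises. A round adds 8 to the body, 4 for the test and 4 for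
  the increment; the 6 are 2 for the initialisation and 4 for the last test.\<close>

lemma runs_For:
  assumes vars: "i \<notin> svars c" "b \<notin> svars c" "i \<noteq> b" and N: "scalar s b = int N"
    and init: "I 0 (set_scalar i 0 s)"
    and step: "\<And>j s'. j < N \<Longrightarrow> scalar s' i = int j \<Longrightarrow> frame (insert i (svars c)) (avars c) s s' \<Longrightarrow> I j s' \<Longrightarrow>
        runs m c B s' (\<lambda>s''. I (Suc j) (set_scalar i (int (Suc j)) s''))"
  shows "runs m (For i b c) (N * (B + 8) + 6) s
     (\<lambda>s'. I N s' \<and> frame (insert i (svars c)) (avars c) s s')"
proof -
  let ?F = "frame (insert i (svars c)) (avars c) s"
  let ?W = "While (Op ILess (Var i) (Var b)) (Seq c (Assign i (Op IAdd (Var i) (Num 1))))"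
  have loop: "runs m ?W (d * (B + 8) + 4) s' (\<lambda>s'. I N s' \<and> ?F s')"
    if "d + j = N" "scalar s' i = int j" "?F s'" "I j s'" for d j s'
    using that
  proof (induction d arbitrary: j s')
    case 0
    have "scalar s' b = int N" using 0(3) vars N by (simp add: frame_scalar)
    then have "runs m ?W (1 + cost (Op ILess (Var i) (Var b))) s' (\<lambda>s'. I N s' \<and> ?F s')"
      using 0 by (intro runs_While_false) auto
    then show ?case by (rule runs_mono) auto
  next
    case (Suc d)
    have b: "scalar s' b = int N" using Suc.prems(3) vars N by (simp add: frame_scalar)
    have "runs m c B s' (\<lambda>s''. I (Suc j) (set_scalar i (int (Suc j)) s''))"
      using Suc.prems by (intro step) auto
    then have "runs m (Seq c (Assign i (Op IAdd (Var i) (Num 1)))) (B + 4) s'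
       (\<lambda>s''. runs m ?W (d * (B + 8) + 4) s'' (\<lambda>s'. I N s' \<and> ?F s'))"
    proof (rule runs_Seq_frame)
      fix s'' assume 1: "I (Suc j) (set_scalar i (int (Suc j)) s'')" and f: "frame (svars c) (avars c) s' s''"
      have i: "scalar s'' i = int j" using f vars Suc.prems(2) by (simp add: frame_scalar)
      let ?s = "set_scalar i (int (Suc j)) s''"
      have "?F ?s" using frame_trans[OF Suc.prems(3) f] by (auto simp: frame_def)
      then have "runs m ?W (d * (B + 8) + 4) ?s (\<lambda>s'. I N s' \<and> ?F s')"
        using 1 Suc.prems(1) by (intro Suc.IH) auto
      moreover have "run m (Assign i (Op IAdd (Var i) (Num 1))) s'' = ?s"
        using i by (simp add: add.commute)
      ultimately have "runs m (Assign i (Op IAdd (Var i) (Num 1))) (ccost (Assign i (Op IAdd (Var i) (Num 1)))) s''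
         (\<lambda>s''. runs m ?W (d * (B + 8) + 4) s'' (\<lambda>s'. I N s' \<and> ?F s'))"
        by (intro runs_straight) (simp_all only: straight.simps)
      then show "runs m (Assign i (Op IAdd (Var i) (Num 1))) 4 s''
         (\<lambda>s''. runs m ?W (d * (B + 8) + 4) s'' (\<lambda>s'. I N s' \<and> ?F s'))"
        by (rule runs_mono) auto
    qed
    moreover have "eval_expr m s' (Op ILess (Var i) (Var b)) \<noteq> 0" using Suc.prems(1,2) b by simp
    ultimately have "runs m ?W (1 + cost (Op ILess (Var i) (Var b)) + (B + 4) + (d * (B + 8) + 4)) s' (\<lambda>s'. I N s' \<and> ?F s')"
      by (intro runs_While_true)
    then show ?case by (rule runs_mono) auto
  qed
  have "runs m (Assign i (Num 0)) 2 s (\<lambda>s'. s' = set_scalar i 0 s)"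
    by (rule runs_mono[OF runs_run]) auto
  then have "runs m (For i b c) (2 + (N * (B + 8) + 4)) s (\<lambda>s'. I N s' \<and> ?F s')"
    unfolding For_def
  proof (rule runs_Seq_frame)
    fix s' assume "s' = set_scalar i 0 s"
    then show "runs m ?W (N * (B + 8) + 4) s' (\<lambda>s'. I N s' \<and> ?F s')"
      using init by (intro loop) (auto simp: frame_def)
  qed
  then show ?thesis by (rule runs_mono) auto
qed

section \<open>The exponent of matrix multiplication is at least two\<close>

text \<open>Only \<open>Store\<close> changes an array, one cell at a time, and it costs at least
  one unit.\<close>

lemma exec_changed_cells:
  assumes "exec m c s T s'"
  shows "finite {i. arr s' a i \<noteq> arr s a i} \<and> card {i. arr s' a i \<noteq> arr s a i} \<le> T"
proof -
  have comb: "finite {i. arr s'' a i \<noteq> arr s a i} \<and> card {i. arr s'' a i \<noteq> arr s a i} \<le> T1 + T2"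
    if "finite {i. arr s' a i \<noteq> arr s a i} \<and> card {i. arr s' a i \<noteq> arr s a i} \<le> T1"
       "finite {i. arr s'' a i \<noteq> arr s' a i} \<and> card {i. arr s'' a i \<noteq> arr s' a i} \<le> T2"
    for s s' s'' T1 T2
  proof -
    let ?A = "{i. arr s' a i \<noteq> arr s a i}" let ?B = "{i. arr s'' a i \<noteq> arr s' a i}"
    have "finite (?A \<union> ?B)" "card (?A \<union> ?B) \<le> T1 + T2"
      using that card_Un_le[of ?A ?B] by auto
    moreover have "{i. arr s'' a i \<noteq> arr s a i} \<subseteq> ?A \<union> ?B" by auto
    ultimately show ?thesis by (meson card_mono finite_subset order_trans)
  qed
  show ?thesis using assms
  proof (induction rule: exec.induct)
    case (Store b i e s)
    let ?s = "set_arr b (eval_expr m s i) (eval_expr m s e) s"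
    have sub: "{j. arr ?s a j \<noteq> arr s a j} \<subseteq> {eval_expr m s i}" by auto
    then have "finite {j. arr ?s a j \<noteq> arr s a j}" "card {j. arr ?s a j \<noteq> arr s a j} \<le> 1"
      using finite_subset card_mono[OF _ sub] by auto
    then show ?case by linarith
  next
    case (Seq c1 s T1 s' c2 T2 s'')
    show ?case by (rule comb[OF Seq.IH])
  next
    case (WhileTrue s b c T1 s' T2 s'')
    from comb[OF WhileTrue.IH] show ?case by (metis (lifting) add.assoc trans_le_add2)
  qed (auto intro: le_SucI)
qed

lemma matmul_exponent_ge_2:
  assumes "matmul_exponent \<omega>"
  shows "\<omega> \<ge> 2"
proof (rule ccontr)
  assume "\<not> \<omega> \<ge> 2"
  then have \<omega>: "2 - \<omega> > 0" by simp
  obtain prog K where prog: "\<And>p k n A B. prime p \<Longrightarrow> 1 \<le> k \<Longrightarrow> 1 \<le> n \<Longrightarrow> A \<in> zmod_mats p k n \<Longrightarrow> B \<in> zmod_mats p k n \<Longrightarrow>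
        (\<exists>T s. exec (int p ^ k) prog (matmul_input p k n A B) T s \<and>
               (\<forall>i<n. \<forall>j<n. arr s ''C'' (int (i * n + j)) = (A * B) $$ (i, j) mod int p ^ k) \<and>
               real T \<le> K * real n powr \<omega>)"
    using assms unfolding matmul_exponent_def by metis
  have bound: "real n powr (2 - \<omega>) \<le> K" if n: "1 \<le> n" for n :: nat
  proof -
    \<comment> \<open>All entries of the square of the all-ones matrix are n, and n < 2^n, so modulo
      2^n the product is nonzero everywhere. The cells of \<open>C\<close> are initially 0, hence
      all of them must be written.\<close>
    define J where "J = mat n n (\<lambda>_. 1 :: int)"
    have pow: "int n < 2 ^ n" by (metis of_nat_less_two_power)
    have J: "J \<in> zmod_mats 2 n n" using n pow by (auto simp: J_def zmod_mats_def)
    have JJ: "(J * J) $$ (i, j) = int n" if "i < n" "j < n" for i j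
      using that by (simp add: J_def scalar_prod_def)
    obtain T s where ex: "exec (int 2 ^ n) prog (matmul_input 2 n n J J) T s"
      and C: "\<forall>i<n. \<forall>j<n. arr s ''C'' (int (i * n + j)) = (J * J) $$ (i, j) mod int 2 ^ n"
      and T: "real T \<le> K * real n powr \<omega>"
      using prog[OF two_is_prime_nat n n J J] by auto
    let ?D = "{i. arr s ''C'' i \<noteq> arr (matmul_input 2 n n J J) ''C'' i}"
    have D: "finite ?D" "card ?D \<le> T" using exec_changed_cells[OF ex] by auto
    have "int ` {..<n * n} \<subseteq> ?D"
    proof
      fix x assume "x \<in> int ` {..<n * n}"
      then obtain y where y: "x = int y" "y < n * n" by auto
      have ij: "y div n < n" "y mod n < n" using y n by (simp_all add: less_mult_imp_div_less)
      have "arr s ''C'' (int (y div n * n + y mod n)) = int n"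
        using C[rule_format, OF ij] JJ[OF ij] pow by simp
      then have "arr s ''C'' x = int n" using y by simp
      then show "x \<in> ?D" using n by (simp add: matmul_input_def)
    qed
    from card_mono[OF D(1) this] have "n * n \<le> T" using D(2) by (simp add: card_image)
    then have "real n * real n \<le> K * real n powr \<omega>" using T
      by (metis of_nat_le_iff of_nat_mult order_trans)
    moreover have "real n powr 2 = real n * real n" using n by (simp add: powr_numeral power2_eq_square)
    ultimately have "real n powr 2 \<le> K * real n powr \<omega>" by simp
    then show ?thesis using n by (simp add: powr_diff divide_le_eq)
  qed
  \<comment> \<open>Chosen so that its power \<open>2 - \<omega>\<close> is
    \<open>\<bar>K\<bar> + 1\<close>, which exceeds K.\<close>
  define x where "x = (\<bar>K\<bar> + 1) powr (1 / (2 - \<omega>))"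
  obtain n :: nat where n: "n \<ge> 1" "real n \<ge> x"
    by (metis le_add1 of_nat_le_iff order_trans real_arch_simple add.commute)
  have "\<bar>K\<bar> + 1 = x powr (2 - \<omega>)" using \<omega> by (simp add: x_def powr_powr)
  also have "\<dots> \<le> real n powr (2 - \<omega>)" using n \<omega> by (intro powr_mono2) (auto simp: x_def)
  also have "\<dots> \<le> K" by (rule bound[OF n(1)])
  finally show False by simp
qed

section \<open>Program notation and the layout of the matrix in memory\<close>

abbreviation Add_expr (infixl "+\<^sub>e" 65) where "a +\<^sub>e b \<equiv> Op IAdd a b"
abbreviation Sub_expr (infixl "-\<^sub>e" 65) where "a -\<^sub>e b \<equiv> Op ISub a b"
abbreviation Mul_expr (infixl "*\<^sub>e" 70) where "a *\<^sub>e b \<equiv> Op IMul a b"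
abbreviation Div_expr (infixl "div\<^sub>e" 70) where "a div\<^sub>e b \<equiv> Op IDiv a b"
abbreviation Mod_expr (infixl "mod\<^sub>e" 70) where "a mod\<^sub>e b \<equiv> Op IMod a b"
abbreviation Less_expr (infix "<\<^sub>e" 50) where "a <\<^sub>e b \<equiv> Op ILess a b"
abbreviation Eq_expr (infix "=\<^sub>e" 50) where "a =\<^sub>e b \<equiv> Op IEq a b"
abbreviation Assign_com (infix "::=" 45) where "x ::= e \<equiv> Assign x e"
abbreviation Seq_com (infixr ";;" 40) where "c ;; d \<equiv> Seq c d"

definition entry :: "nat \<Rightarrow> mem \<Rightarrow> nat \<Rightarrow> nat \<Rightarrow> int" where
  "entry n s l m = arr s ''Q'' (int (l * n + m))"

text \<open>Memory is initially 0, so the array \<open>A\<close> marks the eliminated indices.\<close>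

definition act :: "nat \<Rightarrow> mem \<Rightarrow> nat set" where
  "act n s = {l. l < n \<and> arr s ''A'' (int l) = 0}"

definition blk :: "mem \<Rightarrow> nat \<Rightarrow> block" where
  "blk s b = (arr s ''a'' (int b), arr s ''b'' (int b), arr s ''c'' (int b))"

lemma act_less: "l \<in> act n s \<Longrightarrow> l < n"
  by (simp add: act_def)

lemma finite_act [simp]: "finite (act n s)"
  by (simp add: act_def)

lemma index_less_Suc:
  fixes n :: nat
  assumes "l < n" "m < n"
  shows "l * n + m < Suc t \<longleftrightarrow> l * n + m < t \<or> (l = t div n \<and> m = t mod n)"
proof -
  have "l * n + m = t \<longleftrightarrow> l = t div n \<and> m = t mod n"
    using assms by auto
  then show ?thesis by (auto simp: less_Suc_eq)
qed

lemma index_less: "l < n \<Longrightarrow> m < n \<Longrightarrow> l * n + m < n * (n::nat)"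
  by (metis add_less_cancel_left less_le_trans mult.commute mult_Suc_right mult_le_mono2 Suc_leI add.commute)

section \<open>Pivot search\<close>

text \<open>Sums of flags serve as logical connectives. The sum of the two \<open>A\<close> entries
  is 0 when both indices are active. An entry not divisible by \<open>pv * p\<close> is recorded if
  nothing was found before or if it is diagonal; a diagonal entry thus overrides an off-diagonal
  one, and an off-diagonal result means that no diagonal entry qualified.\<close>

definition search_body :: com where
  "search_body =
    (''i'' ::= Var ''x'' div\<^sub>e Var ''n'' ;;
     ''j'' ::= Var ''x'' mod\<^sub>e Var ''n'' ;;
     Cond (Arr ''A'' (Var ''i'') +\<^sub>e Arr ''A'' (Var ''j'') =\<^sub>e Num 0)
       (Cond (Arr ''Q'' (Var ''x'') mod\<^sub>e (Var ''pv'' *\<^sub>e Var ''p''))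
         (Cond ((Var ''fi'' <\<^sub>e Num 0) +\<^sub>e (Var ''i'' =\<^sub>e Var ''j''))
            (''fi'' ::= Var ''i'' ;; ''fj'' ::= Var ''j'')
            Skip)
         Skip)
       Skip)"

definition search :: com where
  "search = (''fi'' ::= Num (-1) ;; For ''x'' ''nn'' search_body)"

lemma svars_search_body [simp]: "svars search_body = {''i'', ''j'', ''fi'', ''fj''}"
  and avars_search_body [simp]: "avars search_body = {}"
  and straight_search_body [simp]: "straight search_body"
  by (auto simp: search_body_def)

definition found :: "nat \<Rightarrow> int \<Rightarrow> mem \<Rightarrow> nat \<Rightarrow> mem \<Rightarrow> bool" where
  "found n d s t s' \<longleftrightarrow>
     (scalar s' ''fi'' = -1 \<and> (\<forall>l\<in>act n s. \<forall>m\<in>act n s. l * n + m < t \<longrightarrow> d dvd entry n s l m)) \<or>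
     (\<exists>i\<in>act n s. \<exists>j\<in>act n s. scalar s' ''fi'' = int i \<and> scalar s' ''fj'' = int j \<and>
        \<not> d dvd entry n s i j \<and> (i \<noteq> j \<longrightarrow> (\<forall>l\<in>act n s. l * n + l < t \<longrightarrow> d dvd entry n s l l)))"

lemma runs_search:
  assumes n: "scalar s ''n'' = int n" "scalar s ''nn'' = int (n * n)"
    and A: "\<And>l. l < n \<Longrightarrow> arr s ''A'' (int l) \<in> {0, 1}"
    and d: "scalar s ''pv'' * scalar s ''p'' = d"
  shows "runs M search (2 + (n * n * (ccost search_body + 8) + 6)) s
    (\<lambda>s'. found n d s (n * n) s')"
  unfolding search_def
proof (rule runs_Seq_frame)
  show "runs M (''fi'' ::= Num (-1)) 2 s (\<lambda>s'. s' = set_scalar ''fi'' (-1) s)"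
    by (rule runs_mono[OF runs_run]) auto
next
  fix s1 assume s1: "s1 = set_scalar ''fi'' (-1) s"
  have "runs M (For ''x'' ''nn'' search_body) (n * n * (ccost search_body + 8) + 6) s1
    (\<lambda>s'. found n d s (n * n) s' \<and> frame (insert ''x'' (svars search_body)) (avars search_body) s1 s')"
  proof (rule runs_For)
    show "found n d s 0 (set_scalar ''x'' 0 s1)" by (simp add: s1 found_def)
  next
    fix t s' assume t: "t < n * n" and x: "scalar s' ''x'' = int t"
      and fr: "frame (insert ''x'' (svars search_body)) (avars search_body) s1 s'" and I: "found n d s t s'"
    define l where "l = t div n"
    define m where "m = t mod n"
    have n0: "n > 0" using t by (cases n) auto
    have lm: "l < n" "m < n" "t = l * n + m" using t n0 by (simp_all add: l_def m_def less_mult_imp_div_less)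
    have fs: "scalar s' ''n'' = int n" "scalar s' ''pv'' = scalar s ''pv''" "scalar s' ''p'' = scalar s ''p''"
      "\<And>a. arr s' a = arr s a"
      using fr n by (simp_all add: frame_def s1)
    let ?C = "l \<in> act n s \<and> m \<in> act n s \<and> \<not> d dvd entry n s l m \<and> (scalar s' ''fi'' < 0 \<or> l = m)"
    have R: "scalar (run M search_body s') ''fi'' = (if ?C then int l else scalar s' ''fi'')"
      "scalar (run M search_body s') ''fj'' = (if ?C then int m else scalar s' ''fj'')"
    proof -
      have A2: "(arr s ''A'' (int l) + arr s ''A'' (int m) = 0) \<longleftrightarrow> l \<in> act n s \<and> m \<in> act n s"
        using A[OF lm(1)] A[OF lm(2)] lm by (auto simp: act_def)
      have dv: "int t div int n = int l" "int t mod int n = int m"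
        by (simp_all add: l_def m_def zdiv_int zmod_int)
      have md: "(arr s ''Q'' (int t) mod d \<noteq> 0) \<longleftrightarrow> \<not> d dvd entry n s l m"
        by (simp add: entry_def lm(3) dvd_eq_mod_eq_0)
      show "scalar (run M search_body s') ''fi'' = (if ?C then int l else scalar s' ''fi'')"
        "scalar (run M search_body s') ''fj'' = (if ?C then int m else scalar s' ''fj'')"
        using A2 md by (simp_all add: search_body_def fs x dv d)
    qed
    have lt: "l' * n + m' < Suc t \<longleftrightarrow> l' * n + m' < t \<or> (l' = l \<and> m' = m)" if "l' \<in> act n s" "m' \<in> act n s" for l' m'
      unfolding l_def m_def using that by (intro index_less_Suc) (auto simp: act_def)
    have "found n d s (Suc t) (set_scalar ''x'' (int (Suc t)) (run M search_body s'))"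
    proof (cases "?C")
      case True
      then have ll: "l' * n + l' < Suc t \<longrightarrow> d dvd entry n s l' l'" if "l' \<in> act n s" "l \<noteq> m" for l'
        using I that lt[of l' l'] unfolding found_def by auto
      show ?thesis using True ll unfolding found_def by (auto simp: R)
    next
      case False
      from I[unfolded found_def] show ?thesis
      proof (elim disjE conjE)
        assume "scalar s' ''fi'' = -1" "\<forall>l\<in>act n s. \<forall>m\<in>act n s. l * n + m < t \<longrightarrow> d dvd entry n s l m"
        then show ?thesis using False lt R unfolding found_def by auto
      next
        assume "\<exists>i\<in>act n s. \<exists>j\<in>act n s. scalar s' ''fi'' = int i \<and> scalar s' ''fj'' = int j \<and>
          \<not> d dvd entry n s i j \<and> (i \<noteq> j \<longrightarrow> (\<forall>l\<in>act n s. l * n + l < t \<longrightarrow> d dvd entry n s l l))"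
        then obtain i j where ij: "i \<in> act n s" "j \<in> act n s" "scalar s' ''fi'' = int i" "scalar s' ''fj'' = int j"
          "\<not> d dvd entry n s i j" "i \<noteq> j \<longrightarrow> (\<forall>l\<in>act n s. l * n + l < t \<longrightarrow> d dvd entry n s l l)" by blast
        have "i \<noteq> j \<longrightarrow> (\<forall>l\<in>act n s. l * n + l < Suc t \<longrightarrow> d dvd entry n s l l)"
          using ij(6) False lt by auto
        then show ?thesis using ij False R unfolding found_def by auto
      qed
    qed
    then show "runs M search_body (ccost search_body) s'
        (\<lambda>s''. found n d s (Suc t) (set_scalar ''x'' (int (Suc t)) s''))"
      by (intro runs_straight) simp_all
  qed (use n in \<open>auto simp: s1\<close>)
  then show "runs M (For ''x'' ''nn'' search_body) (n * n * (ccost search_body + 8) + 6) s1 (found n d s (n * n))"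
    by (rule runs_mono) auto
qed

section \<open>Elimination\<close>

definition row_expr :: "string \<Rightarrow> string \<Rightarrow> expr" where
  "row_expr f x = Arr ''Q'' (Var f *\<^sub>e Var ''n'' +\<^sub>e Var x) div\<^sub>e Var ''pv''"

text \<open>Both kinds of pivot share this update; the unary one sets \<open>e2\<close> and
  \<open>e3\<close> to 0. It works in place: the pivot rows are read throughout, but their indices
  are already marked inactive, so their entries are never overwritten.\<close>

definition update_body :: com where
  "update_body =
    (''i'' ::= Var ''x'' div\<^sub>e Var ''n'' ;;
     ''j'' ::= Var ''x'' mod\<^sub>e Var ''n'' ;;
     Cond (Arr ''A'' (Var ''i'') +\<^sub>e Arr ''A'' (Var ''j'') =\<^sub>e Num 0)
       (Store ''Q'' (Var ''x'') ((Arr ''Q'' (Var ''x'') -\<^sub>e Var ''pv'' *\<^sub>e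
          (Var ''e1'' *\<^sub>e (row_expr ''fi'' ''i'' *\<^sub>e row_expr ''fi'' ''j'')
           +\<^sub>e Var ''e2'' *\<^sub>e (row_expr ''fi'' ''i'' *\<^sub>e row_expr ''fj'' ''j''
                             +\<^sub>e row_expr ''fj'' ''i'' *\<^sub>e row_expr ''fi'' ''j'')
           +\<^sub>e Var ''e3'' *\<^sub>e (row_expr ''fj'' ''i'' *\<^sub>e row_expr ''fj'' ''j''))) mod\<^sub>e Var ''P''))
       Skip)"

lemma svars_update_body [simp]: "svars update_body = {''i'', ''j''}"
  and avars_update_body [simp]: "avars update_body = {''Q''}"
  and straight_update_body [simp]: "straight update_body"
  by (auto simp: update_body_def)

definition eliminated :: "nat \<Rightarrow> nat \<Rightarrow> nat \<Rightarrow> mem \<Rightarrow> nat \<Rightarrow> nat \<Rightarrow> int" where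
  "eliminated n i j s l m =
     (entry n s l m - scalar s ''pv'' *
        (scalar s ''e1'' * (entry n s i l div scalar s ''pv'' * (entry n s i m div scalar s ''pv''))
         + scalar s ''e2'' * (entry n s i l div scalar s ''pv'' * (entry n s j m div scalar s ''pv'')
                            + entry n s j l div scalar s ''pv'' * (entry n s i m div scalar s ''pv''))
         + scalar s ''e3'' * (entry n s j l div scalar s ''pv'' * (entry n s j m div scalar s ''pv''))))
      mod scalar s ''P''"

lemma runs_update:
  assumes n: "scalar s ''n'' = int n" "scalar s ''nn'' = int (n * n)"
    and A: "\<And>l. l < n \<Longrightarrow> arr s ''A'' (int l) \<in> {0, 1}"
    and ij: "scalar s ''fi'' = int i" "scalar s ''fj'' = int j" "i < n" "j < n" "i \<notin> act n s" "j \<notin> act n s"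
  shows "runs M (For ''x'' ''nn'' update_body) (n * n * (ccost update_body + 8) + 6) s
    (\<lambda>s'. (\<forall>l\<in>act n s. \<forall>m\<in>act n s. entry n s' l m = eliminated n i j s l m) \<and>
       frame {''x'', ''i'', ''j''} {''Q''} s s')"
proof -
  let ?J = "\<lambda>t s'. \<forall>l<n. \<forall>m<n. entry n s' l m =
     (if l \<in> act n s \<and> m \<in> act n s \<and> l * n + m < t then eliminated n i j s l m else entry n s l m)"
  have "runs M (For ''x'' ''nn'' update_body) (n * n * (ccost update_body + 8) + 6) s
    (\<lambda>s'. ?J (n * n) s' \<and> frame (insert ''x'' (svars update_body)) (avars update_body) s s')"
  proof (rule runs_For)
    show "?J 0 (set_scalar ''x'' 0 s)" by (simp add: entry_def)
  next
    fix t s' assume t: "t < n * n" and x: "scalar s' ''x'' = int t"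
      and fr: "frame (insert ''x'' (svars update_body)) (avars update_body) s s'" and I: "?J t s'"
    define l where "l = t div n"
    define m where "m = t mod n"
    have n0: "n > 0" using t by (cases n) auto
    have lm: "l < n" "m < n" "t = l * n + m" using t n0 by (simp_all add: l_def m_def less_mult_imp_div_less)
    have fs: "scalar s' ''n'' = int n" "scalar s' ''pv'' = scalar s ''pv''" "scalar s' ''P'' = scalar s ''P''"
      "scalar s' ''e1'' = scalar s ''e1''" "scalar s' ''e2'' = scalar s ''e2''" "scalar s' ''e3'' = scalar s ''e3''"
      "scalar s' ''fi'' = int i" "scalar s' ''fj'' = int j" "arr s' ''A'' = arr s ''A''"
      using fr n ij by (simp_all add: frame_def)
    have A2: "(arr s ''A'' (int l) + arr s ''A'' (int m) = 0) \<longleftrightarrow> l \<in> act n s \<and> m \<in> act n s"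
      using A[OF lm(1)] A[OF lm(2)] lm by (auto simp: act_def)
    have dv: "int t div int n = int l" "int t mod int n = int m"
      by (simp_all add: l_def m_def zdiv_int zmod_int)
    have Qi: "arr s' ''Q'' (int i * int n + int y) = entry n s i y" if "y < n" for y
      using I[rule_format, OF ij(3) that] ij by (simp add: entry_def)
    have Qj: "arr s' ''Q'' (int j * int n + int y) = entry n s j y" if "y < n" for y
      using I[rule_format, OF ij(4) that] ij by (simp add: entry_def)
    have Qt: "arr s' ''Q'' (int t) = entry n s l m"
      using I[rule_format, OF lm(1,2)] lm(3) by (simp add: entry_def)
    have "arr (run M update_body s') ''Q'' =
      (if l \<in> act n s \<and> m \<in> act n s then (arr s' ''Q'')(int t := eliminated n i j s l m) else arr s' ''Q'')"
      using A2 by (simp add: update_body_def row_expr_def fs x dv Qi Qj Qt lm(1,2) eliminated_def)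
    then have R: "entry n (run M update_body s') l' m' =
      (if l \<in> act n s \<and> m \<in> act n s \<and> l' * n + m' = t then eliminated n i j s l m else entry n s' l' m')" for l' m'
      by (auto simp: entry_def simp del: of_nat_add of_nat_mult)
    have "?J (Suc t) (set_scalar ''x'' (int (Suc t)) (run M update_body s'))"
    proof (intro allI impI)
      fix l' m' assume l'm': "l' < n" "m' < n"
      have lt: "l' * n + m' < Suc t \<longleftrightarrow> l' * n + m' < t \<or> (l' = l \<and> m' = m)"
        unfolding l_def m_def using l'm' by (rule index_less_Suc)
      have eq: "l' * n + m' = t \<longleftrightarrow> l' = l \<and> m' = m"
        unfolding l_def m_def using l'm' by auto
      have "entry n (set_scalar ''x'' (int (Suc t)) (run M update_body s')) l' m' = entry n (run M update_body s') l' m'"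
        by (simp add: entry_def)
      then show "entry n (set_scalar ''x'' (int (Suc t)) (run M update_body s')) l' m' =
       (if l' \<in> act n s \<and> m' \<in> act n s \<and> l' * n + m' < Suc t then eliminated n i j s l' m' else entry n s l' m')"
        using I[rule_format, OF l'm'] R[of l' m'] lt eq by auto
    qed
    then show "runs M update_body (ccost update_body) s' (\<lambda>s''. ?J (Suc t) (set_scalar ''x'' (int (Suc t)) s''))"
      by (intro runs_straight) simp_all
  qed (use n in auto)
  then show ?thesis
    by (rule runs_mono) (auto simp: act_less index_less)
qed

text \<open>Slots are filled from the top downwards. Besides the pivot its unit part is kept in
  \<open>u\<close>, whose quadratic character is computed later.\<close>

definition setup_unary :: com where
  "setup_unary =
    (''top'' ::= Var ''top'' -\<^sub>e Num 1 ;;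
     Store ''a'' (Var ''top'') (Arr ''Q'' (Var ''fi'' *\<^sub>e Var ''n'' +\<^sub>e Var ''fi'')) ;;
     Store ''u'' (Var ''top'') (row_expr ''fi'' ''fi'') ;;
     ''e1'' ::= RInv (Arr ''u'' (Var ''top'')) ;;
     ''e2'' ::= Num 0 ;;
     ''e3'' ::= Num 0)"

text \<open>\<open>e1\<close>, \<open>e2\<close>, \<open>e3\<close> are the entries of the inverse
  of the pivot block without its power of p: adjugate times the inverse determinant
  \<open>dd\<close>. The second decrement of \<open>top\<close> skips a slot, which stays zero and
  is the zero block.\<close>

definition setup_binary :: com where
  "setup_binary =
    (''aa'' ::= row_expr ''fi'' ''fi'' ;;
     ''bb'' ::= row_expr ''fi'' ''fj'' ;;
     ''cc'' ::= row_expr ''fj'' ''fj'' ;;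
     ''dd'' ::= RInv (Var ''aa'' *\<^sub>e Var ''cc'' -\<^sub>e Var ''bb'' *\<^sub>e Var ''bb'') ;;
     ''e1'' ::= Var ''cc'' *\<^sub>e Var ''dd'' ;;
     ''e2'' ::= Num 0 -\<^sub>e Var ''bb'' *\<^sub>e Var ''dd'' ;;
     ''e3'' ::= Var ''aa'' *\<^sub>e Var ''dd'' ;;
     ''top'' ::= Var ''top'' -\<^sub>e Num 1 ;;
     Store ''a'' (Var ''top'') (Arr ''Q'' (Var ''fi'' *\<^sub>e Var ''n'' +\<^sub>e Var ''fi'')) ;;
     Store ''b'' (Var ''top'') (Arr ''Q'' (Var ''fi'' *\<^sub>e Var ''n'' +\<^sub>e Var ''fj'')) ;;
     Store ''c'' (Var ''top'') (Arr ''Q'' (Var ''fj'' *\<^sub>e Var ''n'' +\<^sub>e Var ''fj'')) ;;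
     ''top'' ::= Var ''top'' -\<^sub>e Num 1)"

definition setup_pivot :: com where
  "setup_pivot =
    (Cond (Var ''fi'' =\<^sub>e Var ''fj'') setup_unary setup_binary ;;
     Store ''A'' (Var ''fi'') (Num 1) ;;
     Store ''A'' (Var ''fj'') (Num 1))"

definition pivot_round :: com where
  "pivot_round = (search ;;
     Cond (Var ''fi'' <\<^sub>e Num 0)
       (''pv'' ::= Var ''pv'' *\<^sub>e Var ''p'')
       (setup_pivot ;; For ''x'' ''nn'' update_body))"

lemma svars_setup_pivot [simp]:
  "svars setup_pivot = {''top'', ''e1'', ''e2'', ''e3'', ''aa'', ''bb'', ''cc'', ''dd''}"
  and avars_setup_pivot [simp]: "avars setup_pivot = {''a'', ''b'', ''c'', ''u'', ''A''}"
  and straight_setup_pivot [simp]: "straight setup_pivot"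
  by (auto simp: setup_pivot_def setup_unary_def setup_binary_def)

lemma svars_pivot_round [simp]: "svars pivot_round = {''fi'', ''fj'', ''x'', ''i'', ''j'', ''pv'', ''top'', ''e1'', ''e2'', ''e3'', ''aa'', ''bb'', ''cc'', ''dd''}"
  and avars_pivot_round [simp]: "avars pivot_round = {''Q'', ''a'', ''b'', ''c'', ''u'', ''A''}"
  by (auto simp: pivot_round_def search_def)

definition stored :: "int \<Rightarrow> mem \<Rightarrow> nat \<Rightarrow> bool" where
  "stored p s b \<longleftrightarrow> good_block p (blk s b) \<and>
     (arr s ''b'' (int b) = 0 \<longrightarrow> arr s ''a'' (int b) = 0 \<or>
       (\<exists>v. arr s ''a'' (int b) = p ^ v * arr s ''u'' (int b) \<and> \<not> p dvd arr s ''u'' (int b)))"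

text \<open>The inequality on r measures progress: a round either raises the exponent v of
  \<open>pv\<close> or lowers the number of active indices. That number is also the lowest slot in
  use, so slots below it are still zero.\<close>

definition reduced :: "int \<Rightarrow> nat \<Rightarrow> nat \<Rightarrow> (nat \<Rightarrow> nat \<Rightarrow> int) \<Rightarrow> nat \<Rightarrow> mem \<Rightarrow> bool" where
  "reduced p k n Q r s \<longleftrightarrow>
     (\<exists>v. scalar s ''pv'' = p ^ v \<and> r \<le> v + (n - card (act n s))) \<and>
     scalar s ''top'' = int (card (act n s)) \<and>
     (\<forall>l<n. arr s ''A'' (int l) \<in> {0, 1}) \<and>
     (\<forall>l\<in>act n s. \<forall>m\<in>act n s. entry n s l m \<in> {0..<p ^ k} \<and> entry n s l m = entry n s m l
        \<and> scalar s ''pv'' dvd entry n s l m) \<and>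
     decomposed (p ^ k) {..<n} Q (map (blk s) (rev [card (act n s)..<n])) (act n s) (entry n s) \<and>
     (\<forall>b<card (act n s). blk s b = (0, 0, 0)) \<and>
     (\<forall>b. card (act n s) \<le> b \<and> b < n \<longrightarrow> stored p s b)"

lemma card_act_le: "card (act n s) \<le> n"
  using card_mono[of "{..<n}" "act n s"] by (auto simp: act_def)

lemma coprime_power_prime:
  fixes p u :: int
  assumes "prime p" "\<not> p dvd u"
  shows "coprime u (p ^ k)"
  using prime_imp_coprime[OF assms] by (simp add: coprime_commute)

text \<open>Let q = p^v divide all active entries. The chosen entry is q times a unit. On the
  diagonal its unit part is inverted; off the diagonal the active diagonal entries are divisible by
  \<open>q * p\<close>, which makes the block q times one with unit determinant. The power q itself
  is only divided off and multiplied back, so the updated entries remain divisible by it.\<close>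

lemma reduced_eliminate:
  assumes p: "prime p"
    and const: "scalar s ''n'' = int n" "scalar s ''nn'' = int (n * n)" "scalar s ''p'' = p" "scalar s ''P'' = p ^ k"
    and red: "reduced p k n Q r s"
    and ij: "i \<in> act n s" "j \<in> act n s" "scalar s ''fi'' = int i" "scalar s ''fj'' = int j"
      "\<not> scalar s ''pv'' * p dvd entry n s i j"
      "i \<noteq> j \<longrightarrow> (\<forall>l\<in>act n s. scalar s ''pv'' * p dvd entry n s l l)"
    and s1: "s1 = run (p ^ k) setup_pivot s"
    and s2: "\<forall>l\<in>act n s1. \<forall>m\<in>act n s1. entry n s2 l m = eliminated n i j s1 l m"
      "frame {''x'', ''i'', ''j''} {''Q''} s1 s2"
  shows "reduced p k n Q (Suc r) s2"
proof -
  have p1: "p > 1" using p prime_gt_1_int by auto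
  define S where "S = act n s"
  define S' where "S' = S - {i, j}"
  define N where "N = card S"
  define N' where "N' = card S'"
  obtain v where v: "scalar s ''pv'' = p ^ v" "r \<le> v + (n - N)" using red by (auto simp: reduced_def S_def N_def)
  have top: "scalar s ''top'' = int N" and A: "\<And>l. l < n \<Longrightarrow> arr s ''A'' (int l) \<in> {0, 1}"
    and E: "\<And>l m. l \<in> S \<Longrightarrow> m \<in> S \<Longrightarrow> entry n s l m \<in> {0..<p ^ k} \<and> entry n s l m = entry n s m l \<and> p ^ v dvd entry n s l m"
    and dec: "decomposed (p ^ k) {..<n} Q (map (blk s) (rev [N..<n])) S (entry n s)"
    and zero: "\<And>b. b < N \<Longrightarrow> blk s b = (0, 0, 0)" and st: "\<And>b. N \<le> b \<Longrightarrow> b < n \<Longrightarrow> stored p s b"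
    using red v(1) by (simp_all add: reduced_def S_def N_def)
  have iS: "i \<in> S" "j \<in> S" "i < n" "j < n" using ij by (simp_all add: S_def act_def)
  have finS: "finite S" "finite S'" by (simp_all add: S_def S'_def)
  have Nn: "N \<le> n" unfolding N_def S_def by (rule card_act_le)
  have nd: "\<not> p ^ Suc v dvd entry n s i j" using ij(5) by (simp add: v mult.commute)
  \<comment> \<open>The pivot is a representative below p^k not divisible by
    \<open>p ^ Suc v\<close>. Had v reached k, it would be 0. With v < k, reduction modulo p^k
    preserves divisibility by p^v.\<close>
  have vk: "v < k"
  proof (rule ccontr)
    assume "\<not> v < k"
    then have "p ^ k dvd p ^ v" by (simp add: le_imp_power_dvd)
    then have "p ^ k dvd entry n s i j" using E[OF iS(1,2)] dvd_trans by blast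
    moreover have "0 \<le> entry n s i j" "entry n s i j < p ^ k" using E[OF iS(1,2)] by auto
    ultimately have "entry n s i j = 0" by (rule dvd_less_imp_0)
    then show False using nd by simp
  qed
  have Pk: "p ^ v dvd p ^ k" "p ^ k > 0" using vk p1 by (simp_all add: le_imp_power_dvd)
  have arrA: "arr s1 ''A'' = (arr s ''A'')(int i := 1, int j := 1)"
    using ij by (simp add: s1 setup_pivot_def setup_unary_def setup_binary_def)
  have act1: "act n s1 = S'"
    by (auto simp: act_def S'_def S_def arrA)
  have act2: "act n s2 = S'"
    using act1 frame_arr[OF s2(2), of "''A''"] by (simp add: act_def)
  have entry1: "entry n s1 = entry n s"
    by (simp add: fun_eq_iff s1 setup_pivot_def setup_unary_def setup_binary_def entry_def)
  have pv1: "scalar s1 ''pv'' = p ^ v" "scalar s1 ''P'' = p ^ k" "scalar s1 ''n'' = int n"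
    using const v by (simp_all add: s1 setup_pivot_def setup_unary_def setup_binary_def)
  have pv2: "scalar s2 ''pv'' = p ^ v" "scalar s2 ''top'' = scalar s1 ''top''"
    using pv1 s2(2) by (simp_all add: frame_def)
  have arr2: "arr s2 a = arr s1 a" if "a \<noteq> ''Q''" for a
    using s2(2) that by (simp add: frame_def)
  have A2: "arr s2 ''A'' (int l) \<in> {0, 1}" if "l < n" for l
    using A[OF that] arr2[of "''A''"] by (simp add: arrA)
  define q where "q = p ^ v"
  define w where "w = (\<lambda>l. entry n s i l div q)"
  define w' where "w' = (\<lambda>l. entry n s j l div q)"
  have ww: "entry n s i l = q * w l" "entry n s j l = q * w' l" if "l \<in> S" for l
  proof -
    have "q dvd entry n s i l" "q dvd entry n s j l"
      using E[OF iS(1) that] E[OF iS(2) that] unfolding q_def by blast+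
    then show "entry n s i l = q * w l" "entry n s j l = q * w' l" by (simp_all add: w_def w'_def)
  qed
  have E2: "entry n s2 l m = (entry n s l m - q * (scalar s1 ''e1'' * (w l * w m)
     + scalar s1 ''e2'' * (w l * w' m + w' l * w m) + scalar s1 ''e3'' * (w' l * w' m))) mod p ^ k"
    if "l \<in> S'" "m \<in> S'" for l m
    using s2(1)[unfolded act1, rule_format, OF that] unfolding eliminated_def entry1 pv1 w_def w'_def q_def .
  have E3: "entry n s2 l m \<in> {0..<p ^ k} \<and> entry n s2 l m = entry n s2 m l \<and> p ^ v dvd entry n s2 l m"
    if "l \<in> S'" "m \<in> S'" for l m
  proof -
    have lm: "l \<in> S" "m \<in> S" using that by (simp_all add: S'_def)
    have el: "entry n s l m = entry n s m l" "p ^ v dvd entry n s l m" using E[OF lm] by blast+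
    have "entry n s2 l m = entry n s2 m l"
      unfolding E2[OF that] E2[OF that(2,1)] using el(1)
      by (simp add: mult.commute add.commute)
    moreover have "p ^ v dvd entry n s2 l m"
      unfolding E2[OF that] using el(2) Pk(1) by (intro dvd_mod dvd_diff) (simp_all add: q_def)
    moreover have "entry n s2 l m \<in> {0..<p ^ k}"
      unfolding E2[OF that] using Pk(2) by simp
    ultimately show ?thesis by blast
  qed
  have main: "scalar s1 ''top'' = int N' \<and> N' < N \<and> (\<forall>b<N'. blk s1 b = (0, 0, 0)) \<and> (\<forall>b. N' \<le> b \<and> b < n \<longrightarrow> stored p s1 b)
     \<and> decomposed (p ^ k) {..<n} Q (map (blk s1) (rev [N'..<n])) S' (entry n s2)"
  proof (cases "i = j")
    case True
    have "N = Suc N'"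
      using iS finS True by (simp add: N_def N'_def S'_def card_Suc_Diff1 del: card_Diff_insert)
    then have N: "N = Suc N'" "N' < n" using Nn by simp_all
    define u where "u = w i"
    have u: "entry n s i i = q * u" using ww(1)[OF iS(1)] by (simp add: u_def)
    have pu: "\<not> p dvd u" using nd True p1 u by (simp add: q_def power_Suc2 del: power_Suc)
    define e where "e = modular_inverse (p ^ k) u"
    have ue: "[u * e = 1] (mod p ^ k)" unfolding e_def by (rule cong_modular_inverse1[OF coprime_power_prime[OF p pu]])
    have ent: "arr s ''Q'' (int l * int n + int m) = entry n s l m" for l m by (simp add: entry_def)
    have t1: "scalar s1 ''top'' = int N'"
      using top N True ij by (simp add: s1 setup_pivot_def setup_unary_def)
    have b1: "blk s1 b = (if b = N' then (entry n s i i, 0, 0) else blk s b)" for b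
      using top N True ij zero[of N'] const
      by (auto simp: s1 setup_pivot_def setup_unary_def blk_def ent)
    have u1: "arr s1 ''u'' (int b) = (if b = N' then u else arr s ''u'' (int b))" for b
      using top N True ij const
      by (auto simp: s1 setup_pivot_def setup_unary_def row_expr_def ent u_def w_def q_def v)
    have e1: "scalar s1 ''e1'' = e" "scalar s1 ''e2'' = 0" "scalar s1 ''e3'' = 0"
      using top N True ij const
      by (auto simp: s1 setup_pivot_def setup_unary_def row_expr_def ent e_def u_def w_def q_def v)
    have "\<forall>b<N'. blk s1 b = (0, 0, 0)" using zero N by (simp add: b1)
    moreover have "stored p s1 b" if "N' \<le> b" "b < n" for b
    proof (cases "b = N'")
      case True
      then have "blk s1 b = (q * u, 0, 0)" "arr s1 ''u'' (int b) = u" using u by (simp_all add: b1 u1)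
      then show ?thesis using pu by (auto simp: stored_def blk_def q_def)
    next
      case False
      then have "blk s1 b = blk s b" "arr s1 ''u'' (int b) = arr s ''u'' (int b)" by (simp_all add: b1 u1)
      then show ?thesis using st[of b] that False N by (simp add: stored_def blk_def)
    qed
    moreover have "decomposed (p ^ k) {..<n} Q (map (blk s1) (rev [N'..<n])) S' (entry n s2)"
    proof -
      \<comment> \<open>As slots are filled downwards, the reversed interval lists the blocks in the
        order of elimination, and the new one is appended.\<close>
      have "rev [N'..<n] = rev [N..<n] @ [N']" using N by (simp add: upt_conv_Cons)
      moreover have "map (blk s1) (rev [N..<n]) = map (blk s) (rev [N..<n])"
        using N by (auto simp: b1)
      ultimately have L: "map (blk s1) (rev [N'..<n]) = map (blk s) (rev [N..<n]) @ [(entry n s i i, 0, 0)]"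
        by (simp add: b1)
      show ?thesis unfolding L
      proof (rule decomposed_unary[where M = "entry n s" and i = i and q = q and w = w and u = u and e = e])
        have "S = insert i S'" using iS True by (auto simp: S'_def)
        then show "decomposed (p ^ k) {..<n} Q (map (blk s) (rev [N..<n])) (insert i S') (entry n s)"
          using dec by simp
        fix l m assume lm: "l \<in> S'" "m \<in> S'"
        show "[entry n s2 l m = entry n s l m - q * (e * (w l * w m))] (mod p ^ k)"
          unfolding E2[OF lm] e1 by (simp add: cong_def)
      qed (use Pk finS ue u E iS ww in \<open>auto simp: S'_def True\<close>)
    qed
    moreover have "N' < N" using N by simp
    ultimately show ?thesis using t1 by blast
  next
    case False
    have "card (S - {i, j}) = card S - 2" "card S \<ge> 2"
      using iS finS False card_mono[of S "{i, j}"] by (simp_all add: card_Diff_subset)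
    then have "N = Suc (Suc N')" by (simp add: N_def N'_def S'_def)
    then have N: "N = Suc (Suc N')" "Suc N' < n" using Nn by simp_all
    have diag: "p ^ Suc v dvd entry n s l l" if "l \<in> S" for l
      using ij(6) False that by (simp add: S_def v mult.commute)
    define a where "a = w i"
    define b where "b = w j"
    define c where "c = w' j"
    have abc: "entry n s i i = q * a" "entry n s i j = q * b" "entry n s j j = q * c"
      using ww iS by (simp_all add: a_def b_def c_def)
    have q0: "q \<noteq> 0" using p1 by (simp add: q_def)
    have pabc: "p dvd a" "p dvd c" "\<not> p dvd b"
      using diag[OF iS(1)] diag[OF iS(2)] nd p1 unfolding abc by (simp_all add: q_def power_Suc2 del: power_Suc)
    \<comment> \<open>p divides \<open>a * c\<close> but not \<open>b * b\<close>, so the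
      determinant is a unit. The 2 of the cross term does not enter the matrix, so p = 2 is no
      exception.\<close>
    have "\<not> p dvd b * b" using pabc(3) p by (simp add: prime_dvd_mult_iff)
    then have nd2: "\<not> p dvd a * c - b * b"
      using dvd_diff[of p "a * c" "a * c - b * b"] pabc(1) by auto
    define d where "d = modular_inverse (p ^ k) (a * c - b * b)"
    have dd: "[(a * c - b * b) * d = 1] (mod p ^ k)"
      unfolding d_def by (rule cong_modular_inverse1[OF coprime_power_prime[OF p nd2]])
    have ent: "arr s ''Q'' (int l * int n + int m) = entry n s l m" for l m by (simp add: entry_def)
    have abcdef: "entry n s i i div q = a" "entry n s i j div q = b" "entry n s j j div q = c"
      by (simp_all add: a_def b_def c_def w_def w'_def)
    have t1: "scalar s1 ''top'' = int N'"
      using top N False ij by (simp add: s1 setup_pivot_def setup_binary_def)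
    have b1: "blk s1 x = (if x = Suc N' then (entry n s i i, entry n s i j, entry n s j j) else blk s x)" for x
      using top N False ij const
      by (auto simp: s1 setup_pivot_def setup_binary_def blk_def ent)
    have u1: "arr s1 ''u'' = arr s ''u''"
      using False ij by (simp add: s1 setup_pivot_def setup_binary_def)
    have e1: "scalar s1 ''e1'' = c * d" "scalar s1 ''e2'' = - (b * d)" "scalar s1 ''e3'' = a * d"
      using top N False ij const
      by (simp_all add: s1 setup_pivot_def setup_binary_def row_expr_def ent v q_def[symmetric] abcdef d_def[symmetric])
    have "\<forall>b<N'. blk s1 b = (0, 0, 0)" using zero N by (simp add: b1)
    moreover have "stored p s1 x" if x: "N' \<le> x" "x < n" for x
    proof -
      consider "x = N'" | "x = Suc N'" | "N \<le> x" using x N by linarith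
      then show ?thesis
      proof cases
        case 1
        then have "blk s1 x = (0, 0, 0)" using zero[of N'] N by (simp add: b1)
        then show ?thesis by (simp add: stored_def blk_def)
      next
        case 2
        then have B: "blk s1 x = (q * a, q * b, q * c)" by (simp add: b1 abc)
        obtain a' c' where "a = p * a'" "c = p * c'" using pabc by (auto elim!: dvdE)
        then have "good_block p (blk s1 x)" using pabc(3) unfolding B q_def by auto
        moreover have "q * b \<noteq> 0" using pabc(3) q0 by auto
        ultimately show ?thesis using B by (simp add: stored_def blk_def)
      next
        case 3
        then have "blk s1 x = blk s x" "arr s1 ''u'' = arr s ''u''" using N by (simp_all add: b1 u1)
        then show ?thesis using st[of x] x 3 by (simp add: stored_def blk_def)
      qed
    qed
    moreover have "decomposed (p ^ k) {..<n} Q (map (blk s1) (rev [N'..<n])) S' (entry n s2)"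
    proof -
      have "rev [N'..<n] = rev [N..<n] @ [Suc N', N']" using N by (simp add: upt_conv_Cons)
      moreover have "map (blk s1) (rev [N..<n]) = map (blk s) (rev [N..<n])"
        using N by (auto simp: b1)
      moreover have "blk s1 N' = (0, 0, 0)" using zero[of N'] N by (simp add: b1)
      ultimately have L: "map (blk s1) (rev [N'..<n])
          = map (blk s) (rev [N..<n]) @ [(entry n s i i, entry n s i j, entry n s j j), (0, 0, 0)]"
        by (simp add: b1)
      have sym: "entry n s l i = entry n s i l" "entry n s l j = entry n s j l" if "l \<in> S'" for l
        using E iS that unfolding S'_def by blast+
      have symij: "entry n s j i = entry n s i j" using E[OF iS(2,1)] by blast
      have w: "entry n s i l = q * w l" "entry n s j l = q * w' l" if "l \<in> S'" for l
        using ww that unfolding S'_def by blast+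
      show ?thesis unfolding L
      proof (rule decomposed_binary[where M = "entry n s" and i = i and j = j and q = q and w = w and w' = w' and a = a and b = b and c = c and d = d])
        have "S = insert i (insert j S')" using iS by (auto simp: S'_def)
        then show "decomposed (p ^ k) {..<n} Q (map (blk s) (rev [N..<n])) (insert i (insert j S')) (entry n s)"
          using dec by simp
        fix l m assume lm: "l \<in> S'" "m \<in> S'"
        show "[entry n s2 l m = entry n s l m - q * (c * d * (w l * w m)
         + - (b * d) * (w l * w' m + w' l * w m) + a * d * (w' l * w' m))] (mod p ^ k)"
          unfolding E2[OF lm] e1 by (simp add: cong_def)
      qed ((fact sym symij w Pk(2) finS(2) dd abc False | simp add: S'_def)+)
    qed
    moreover have "N' < N" using N by simp
    ultimately show ?thesis using t1 by blast
  qed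
  have blk2: "blk s2 = blk s1" "stored p s2 = stored p s1"
    using arr2 by (simp_all add: blk_def stored_def fun_eq_iff)
  have "Suc r \<le> v + (n - N')" using v(2) main Nn by linarith
  then show ?thesis
    unfolding reduced_def act2 pv2 blk2 N'_def[symmetric] using main A2 E3
    by (intro conjI exI[of _ v]) blast+
qed

lemma reduced_no_pivot:
  assumes p: "prime p"
    and red: "reduced p k n Q r s"
    and dv: "\<forall>l\<in>act n s. \<forall>m\<in>act n s. scalar s ''pv'' * p dvd entry n s l m"
  shows "reduced p k n Q (Suc r) (set_scalar ''pv'' (scalar s ''pv'' * p) s)"
proof -
  let ?s = "set_scalar ''pv'' (scalar s ''pv'' * p) s"
  have eqs: "act n ?s = act n s" "entry n ?s = entry n s" "blk ?s = blk s" "stored p ?s = stored p s"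
    "scalar ?s ''top'' = scalar s ''top''" "arr ?s = arr s" "scalar ?s ''pv'' = scalar s ''pv'' * p"
    by (simp_all add: act_def entry_def blk_def stored_def fun_eq_iff)
  obtain v where "scalar s ''pv'' = p ^ v" "r \<le> v + (n - card (act n s))" using red by (auto simp: reduced_def)
  then have "scalar ?s ''pv'' = p ^ Suc v" "Suc r \<le> Suc v + (n - card (act n s))" by simp_all
  then have "\<exists>v. scalar ?s ''pv'' = p ^ v \<and> Suc r \<le> v + (n - card (act n s))" by blast
  then show ?thesis using red dv unfolding reduced_def eqs by simp
qed

definition pivot_round_cost :: "nat \<Rightarrow> nat" where
  "pivot_round_cost n = (2 + (n * n * (ccost search_body + 8) + 6)) +
     (4 + (4 + (ccost setup_pivot + (n * n * (ccost update_body + 8) + 6))))"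

lemma runs_pivot_round:
  assumes p: "prime p"
    and const: "scalar s ''n'' = int n" "scalar s ''nn'' = int (n * n)" "scalar s ''p'' = p" "scalar s ''P'' = p ^ k"
    and red: "reduced p k n Q r s"
  shows "runs (p ^ k) pivot_round (pivot_round_cost n) s (reduced p k n Q (Suc r))"
  unfolding pivot_round_def pivot_round_cost_def
proof (rule runs_Seq_frame)
  have A: "\<And>l. l < n \<Longrightarrow> arr s ''A'' (int l) \<in> {0, 1}" using red by (auto simp: reduced_def)
  show "runs (p ^ k) search (2 + (n * n * (ccost search_body + 8) + 6)) s (found n (scalar s ''pv'' * p) s (n * n))"
    using const A by (intro runs_search) auto
next
  fix s1 assume F: "found n (scalar s ''pv'' * p) s (n * n) s1" and fr: "frame (svars search) (avars search) s s1"
  have sc: "scalar s1 x = scalar s x" if "x \<notin> {''fi'', ''fj'', ''x'', ''i'', ''j''}" for x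
    using fr that by (simp add: frame_def search_def)
  have ar: "arr s1 = arr s" using fr by (simp add: frame_def search_def fun_eq_iff)
  have eqs: "act n s1 = act n s" "entry n s1 = entry n s" "blk s1 = blk s" "stored p s1 = stored p s"
    by (simp_all add: act_def entry_def blk_def stored_def fun_eq_iff ar)
  have red1: "reduced p k n Q r s1" using red unfolding reduced_def eqs ar by (simp add: sc)
  have const1: "scalar s1 ''n'' = int n" "scalar s1 ''nn'' = int (n * n)" "scalar s1 ''p'' = p" "scalar s1 ''P'' = p ^ k"
    using const by (simp_all add: sc)
  have pv1: "scalar s1 ''pv'' = scalar s ''pv''" by (simp add: sc)
  have "runs (p ^ k) (Cond (Var ''fi'' <\<^sub>e Num 0) (''pv'' ::= Var ''pv'' *\<^sub>e Var ''p'') (setup_pivot ;; For ''x'' ''nn'' update_body))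
    (1 + cost (Var ''fi'' <\<^sub>e Num 0) + (4 + (ccost setup_pivot + (n * n * (ccost update_body + 8) + 6)))) s1 (reduced p k n Q (Suc r))"
  proof (rule runs_Cond)
    assume "eval_expr (p ^ k) s1 (Var ''fi'' <\<^sub>e Num 0) \<noteq> 0"
    then have neg: "scalar s1 ''fi'' < 0" by (simp split: if_splits)
    have "\<forall>l\<in>act n s1. \<forall>m\<in>act n s1. scalar s1 ''pv'' * p dvd entry n s1 l m"
      using F neg unfolding found_def eqs pv1 by (auto simp: act_less index_less)
    from reduced_no_pivot[OF p red1 this] const1(3)
    have "runs (p ^ k) (''pv'' ::= Var ''pv'' *\<^sub>e Var ''p'') (ccost (''pv'' ::= Var ''pv'' *\<^sub>e Var ''p'')) s1 (reduced p k n Q (Suc r))"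
      by (intro runs_straight) simp_all
    then show "runs (p ^ k) (''pv'' ::= Var ''pv'' *\<^sub>e Var ''p'')
      (4 + (ccost setup_pivot + (n * n * (ccost update_body + 8) + 6))) s1 (reduced p k n Q (Suc r))"
      by (rule runs_mono) auto
  next
    assume "eval_expr (p ^ k) s1 (Var ''fi'' <\<^sub>e Num 0) = 0"
    then have "\<not> scalar s1 ''fi'' < 0" by (simp split: if_splits)
    then obtain i j where ij: "i \<in> act n s1" "j \<in> act n s1" "scalar s1 ''fi'' = int i" "scalar s1 ''fj'' = int j"
      "\<not> scalar s1 ''pv'' * p dvd entry n s1 i j"
      "i \<noteq> j \<longrightarrow> (\<forall>l\<in>act n s1. scalar s1 ''pv'' * p dvd entry n s1 l l)"
      using F unfolding found_def eqs pv1 by (auto simp: act_less index_less)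
    let ?s = "run (p ^ k) setup_pivot s1"
    have "runs (p ^ k) (setup_pivot ;; For ''x'' ''nn'' update_body) (ccost setup_pivot + (n * n * (ccost update_body + 8) + 6)) s1 (reduced p k n Q (Suc r))"
    proof (rule runs_Seq_frame[OF runs_run])
      fix s2 assume s2: "s2 = run (p ^ k) setup_pivot s1" and f2: "frame (svars setup_pivot) (avars setup_pivot) s1 s2"
      have A1: "\<And>l. l < n \<Longrightarrow> arr s1 ''A'' (int l) \<in> {0, 1}" using red1 by (auto simp: reduced_def)
      have arrA: "arr s2 ''A'' = (arr s1 ''A'')(int i := 1, int j := 1)"
        using ij by (simp add: s2 setup_pivot_def setup_unary_def setup_binary_def)
      have const2: "scalar s2 ''n'' = int n" "scalar s2 ''nn'' = int (n * n)" "scalar s2 ''fi'' = int i" "scalar s2 ''fj'' = int j"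
        using f2 const1 ij by (simp_all add: frame_def)
      have A2: "arr s2 ''A'' (int l) \<in> {0, 1}" if "l < n" for l using A1[OF that] by (simp add: arrA)
      have nact: "i \<notin> act n s2" "j \<notin> act n s2" by (simp_all add: act_def arrA)
      have "i < n" "j < n" using ij by (simp_all add: act_def)
      from runs_update[OF const2(1,2) A2 const2(3,4) this nact]
      show "runs (p ^ k) (For ''x'' ''nn'' update_body) (n * n * (ccost update_body + 8) + 6) s2 (reduced p k n Q (Suc r))"
        by (rule runs_mono) (auto intro: reduced_eliminate[OF p const1 red1 ij s2])
    qed simp
    then show "runs (p ^ k) (setup_pivot ;; For ''x'' ''nn'' update_body)
      (4 + (ccost setup_pivot + (n * n * (ccost update_body + 8) + 6))) s1 (reduced p k n Q (Suc r))"
      by (rule runs_mono) auto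
  qed
  then show "runs (p ^ k) (Cond (Var ''fi'' <\<^sub>e Num 0) (''pv'' ::= Var ''pv'' *\<^sub>e Var ''p'') (setup_pivot ;; For ''x'' ''nn'' update_body))
    (4 + (4 + (ccost setup_pivot + (n * n * (ccost update_body + 8) + 6)))) s1 (reduced p k n Q (Suc r))"
    by (rule runs_mono) auto
qed

section \<open>Reduction to blocks\<close>

text \<open>The modulus is not among the inputs. Ring addition of -1 and 0 yields the largest
  representative, one less than the modulus, so p^k is available in constant time.\<close>

definition reduce_init :: com where
  "reduce_init =
    (''P'' ::= Op RAdd (Num (-1)) (Num 0) +\<^sub>e Num 1 ;;
     ''nn'' ::= Var ''n'' *\<^sub>e Var ''n'' ;;
     ''nk'' ::= Var ''n'' +\<^sub>e Var ''k'' ;;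
     ''pv'' ::= Num 1 ;;
     ''top'' ::= Var ''n'')"

definition mod_body :: com where
  "mod_body = Store ''Q'' (Var ''x'') (Arr ''Q'' (Var ''x'') mod\<^sub>e Var ''P'')"

definition reduce :: com where
  "reduce = (reduce_init ;; For ''x'' ''nn'' mod_body ;; For ''r'' ''nk'' pivot_round)"

lemma svars_reduce [simp]: "svars reduce = {''P'', ''nn'', ''nk'', ''r'', ''fi'', ''fj'', ''x'', ''i'', ''j'', ''pv'', ''top'',
    ''e1'', ''e2'', ''e3'', ''aa'', ''bb'', ''cc'', ''dd''}"
  by (auto simp: reduce_def reduce_init_def mod_body_def)

lemma count_input_simps:
  "scalar (count_input p k n Q t) ''p'' = int p"
  "scalar (count_input p k n Q t) ''k'' = int k"
  "scalar (count_input p k n Q t) ''n'' = int n"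
  "scalar (count_input p k n Q t) ''t'' = t"
  "arr (count_input p k n Q t) ''Q'' = row_major n Q"
  "a \<noteq> ''Q'' \<Longrightarrow> arr (count_input p k n Q t) a = (\<lambda>_. 0)"
  by (simp_all add: count_input_def)

definition reduce_cost :: "nat \<Rightarrow> nat \<Rightarrow> nat" where
  "reduce_cost n k = ccost reduce_init + ((n * n * (ccost mod_body + 8) + 6) + ((n + k) * (pivot_round_cost n + 8) + 6))"

text \<open>After n + k rounds the progress inequality gives v >= k, so p^k divides the remaining
  active entries; being representatives below p^k they are 0, and zero blocks complete the
  list.\<close>

lemma reduced_final:
  assumes p: "prime p" and red: "reduced p k n Q (n + k) s" and g: "periodic (p ^ k) g"
  shows "(p ^ k) ^ n * form_sum (p ^ k) {..<n} Q g v = bsum free (p ^ k) (map (blk s) (rev [0..<n])) g v"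
    and "\<forall>b<n. stored p s b"
proof -
  have p1: "p > 1" using p prime_gt_1_int by auto
  define S where "S = act n s"
  define N where "N = card S"
  have Nn: "N \<le> n" unfolding N_def S_def by (rule card_act_le)
  obtain w where w: "scalar s ''pv'' = p ^ w" "n + k \<le> w + (n - N)"
    using red by (auto simp: reduced_def S_def N_def)
  have E: "\<And>l m. l \<in> S \<Longrightarrow> m \<in> S \<Longrightarrow> entry n s l m \<in> {0..<p ^ k} \<and> p ^ w dvd entry n s l m"
    and dec: "decomposed (p ^ k) {..<n} Q (map (blk s) (rev [N..<n])) S (entry n s)"
    and zero: "\<And>b. b < N \<Longrightarrow> blk s b = (0, 0, 0)" and st: "\<And>b. N \<le> b \<Longrightarrow> b < n \<Longrightarrow> stored p s b"
    using red w(1) by (simp_all add: reduced_def S_def N_def)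
  have kw: "p ^ k dvd p ^ w" using w(2) Nn by (intro le_imp_power_dvd) linarith
  have Z: "entry n s l m = 0" if "l \<in> S" "m \<in> S" for l m
    using E[OF that] kw by (intro dvd_less_imp_0[of "p ^ k"]) (auto intro: dvd_trans)
  have "rev [0..<n] = rev [N..<n] @ rev [0..<N]"
    using Nn upt_add_eq_append[of 0 N "n - N"] by (simp flip: rev_append)
  moreover have "map (blk s) (rev [0..<N]) = replicate (card S) (0, 0, 0)"
    unfolding N_def[symmetric] by (rule replicate_eqI) (auto simp: zero)
  ultimately have "map (blk s) (rev [0..<n]) = map (blk s) (rev [N..<n]) @ replicate (card S) (0, 0, 0)"
    by simp
  then show "(p ^ k) ^ n * form_sum (p ^ k) {..<n} Q g v = bsum free (p ^ k) (map (blk s) (rev [0..<n])) g v"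
    using decomposed_zero[OF dec _ _ Z g] p1 Nn by (simp add: S_def N_def[unfolded S_def, symmetric])
  show "\<forall>b<n. stored p s b"
  proof (intro allI impI)
    fix b assume "b < n"
    show "stored p s b"
    proof (cases "N \<le> b")
      case False
      then have "blk s b = (0, 0, 0)" using zero by simp
      then show ?thesis by (simp add: stored_def blk_def)
    qed (use st \<open>b < n\<close> in auto)
  qed
qed

lemma runs_reduce:
  assumes p: "prime p" and k: "1 \<le> k" and Q: "Q \<in> carrier_mat n n" "transpose_mat Q = Q"
  shows "runs (int p ^ k) reduce (reduce_cost n k) (count_input p k n Q t)
    (\<lambda>s. scalar s ''P'' = int p ^ k \<and> (\<forall>b<n. stored (int p) s b) \<and>
       (\<forall>g v. periodic (int p ^ k) g \<longrightarrow>
         (int p ^ k) ^ n * form_sum (int p ^ k) {..<n} (\<lambda>l m. Q $$ (l, m)) g v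
          = bsum free (int p ^ k) (map (blk s) (rev [0..<n])) g v))" (is "runs _ _ _ _ ?R")
  unfolding reduce_def reduce_cost_def
proof (rule runs_Seq_frame[OF runs_run])
  have p': "prime (int p)" using p by simp
  have P1: "int p ^ k > 1" using prime_gt_1_int[OF p'] k by simp
  let ?s = "count_input p k n Q t"
  fix s1 assume s1: "s1 = run (int p ^ k) reduce_init ?s"
  have "(-1 :: int) mod (int p ^ k) = int p ^ k - 1"
    using P1 zmod_minus1[of "int p ^ k"] by linarith
  then have c1: "scalar s1 ''P'' = int p ^ k" "scalar s1 ''nn'' = int (n * n)" "scalar s1 ''nk'' = int (n + k)"
    "scalar s1 ''pv'' = 1" "scalar s1 ''top'' = int n" "scalar s1 ''n'' = int n" "scalar s1 ''p'' = int p"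
    "arr s1 = arr ?s"
    by (simp_all add: s1 reduce_init_def count_input_simps)
  let ?J = "\<lambda>x s. \<forall>y<n * n. arr s ''Q'' (int y) =
    (if y < x then row_major n Q (int y) mod int p ^ k else row_major n Q (int y))"
  have "runs (int p ^ k) (For ''x'' ''nn'' mod_body) (n * n * (ccost mod_body + 8) + 6) s1
    (\<lambda>s. ?J (n * n) s \<and> frame (insert ''x'' (svars mod_body)) (avars mod_body) s1 s)"
  proof (rule runs_For[where I = ?J])
    show "?J 0 (set_scalar ''x'' 0 s1)" by (simp add: c1 count_input_simps)
    fix x s' assume x: "x < n * n" "scalar s' ''x'' = int x" and J: "?J x s'"
      and fr: "frame (insert ''x'' (svars mod_body)) (avars mod_body) s1 s'"
    have "scalar s' ''P'' = int p ^ k" using fr c1 by (simp add: frame_def mod_body_def)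
    then have "?J (Suc x) (set_scalar ''x'' (int (Suc x)) (run (int p ^ k) mod_body s'))"
      using J x by (auto simp: mod_body_def less_Suc_eq)
    then show "runs (int p ^ k) mod_body (ccost mod_body) s' (\<lambda>s''. ?J (Suc x) (set_scalar ''x'' (int (Suc x)) s''))"
      by (intro runs_straight) (simp_all add: mod_body_def)
  qed (use c1 in \<open>auto simp: mod_body_def\<close>)
  then show "runs (int p ^ k) (For ''x'' ''nn'' mod_body ;; For ''r'' ''nk'' pivot_round)
     ((n * n * (ccost mod_body + 8) + 6) + ((n + k) * (pivot_round_cost n + 8) + 6)) s1
    ?R"
  proof (rule runs_Seq_frame)
    fix s2 assume J: "?J (n * n) s2 \<and> frame (insert ''x'' (svars mod_body)) (avars mod_body) s1 s2"
    then have c2: "scalar s2 ''P'' = int p ^ k" "scalar s2 ''nn'' = int (n * n)" "scalar s2 ''nk'' = int (n + k)"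
       "scalar s2 ''pv'' = 1" "scalar s2 ''top'' = int n" "scalar s2 ''n'' = int n" "scalar s2 ''p'' = int p"
      and ar: "\<And>a. a \<noteq> ''Q'' \<Longrightarrow> arr s2 a = (\<lambda>_. 0)"
      using c1 by (simp_all add: frame_def mod_body_def count_input_simps)
    have act: "act n s2 = {..<n}" by (auto simp: act_def ar)
    have ent: "entry n s2 l m = Q $$ (l, m) mod int p ^ k" if "l < n" "m < n" for l m
    proof -
      have "arr s2 ''Q'' (int (l * n + m)) = row_major n Q (int (l * n + m)) mod int p ^ k"
        using J[THEN conjunct1, rule_format, OF index_less[OF that]] index_less[OF that] by (simp del: of_nat_add of_nat_mult)
      moreover have "row_major n Q (int (l * n + m)) = Q $$ (l, m)"
      proof -
        have "int (l * n + m) < int (n * n)" using index_less[OF that] by (simp only: of_nat_less_iff)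
        then show ?thesis using that by (simp add: row_major_def del: of_nat_add of_nat_mult)
      qed
      ultimately show ?thesis by (simp add: entry_def)
    qed
    have sym: "Q $$ (l, m) = Q $$ (m, l)" if "l < n" "m < n" for l m
      using that Q by (metis carrier_matD index_transpose_mat(1))
    have P0: "0 < int p ^ k" using P1 by linarith
    have range: "0 \<le> y mod int p ^ k" "y mod int p ^ k < int p ^ k" for y
      by (rule pos_mod_sign[OF P0], rule pos_mod_bound[OF P0])
    have "decomposed (int p ^ k) {..<n} (\<lambda>l m. Q $$ (l, m)) [] {..<n} (entry n s2)"
      by (rule decomposed_init) (simp add: ent cong_def)
    then have red: "reduced (int p) k n (\<lambda>l m. Q $$ (l, m)) 0 s2"
      using P1 unfolding reduced_def act c2
      using sym by (auto simp: ar ent blk_def range intro!: exI[of _ 0])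
    have "runs (int p ^ k) (For ''r'' ''nk'' pivot_round) ((n + k) * (pivot_round_cost n + 8) + 6) s2
      (\<lambda>s. reduced (int p) k n (\<lambda>l m. Q $$ (l, m)) (n + k) s \<and> frame (insert ''r'' (svars pivot_round)) (avars pivot_round) s2 s)"
    proof (rule runs_For)
      have upd: "reduced (int p) k n q r (set_scalar ''r'' x s) = reduced (int p) k n q r s" for q r x s
      proof -
        have "act n (set_scalar ''r'' x s) = act n s" "entry n (set_scalar ''r'' x s) = entry n s"
          "blk (set_scalar ''r'' x s) = blk s" "stored (int p) (set_scalar ''r'' x s) = stored (int p) s"
          by (simp_all add: act_def entry_def blk_def stored_def fun_eq_iff)
        then show ?thesis by (simp add: reduced_def)
      qed
      show "reduced (int p) k n (\<lambda>l m. Q $$ (l, m)) 0 (set_scalar ''r'' 0 s2)" using red by (simp add: upd)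
      fix r s' assume "frame (insert ''r'' (svars pivot_round)) (avars pivot_round) s2 s'"
        and r: "reduced (int p) k n (\<lambda>l m. Q $$ (l, m)) r s'"
      then have c: "scalar s' ''n'' = int n" "scalar s' ''nn'' = int (n * n)" "scalar s' ''p'' = int p" "scalar s' ''P'' = int p ^ k"
        using c2 by (simp_all add: frame_def)
      show "runs (int p ^ k) pivot_round (pivot_round_cost n) s'
         (\<lambda>s''. reduced (int p) k n (\<lambda>l m. Q $$ (l, m)) (Suc r) (set_scalar ''r'' (int (Suc r)) s''))"
        unfolding upd by (rule runs_pivot_round[OF p' c r])
    qed (use c2 in auto)
    then show "runs (int p ^ k) (For ''r'' ''nk'' pivot_round) ((n + k) * (pivot_round_cost n + 8) + 6) s2
    ?R"
    proof (rule runs_mono)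
      fix s assume s: "reduced (int p) k n (\<lambda>l m. Q $$ (l, m)) (n + k) s \<and> frame (insert ''r'' (svars pivot_round)) (avars pivot_round) s2 s"
      then have "scalar s ''P'' = int p ^ k" using c2 by (simp add: frame_def)
      moreover have "periodic (int p ^ k) (\<lambda>_. 0)" by (simp add: periodic_def)
      ultimately show "?R s"
        using reduced_final[OF p'] s by blast
    qed simp
  qed
qed (simp add: reduce_init_def)

section \<open>Quadratic characters and constants\<close>

text \<open>Reduction modulo p uses the integer remainder, since the ring operations reduce modulo
  p^k.\<close>

definition power_body :: com where
  "power_body =
    (Cond (Var ''e'' mod\<^sub>e Num 2) (''ac'' ::= Var ''ac'' *\<^sub>e Var ''pb'' mod\<^sub>e Var ''p'') Skip ;;
     ''pb'' ::= Var ''pb'' *\<^sub>e Var ''pb'' mod\<^sub>e Var ''p'' ;;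
     ''e'' ::= Var ''e'' div\<^sub>e Num 2)"

text \<open>Euler's criterion: for odd p the power is 0, 1 or p - 1, and the last assignment turns p
  - 1 into -1.\<close>

definition character :: com where
  "character =
    (''e'' ::= (Var ''p'' -\<^sub>e Num 1) div\<^sub>e Num 2 ;;
     ''ac'' ::= Num 1 ;;
     While (Num 0 <\<^sub>e Var ''e'') power_body ;;
     ''ch'' ::= Var ''ac'' -\<^sub>e Var ''p'' *\<^sub>e (Var ''ac'' +\<^sub>e Num 1 =\<^sub>e Var ''p''))"

lemma svars_character [simp]: "svars character = {''e'', ''ac'', ''pb'', ''ch''}"
  and avars_character [simp]: "avars character = {}"
  by (auto simp: character_def power_body_def)

text \<open>Square and multiply: \<open>ac * pb ^ e\<close> modulo p is preserved, and j bounds the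
  number of binary digits of the exponent.\<close>

lemma runs_power:
  assumes "scalar s ''p'' = p" "p > 1" "scalar s ''e'' = int E" "E < 2 ^ j" "0 \<le> scalar s ''ac''" "scalar s ''ac'' < p"
  shows "runs m (While (Num 0 <\<^sub>e Var ''e'') power_body) (j * (ccost power_body + 4) + 4) s
     (\<lambda>s'. scalar s' ''ac'' = (scalar s ''ac'' * scalar s ''pb'' ^ E) mod p)"
  using assms
proof (induction j arbitrary: s E)
  case 0
  then have "runs m (While (Num 0 <\<^sub>e Var ''e'') power_body) (1 + cost (Num 0 <\<^sub>e Var ''e'')) s
     (\<lambda>s'. scalar s' ''ac'' = (scalar s ''ac'' * scalar s ''pb'' ^ E) mod p)"
    by (intro runs_While_false) auto
  then show ?case by (rule runs_mono) auto
next
  case (Suc j)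
  show ?case
  proof (cases "E = 0")
    case True
    then have "runs m (While (Num 0 <\<^sub>e Var ''e'') power_body) (1 + cost (Num 0 <\<^sub>e Var ''e'')) s
     (\<lambda>s'. scalar s' ''ac'' = (scalar s ''ac'' * scalar s ''pb'' ^ E) mod p)"
      using Suc.prems by (intro runs_While_false) auto
    then show ?thesis by (rule runs_mono) auto
  next
    case False
    let ?s = "run m power_body s"
    let ?a = "scalar s ''ac''" let ?b = "scalar s ''pb''"
    have md: "int E mod 2 = (if odd E then 1 else 0)" by (cases "even E") (auto elim!: evenE oddE)
    have e: "scalar ?s ''e'' = int (E div 2)" and b: "scalar ?s ''pb'' = ?b * ?b mod p"
      and a: "scalar ?s ''ac'' = (if odd E then ?a * ?b mod p else ?a)" and p: "scalar ?s ''p'' = p"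
      using Suc.prems(1,3) by (simp_all add: power_body_def zdiv_int md)
    have "[scalar ?s ''ac'' * scalar ?s ''pb'' ^ (E div 2) = ?a * ?b ^ E] (mod p)"
    proof -
      have E: "?b ^ E = (?b * ?b) ^ (E div 2) * (if odd E then ?b else 1)"
        by (cases "odd E") (auto elim!: oddE evenE simp: power_mult power2_eq_square)
      have "[scalar ?s ''ac'' * scalar ?s ''pb'' ^ (E div 2) = (?a * (if odd E then ?b else 1)) * (?b * ?b) ^ (E div 2)] (mod p)"
        unfolding a b by (intro cong_mult cong_pow) (auto simp: cong_def)
      then show ?thesis unfolding E by (simp add: mult_ac)
    qed
    then have res: "(scalar ?s ''ac'' * scalar ?s ''pb'' ^ (E div 2)) mod p = (?a * ?b ^ E) mod p" by (simp add: cong_def)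
    have "runs m (While (Num 0 <\<^sub>e Var ''e'') power_body) (j * (ccost power_body + 4) + 4) ?s
     (\<lambda>s'. scalar s' ''ac'' = (scalar ?s ''ac'' * scalar ?s ''pb'' ^ (E div 2)) mod p)"
      using Suc.prems e a p by (intro Suc.IH) auto
    then have "runs m (While (Num 0 <\<^sub>e Var ''e'') power_body)
        (1 + cost (Num 0 <\<^sub>e Var ''e'') + ccost power_body + (j * (ccost power_body + 4) + 4)) s
        (\<lambda>s'. scalar s' ''ac'' = (?a * ?b ^ E) mod p)"
      unfolding res using False Suc.prems by (intro runs_While_true runs_straight) (auto simp: power_body_def)
    then show ?thesis by (rule runs_mono) auto
  qed
qed

definition character_cost :: "nat \<Rightarrow> nat" where
  "character_cost j = 6 + (2 + ((j * (ccost power_body + 4) + 4) + 10))"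

lemma runs_character:
  assumes p: "prime p" and s: "scalar s ''p'' = p" and j: "p \<le> 2 ^ j"
  shows "runs m character (character_cost j) s (\<lambda>s'. p \<noteq> 2 \<longrightarrow> scalar s' ''ch'' = Legendre (scalar s ''pb'') p)"
  unfolding character_def character_cost_def
proof (rule runs_Seq[OF runs_mono[OF runs_run]])
  have p1: "p > 1" using p prime_gt_1_int by auto
  fix s1 assume s1: "s1 = run m (''e'' ::= (Var ''p'' -\<^sub>e Num 1) div\<^sub>e Num 2) s"
  define E where "E = (nat p - 1) div 2"
  have E: "int E = (p - 1) div 2" using p1 by (simp add: E_def zdiv_int of_nat_diff)
  have "int E < 2 ^ j" using E j p1 by linarith
  then have Ej: "E < 2 ^ j" by (metis of_nat_less_iff of_nat_numeral of_nat_power)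
  let ?s2 = "set_scalar ''ac'' 1 s1"
  have "runs m (While (Num 0 <\<^sub>e Var ''e'') power_body) (j * (ccost power_body + 4) + 4) ?s2
     (\<lambda>s'. scalar s' ''ac'' = (scalar ?s2 ''ac'' * scalar ?s2 ''pb'' ^ E) mod p)"
    using s p1 E Ej by (intro runs_power) (auto simp: s1)
  then have "runs m (While (Num 0 <\<^sub>e Var ''e'') power_body ;; ''ch'' ::= Var ''ac'' -\<^sub>e Var ''p'' *\<^sub>e (Var ''ac'' +\<^sub>e Num 1 =\<^sub>e Var ''p''))
    ((j * (ccost power_body + 4) + 4) + 10) ?s2 (\<lambda>s'. p \<noteq> 2 \<longrightarrow> scalar s' ''ch'' = Legendre (scalar s ''pb'') p)"
  proof (rule runs_Seq_frame)
    fix s3 assume ac: "scalar s3 ''ac'' = (scalar ?s2 ''ac'' * scalar ?s2 ''pb'' ^ E) mod p"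
      and fr: "frame (svars (While (Num 0 <\<^sub>e Var ''e'') power_body)) (avars (While (Num 0 <\<^sub>e Var ''e'') power_body)) ?s2 s3"
    have p3: "scalar s3 ''p'' = p" using fr s by (simp add: frame_def s1 power_body_def)
    have ch: "scalar s3 ''ac'' - p * (if scalar s3 ''ac'' + 1 = p then 1 else 0) = Legendre (scalar s ''pb'') p" if p2: "p \<noteq> 2"
    proof -
      have "scalar s3 ''ac'' = Legendre (scalar s ''pb'') p mod p"
        using ac Legendre_power[OF p p2, of "scalar s ''pb''"] by (simp add: s1 E_def cong_def)
      moreover have "p \<ge> 3" using p1 p2 by linarith
      moreover have "(-1) mod p = p - 1" using p1 by (simp add: zmod_minus1)
      ultimately show ?thesis using Legendre_values[of "scalar s ''pb''" p] by auto
    qed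
    show "runs m (''ch'' ::= Var ''ac'' -\<^sub>e Var ''p'' *\<^sub>e (Var ''ac'' +\<^sub>e Num 1 =\<^sub>e Var ''p'')) 10 s3
      (\<lambda>s'. p \<noteq> 2 \<longrightarrow> scalar s' ''ch'' = Legendre (scalar s ''pb'') p)"
      using ch p3 by (intro runs_mono[OF runs_run]) auto
  qed
  note loop = this
  show "runs m (''ac'' ::= Num 1 ;; While (Num 0 <\<^sub>e Var ''e'') power_body ;; ''ch'' ::= Var ''ac'' -\<^sub>e Var ''p'' *\<^sub>e (Var ''ac'' +\<^sub>e Num 1 =\<^sub>e Var ''p''))
    (2 + ((j * (ccost power_body + 4) + 4) + 10)) s1 (\<lambda>s'. p \<noteq> 2 \<longrightarrow> scalar s' ''ch'' = Legendre (scalar s ''pb'') p)"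
  proof (rule runs_Seq[OF runs_mono[OF runs_run]])
    fix s' assume "s' = run m (''ac'' ::= Num 1) s1"
    then have "s' = ?s2" by simp
    with loop show "runs m (While (Num 0 <\<^sub>e Var ''e'') power_body ;; ''ch'' ::= Var ''ac'' -\<^sub>e Var ''p'' *\<^sub>e (Var ''ac'' +\<^sub>e Num 1 =\<^sub>e Var ''p''))
      ((j * (ccost power_body + 4) + 4) + 10) s' (\<lambda>s'. p \<noteq> 2 \<longrightarrow> scalar s' ''ch'' = Legendre (scalar s ''pb'') p)" by (simp only:)
  qed auto
qed auto

text \<open>Its exponents are n and at most k + 2, so repeated multiplication stays within the
  budget.\<close>

definition pow_loop :: "string \<Rightarrow> string \<Rightarrow> string \<Rightarrow> com" where
  "pow_loop x y b = (x ::= Num 1 ;; For ''r'' b (x ::= Var x *\<^sub>e Var y))"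

lemma svars_pow_loop [simp]: "svars (pow_loop x y b) = {x, ''r''}"
  and avars_pow_loop [simp]: "avars (pow_loop x y b) = {}"
  by (auto simp: pow_loop_def)

lemma runs_pow_loop:
  assumes "scalar s b = int N" "distinct [x, y, b, ''r'']"
  shows "runs m (pow_loop x y b) (2 + (N * 12 + 6)) s (\<lambda>s'. scalar s' x = scalar s y ^ N)"
  unfolding pow_loop_def
proof (rule runs_Seq_frame[OF runs_mono[OF runs_run]])
  fix s1 assume s1: "s1 = run m (x ::= Num 1) s"
  have "runs m (For ''r'' b (x ::= Var x *\<^sub>e Var y)) (N * (ccost (x ::= Var x *\<^sub>e Var y) + 8) + 6) s1
    (\<lambda>s'. scalar s' x = scalar s y ^ N \<and> frame (insert ''r'' (svars (x ::= Var x *\<^sub>e Var y))) (avars (x ::= Var x *\<^sub>e Var y)) s1 s')"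
  proof (rule runs_For)
    fix j s' assume "scalar s' x = scalar s y ^ j"
      "frame (insert ''r'' (svars (x ::= Var x *\<^sub>e Var y))) (avars (x ::= Var x *\<^sub>e Var y)) s1 s'"
    then show "runs m (x ::= Var x *\<^sub>e Var y) (ccost (x ::= Var x *\<^sub>e Var y)) s'
       (\<lambda>s''. scalar (set_scalar ''r'' (int (Suc j)) s'') x = scalar s y ^ Suc j)"
      using assms by (intro runs_straight) (auto simp: frame_def s1)
  qed (use assms in \<open>auto simp: s1\<close>)
  then show "runs m (For ''r'' b (x ::= Var x *\<^sub>e Var y)) (N * 12 + 6) s1 (\<lambda>s'. scalar s' x = scalar s y ^ N)"
    by (rule runs_mono) auto
qed auto

section \<open>Counting\<close>

primrec sum_expr :: "('a \<Rightarrow> expr) \<Rightarrow> 'a list \<Rightarrow> expr" where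
  "sum_expr f [] = Num 0"
| "sum_expr f (x # xs) = f x +\<^sub>e sum_expr f xs"

lemma eval_sum_expr: "eval_expr m s (sum_expr f [i..j]) = (\<Sum>y\<in>{i..j}. eval_expr m s (f y))"
proof -
  have "eval_expr m s (sum_expr f xs) = (\<Sum>y\<leftarrow>xs. eval_expr m s (f y))" for xs
    by (induction xs) simp_all
  then show ?thesis by (simp add: interv_sum_list_conv_sum_set_int)
qed

text \<open>All 64 values of a block's variables modulo 8, unrolled into one expression of constant
  cost. Row b of the table \<open>D\<close> holds, for each of the eight start values, the count
  modulo 8 over the blocks with index below b.\<close>

definition dp_expr :: expr where
  "dp_expr = sum_expr (\<lambda>y. sum_expr (\<lambda>z. Arr ''D'' (Num 8 *\<^sub>e Var ''b'' +\<^sub>e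
     (Var ''r'' +\<^sub>e (Var ''xa'' *\<^sub>e Num (y * y) +\<^sub>e Var ''xb'' *\<^sub>e Num (2 * y * z) +\<^sub>e Var ''xc'' *\<^sub>e Num (z * z)))
       mod\<^sub>e Num 8)) [0..7]) [0..7]"

lemma eval_dp_expr: "eval_expr m s dp_expr = (\<Sum>y\<in>{0..<8}. \<Sum>z\<in>{0..<8}. arr s ''D'' (8 * scalar s ''b''
    + (scalar s ''r'' + bval (scalar s ''xa'', scalar s ''xb'', scalar s ''xc'') y z) mod 8))"
proof -
  have "{0..7} = {0..<8::int}" by auto
  then show ?thesis unfolding dp_expr_def eval_sum_expr by (simp add: mult_ac)
qed

definition dp_body :: com where
  "dp_body = Store ''D'' (Num 8 *\<^sub>e (Var ''b'' +\<^sub>e Num 1) +\<^sub>e Var ''r'') dp_expr"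

definition load_body :: com where
  "load_body = (''xa'' ::= Arr ''a2'' (Var ''b'') ;; ''xb'' ::= Arr ''b2'' (Var ''b'') ;; ''xc'' ::= Arr ''c2'' (Var ''b''))"

text \<open>An in-place \<open>class_step\<close>, where \<open>X\<close> holds the character of the
  unit part and \<open>ep\<close> that of -1. In the unary case \<open>xt\<close> saves the old
  \<open>DB\<close>, which the new \<open>DC\<close> needs.\<close>

definition class_body :: com where
  "class_body =
    Cond (Var ''xb'' mod\<^sub>e Var ''p'')
      (''DA'' ::= Var ''p'' *\<^sub>e Var ''p'' *\<^sub>e Var ''DA'' +\<^sub>e (Var ''p'' -\<^sub>e Num 1) *\<^sub>e Var ''DB'' ;;
       ''DB'' ::= Var ''p'' *\<^sub>e Var ''DB'' ;;
       ''DC'' ::= Var ''p'' *\<^sub>e Var ''DC'')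
      (Cond (Var ''xa'' mod\<^sub>e Var ''p'')
        (''xt'' ::= Var ''DB'' ;;
         ''DA'' ::= Var ''p'' *\<^sub>e (Var ''p'' *\<^sub>e Var ''DA'' +\<^sub>e Var ''DB'' -\<^sub>e Var ''DC'' *\<^sub>e Arr ''X'' (Var ''b'')) ;;
         ''DB'' ::= Var ''p'' *\<^sub>e (Var ''p'' *\<^sub>e (Var ''DC'' *\<^sub>e Arr ''X'' (Var ''b''))) ;;
         ''DC'' ::= Var ''p'' *\<^sub>e (Var ''xt'' *\<^sub>e (Var ''ep'' *\<^sub>e Arr ''X'' (Var ''b''))))
        (''DA'' ::= Var ''p'' *\<^sub>e Var ''p'' *\<^sub>e Var ''DA'' ;;
         ''DB'' ::= Var ''p'' *\<^sub>e Var ''p'' *\<^sub>e Var ''DB'' ;;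
         ''DC'' ::= Var ''p'' *\<^sub>e Var ''p'' *\<^sub>e Var ''DC''))"

definition times_body :: com where
  "times_body = (Store ''a2'' (Var ''b'') (Var ''p'' *\<^sub>e Var ''xa'') ;; Store ''b2'' (Var ''b'') (Var ''p'' *\<^sub>e Var ''xb'') ;;
     Store ''c2'' (Var ''b'') (Var ''p'' *\<^sub>e Var ''xc''))"

definition shift_body :: com where
  "shift_body =
    Cond (Var ''xb'' mod\<^sub>e Var ''p'') times_body
      (Cond (Var ''xa'' mod\<^sub>e Var ''p'')
        (''W2'' ::= Var ''W2'' *\<^sub>e Var ''p'' ;; times_body)
        (''W2'' ::= Var ''W2'' *\<^sub>e (Var ''p'' *\<^sub>e Var ''p'') ;;
         Store ''a2'' (Var ''b'') (Var ''xa'' div\<^sub>e Var ''p'') ;;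
         Store ''b2'' (Var ''b'') (Var ''xb'' div\<^sub>e Var ''p'') ;;
         Store ''c2'' (Var ''b'') (Var ''xc'' div\<^sub>e Var ''p'')))"

text \<open>One pass over the blocks evaluates the current sum and at the same time prepares the sum
  of the next round.\<close>

definition block_step :: com where
  "block_step = (load_body ;;
     Cond (Var ''p'' =\<^sub>e Num 2) (For ''r'' ''eight'' dp_body) class_body ;; shift_body)"

lemma vars_bodies [simp]:
  "svars load_body = {''xa'', ''xb'', ''xc''}" "avars load_body = {}" "straight load_body"
  "svars dp_body = {}" "avars dp_body = {''D''}" "straight dp_body"
  "svars class_body = {''DA'', ''DB'', ''DC'', ''xt''}" "avars class_body = {}" "straight class_body"
  "svars shift_body = {''W2''}" "avars shift_body = {''a2'', ''b2'', ''c2''}" "straight shift_body"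
  by (auto simp: load_body_def dp_body_def class_body_def shift_body_def times_body_def)

lemma vars_block_step [simp]:
  "svars block_step = {''xa'', ''xb'', ''xc'', ''r'', ''DA'', ''DB'', ''DC'', ''xt'', ''W2''}"
  "avars block_step = {''D'', ''a2'', ''b2'', ''c2''}"
  by (auto simp: block_step_def)

text \<open>A working copy that the rounds overwrite; the original blocks survive for the second
  count.\<close>

definition blk2 :: "mem \<Rightarrow> nat \<Rightarrow> block" where
  "blk2 s b = (arr s ''a2'' (int b), arr s ''b2'' (int b), arr s ''c2'' (int b))"

text \<open>The quadratic character \<open>\<chi>\<close> of the unit part of a unary block survives multiplication and division
  by \<open>p\<close>, so it is computed once per block and not in every round.\<close>

definition tagged :: "int \<Rightarrow> int \<Rightarrow> block \<Rightarrow> bool" where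
  "tagged p \<chi> B \<longleftrightarrow> good_block p B \<and> (case B of (a, b, c) \<Rightarrow> b = 0 \<longrightarrow>
     a = 0 \<or> (\<exists>e u. a = p ^ e * u \<and> \<not> p dvd u \<and> (p \<noteq> 2 \<longrightarrow> Legendre u p = \<chi>)))"

lemma tagged_unary:
  assumes "tagged p \<chi> (a, 0, 0)" "\<not> p dvd a" "p \<noteq> 2"
  shows "Legendre a p = \<chi>"
proof -
  obtain e u where "a = p ^ e * u" "Legendre u p = \<chi>"
    using assms by (auto simp: tagged_def)
  moreover from this assms(2) have "e = 0" by (cases e) auto
  ultimately show ?thesis by simp
qed

lemma tagged_scale: "tagged p \<chi> B \<Longrightarrow> p \<noteq> 0 \<Longrightarrow> tagged p \<chi> (scale_block (p ^ e) B)"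
proof -
  assume t: "tagged p \<chi> B" and p0: "p \<noteq> 0"
  obtain a b c where B: "B = (a, b, c)" by (cases B)
  have "p ^ e * a = 0 \<or> (\<exists>i u. p ^ e * a = p ^ i * u \<and> \<not> p dvd u \<and> (p \<noteq> 2 \<longrightarrow> Legendre u p = \<chi>))"
    if "p ^ e * b = 0"
  proof -
    have "a = 0 \<or> (\<exists>i u. a = p ^ i * u \<and> \<not> p dvd u \<and> (p \<noteq> 2 \<longrightarrow> Legendre u p = \<chi>))"
      using t that p0 by (simp add: tagged_def B)
    then show ?thesis
    proof
      assume "\<exists>i u. a = p ^ i * u \<and> \<not> p dvd u \<and> (p \<noteq> 2 \<longrightarrow> Legendre u p = \<chi>)"
      then obtain i u where u: "a = p ^ i * u" "\<not> p dvd u" "p \<noteq> 2 \<longrightarrow> Legendre u p = \<chi>" by blast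
      then have "p ^ e * a = p ^ (e + i) * u" by (simp add: power_add)
      with u show ?thesis by blast
    qed simp
  qed
  moreover have "good_block p (scale_block (p ^ e) B)" using t by (intro good_scale_block) (simp add: tagged_def)
  ultimately show ?thesis by (simp add: tagged_def B del: good_block.simps)
qed

lemma tagged_shift:
  assumes t: "tagged p \<chi> B" and p1: "p > 1"
  shows "tagged p \<chi> (shift_block p B)"
proof -
  have g: "good_block p B" using t by (simp add: tagged_def)
  from g p1 show ?thesis
  proof (cases rule: shift_block_cases)
    case (binary a b c)
    then show ?thesis using tagged_scale[OF t, of 1] p1 by simp
  next
    case (unary a)
    then show ?thesis using tagged_scale[OF t, of 1] p1 by simp
  next
    case (divisible a b c)
    have "a = 0 \<or> (\<exists>e u. a = p ^ e * u \<and> \<not> p dvd u \<and> (p \<noteq> 2 \<longrightarrow> Legendre u p = \<chi>))" if "b = 0"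
    proof -
      from t that divisible p1 have "a = 0 \<or> (\<exists>e u. p * a = p ^ e * u \<and> \<not> p dvd u \<and> (p \<noteq> 2 \<longrightarrow> Legendre u p = \<chi>))"
        by (auto simp: tagged_def)
      then show ?thesis
      proof
        assume "\<exists>e u. p * a = p ^ e * u \<and> \<not> p dvd u \<and> (p \<noteq> 2 \<longrightarrow> Legendre u p = \<chi>)"
        then obtain e u where eu: "p * a = p ^ e * u" "\<not> p dvd u" "p \<noteq> 2 \<longrightarrow> Legendre u p = \<chi>" by blast
        have "e \<noteq> 0" using eu(1,2) by (metis dvd_triv_left mult_1 power_0)
        then obtain e' where "e = Suc e'" by (cases e) auto
        with eu p1 have "a = p ^ e' * u" by (simp add: mult.assoc)
        with eu show ?thesis by blast
      qed simp
    qed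
    then show ?thesis using good_shift_block[OF g p1] divisible by (simp add: tagged_def)
  qed
qed

text \<open>Blocks are consumed in increasing order of index, hence \<open>rev [0..<j]\<close>: the
  next block becomes the head of the list, where \<open>cnt\<close> and \<open>foldr\<close>
  unfold.\<close>

definition inner_inv :: "int \<Rightarrow> nat \<Rightarrow> mem \<Rightarrow> nat \<Rightarrow> mem \<Rightarrow> bool" where
  "inner_inv p n s j s' \<longleftrightarrow>
     (\<forall>i<n. blk2 s' i = (if i < j then shift_block p (blk2 s i) else blk2 s i)) \<and>
     scalar s' ''W2'' = prod_list (map (low_factor p) (map (blk2 s) (rev [0..<j]))) \<and>
     (p = 2 \<longrightarrow> (\<forall>r<8. arr s' ''D'' (int (8 * j + r)) = cnt 2 free 3 (map (blk2 s) (rev [0..<j])) (int r))) \<and>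
     (p \<noteq> 2 \<longrightarrow> (scalar s' ''DA'', scalar s' ''DB'', scalar s' ''DC'') =
        foldr (class_step p) (map (blk2 s) (rev [0..<j])) (0, 1, 0))"

lemma cnt_Cons_8:
  "cnt 2 free 3 (B # L) t = (\<Sum>y\<in>{0..<8}. \<Sum>z\<in>{0..<8}. cnt 2 free 3 L (t + bval B y z))"
  by (simp add: cnt_Cons free_def)

definition block_step_cost :: nat where
  "block_step_cost = ccost load_body + ((4 + ((8 * (ccost dp_body + 8) + 6) + ccost class_body)) + ccost shift_body)"

lemma runs_block_step:
  assumes p: "prime p" and j: "j < n"
    and const: "scalar s' ''p'' = p" "scalar s' ''b'' = int j" "scalar s' ''eight'' = 8"
      "p \<noteq> 2 \<Longrightarrow> scalar s' ''ep'' = Legendre (-1) p"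
    and tag: "tagged p (arr s' ''X'' (int j)) (blk2 s j)"
    and inv: "inner_inv p n s j s'"
  shows "runs m block_step block_step_cost s' (inner_inv p n s (Suc j))"
  unfolding block_step_def block_step_cost_def
proof (rule runs_Seq_frame[OF runs_run])
  have p1: "p > 1" using p prime_gt_1_int by auto
  define L where "L = map (blk2 s) (rev [0..<j])"
  obtain a b c where B: "blk2 s j = (a, b, c)" by (cases "blk2 s j")
  have L: "map (blk2 s) (rev [0..<Suc j]) = (a, b, c) # L" by (simp add: L_def B)
  have Bj: "blk2 s' j = (a, b, c)" using inv j B by (simp add: inner_inv_def)
  have good: "good_block p (a, b, c)" using tag by (simp add: tagged_def B)
  fix s1 assume s1: "s1 = run m load_body s'"
  have x1: "scalar s1 ''xa'' = a" "scalar s1 ''xb'' = b" "scalar s1 ''xc'' = c" "arr s1 = arr s'"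
    and const1: "scalar s1 ''p'' = p" "scalar s1 ''b'' = int j" "scalar s1 ''eight'' = 8"
      "p \<noteq> 2 \<Longrightarrow> scalar s1 ''ep'' = Legendre (-1) p"
    and keep1: "scalar s1 ''W2'' = scalar s' ''W2''" "scalar s1 ''DA'' = scalar s' ''DA''"
      "scalar s1 ''DB'' = scalar s' ''DB''" "scalar s1 ''DC'' = scalar s' ''DC''"
    using const Bj by (simp_all add: s1 load_body_def blk2_def)
  let ?R = "\<lambda>s2. (p = 2 \<longrightarrow> (\<forall>r<8. arr s2 ''D'' (int (8 * Suc j + r)) = cnt 2 free 3 ((a, b, c) # L) (int r))) \<and>
     (p \<noteq> 2 \<longrightarrow> (scalar s2 ''DA'', scalar s2 ''DB'', scalar s2 ''DC'') = class_step p (a, b, c) (foldr (class_step p) L (0, 1, 0)))"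
  have mid: "runs m (Cond (Var ''p'' =\<^sub>e Num 2) (For ''r'' ''eight'' dp_body) class_body)
      (1 + cost (Var ''p'' =\<^sub>e Num 2) + ((8 * (ccost dp_body + 8) + 6) + ccost class_body)) s1 ?R"
  proof (rule runs_Cond)
    assume "eval_expr m s1 (Var ''p'' =\<^sub>e Num 2) \<noteq> 0"
    then have p2: "p = 2" using const1 by (simp split: if_splits)
    let ?J = "\<lambda>r s2. (\<forall>i<8. arr s2 ''D'' (int (8 * j + i)) = cnt 2 free 3 L (int i)) \<and>
       (\<forall>i<r. arr s2 ''D'' (int (8 * Suc j + i)) = cnt 2 free 3 ((a, b, c) # L) (int i))"
    have "runs m (For ''r'' ''eight'' dp_body) (8 * (ccost dp_body + 8) + 6) s1
      (\<lambda>s2. ?J 8 s2 \<and> frame (insert ''r'' (svars dp_body)) (avars dp_body) s1 s2)"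
    proof (rule runs_For[where I = ?J])
      show "?J 0 (set_scalar ''r'' 0 s1)" using inv p2 by (simp add: inner_inv_def L_def x1)
      fix r s2 assume r: "r < 8" "scalar s2 ''r'' = int r" and J: "?J r s2"
        and fr: "frame (insert ''r'' (svars dp_body)) (avars dp_body) s1 s2"
      have x2: "scalar s2 ''xa'' = a" "scalar s2 ''xb'' = b" "scalar s2 ''xc'' = c" "scalar s2 ''b'' = int j"
        using fr x1 const1 by (simp_all add: frame_def)
      have D: "arr s2 ''D'' (int j * 8 + x mod 8) = cnt 2 free 3 L x" for x
      proof -
        have "arr s2 ''D'' (int (8 * j + nat (x mod 8))) = cnt 2 free 3 L (int (nat (x mod 8)))"
        proof -
          have "nat (x mod 8) < 8" by (simp add: nat_less_iff)
          then show ?thesis using J by blast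
        qed
        moreover have "cnt 2 free 3 L (x mod 8) = cnt 2 free 3 L x"
          by (rule cnt_cong) (simp add: cong_def)
        ultimately show ?thesis by (simp add: mult.commute)
      qed
      have "arr (run m dp_body s2) ''D'' = (arr s2 ''D'')(int (8 * Suc j + r) := cnt 2 free 3 ((a, b, c) # L) (int r))"
        unfolding cnt_Cons_8 by (simp add: dp_body_def eval_dp_expr x2 r D algebra_simps del: bval.simps)
      then have "?J (Suc r) (set_scalar ''r'' (int (Suc r)) (run m dp_body s2))"
        using J r(1) by (auto simp: less_Suc_eq)
      then show "runs m dp_body (ccost dp_body) s2 (\<lambda>s3. ?J (Suc r) (set_scalar ''r'' (int (Suc r)) s3))"
        by (intro runs_straight) simp_all
    qed (use const1 in auto)
    then show "runs m (For ''r'' ''eight'' dp_body) ((8 * (ccost dp_body + 8) + 6) + ccost class_body) s1 ?R"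
      by (rule runs_mono) (simp_all add: p2)
  next
    assume "eval_expr m s1 (Var ''p'' =\<^sub>e Num 2) = 0"
    then have p2: "p \<noteq> 2" using const1 by (simp split: if_splits)
    have F: "(scalar s1 ''DA'', scalar s1 ''DB'', scalar s1 ''DC'') = foldr (class_step p) L (0, 1, 0)"
      using inv p2 by (simp add: inner_inv_def L_def keep1)
    have X: "arr s' ''X'' (int j) = Legendre a p" if "\<not> p dvd a" "p dvd b"
    proof -
      have "b = 0 \<and> c = 0" using good that by auto
      then show ?thesis using tagged_unary[of p _ a] tag that p2 by (simp add: B)
    qed
    have "(scalar (run m class_body s1) ''DA'', scalar (run m class_body s1) ''DB'', scalar (run m class_body s1) ''DC'')
      = class_step p (a, b, c) (foldr (class_step p) L (0, 1, 0))"
      unfolding F[symmetric] class_step.simps[OF p p2]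
      using X by (simp add: class_body_def x1 const1(1,2) const1(4)[OF p2] dvd_eq_mod_eq_0 power2_eq_square)
    then show "runs m class_body ((8 * (ccost dp_body + 8) + 6) + ccost class_body) s1 ?R"
      using p2 by (intro runs_mono[OF runs_run]) auto
  qed
  show "runs m (Cond (Var ''p'' =\<^sub>e Num 2) (For ''r'' ''eight'' dp_body) class_body ;; shift_body)
      ((4 + ((8 * (ccost dp_body + 8) + 6) + ccost class_body)) + ccost shift_body) s1 (inner_inv p n s (Suc j))"
  proof (rule runs_Seq_frame[OF runs_mono[OF mid order_eq_refl]])
    fix s2 assume R: "?R s2"
      and fr: "frame (svars (Cond (Var ''p'' =\<^sub>e Num 2) (For ''r'' ''eight'' dp_body) class_body))
        (avars (Cond (Var ''p'' =\<^sub>e Num 2) (For ''r'' ''eight'' dp_body) class_body)) s1 s2"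
    have x2: "scalar s2 ''xa'' = a" "scalar s2 ''xb'' = b" "scalar s2 ''xc'' = c" "scalar s2 ''b'' = int j"
      "scalar s2 ''p'' = p" "scalar s2 ''W2'' = scalar s' ''W2''"
      "arr s2 ''a2'' = arr s' ''a2''" "arr s2 ''b2'' = arr s' ''b2''" "arr s2 ''c2'' = arr s' ''c2''"
      using fr x1 const1 keep1 by (simp_all add: frame_def)
    let ?s = "run m shift_body s2"
    have D: "arr ?s ''D'' = arr s2 ''D''" "scalar ?s ''DA'' = scalar s2 ''DA''" "scalar ?s ''DB'' = scalar s2 ''DB''"
       "scalar ?s ''DC'' = scalar s2 ''DC''"
      by (simp_all add: shift_body_def times_body_def)
    have bl: "blk2 ?s i = (if i = j then shift_block p (a, b, c) else blk2 s' i)" for i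
      by (simp add: blk2_def shift_body_def times_body_def x2 dvd_eq_mod_eq_0)
    have W: "scalar ?s ''W2'' = low_factor p (a, b, c) * scalar s' ''W2''"
      by (simp add: shift_body_def times_body_def x2 dvd_eq_mod_eq_0 power2_eq_square)
    have "inner_inv p n s (Suc j) ?s"
      unfolding inner_inv_def L
    proof (intro conjI)
      show "\<forall>i<n. blk2 ?s i = (if i < Suc j then shift_block p (blk2 s i) else blk2 s i)"
        using inv B by (auto simp: bl inner_inv_def less_Suc_eq)
      show "scalar ?s ''W2'' = prod_list (map (low_factor p) ((a, b, c) # L))"
        using inv by (simp add: W inner_inv_def L_def del: low_factor.simps)
      show "p = 2 \<longrightarrow> (\<forall>r<8. arr ?s ''D'' (int (8 * Suc j + r)) = cnt 2 free 3 ((a, b, c) # L) (int r))"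
        using R unfolding D by blast
      show "p \<noteq> 2 \<longrightarrow> (scalar ?s ''DA'', scalar ?s ''DB'', scalar ?s ''DC'') = foldr (class_step p) ((a, b, c) # L) (0, 1, 0)"
        using R unfolding D foldr.simps o_apply by blast
    qed
    then show "runs m shift_body (ccost shift_body) s2 (inner_inv p n s (Suc j))"
      by (intro runs_straight) simp_all
  qed simp_all
qed simp

definition step_init :: com where
  "step_init =
    (''W2'' ::= Num 1 ;;
     Store ''D'' (Num 0) (Num 1) ;; Store ''D'' (Num 1) (Num 0) ;; Store ''D'' (Num 2) (Num 0) ;; Store ''D'' (Num 3) (Num 0) ;;
     Store ''D'' (Num 4) (Num 0) ;; Store ''D'' (Num 5) (Num 0) ;; Store ''D'' (Num 6) (Num 0) ;; Store ''D'' (Num 7) (Num 0) ;;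
     ''DA'' ::= Num 0 ;; ''DB'' ::= Num 1 ;; ''DC'' ::= Num 0)"

text \<open>\<open>F1\<close> and \<open>F0\<close> are the counts at the base level and one below.
  For p = 2 both come from the last row of the table, the second by \<open>cnt_2_from_3\<close> with
  \<open>pn2 = 4 ^ n\<close>; for odd p the second is 1. The character of \<open>tau\<close> is read
  from \<open>ct\<close>, that of the p-free part of - t.\<close>

definition step_value :: com where
  "step_value =
    Cond (Var ''p'' =\<^sub>e Num 2)
      (''F1'' ::= Arr ''D'' (Num 8 *\<^sub>e Var ''n'' +\<^sub>e Var ''tau'' mod\<^sub>e Num 8) ;;
       ''F0'' ::= (Var ''F1'' +\<^sub>e Arr ''D'' (Num 8 *\<^sub>e Var ''n'' +\<^sub>e (Var ''tau'' +\<^sub>e Num 4) mod\<^sub>e Num 8)) div\<^sub>e Var ''pn2'')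
      (''F1'' ::= Var ''DA'' +\<^sub>e Var ''DB'' *\<^sub>e (Var ''tau'' mod\<^sub>e Var ''p'' =\<^sub>e Num 0)
          +\<^sub>e Var ''DC'' *\<^sub>e ((Num 1 -\<^sub>e (Var ''tau'' mod\<^sub>e Var ''p'' =\<^sub>e Num 0)) *\<^sub>e Var ''ct'') ;;
       ''F0'' ::= Num 1)"

text \<open>The order matters: \<open>acc\<close> uses the old \<open>Rp\<close>, which then takes
  the value of \<open>R\<close>. Once \<open>tau\<close> is not divisible by p, \<open>W\<close>
  becomes 0; the remaining rounds run without effect on \<open>acc\<close>, so the number of rounds
  need not depend on t.\<close>

definition step_update :: com where
  "step_update =
    (''acc'' ::= Var ''acc'' +\<^sub>e Var ''W'' *\<^sub>e (Var ''R'' *\<^sub>e Var ''F1'' -\<^sub>e Var ''Rp'' *\<^sub>e Var ''F0'') ;;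
     ''Rp'' ::= Var ''R'' ;;
     ''R'' ::= Var ''R'' div\<^sub>e Var ''pq'' ;;
     ''W'' ::= (Var ''W'' *\<^sub>e Var ''W2'') *\<^sub>e (Var ''tau'' mod\<^sub>e Var ''p'' =\<^sub>e Num 0) ;;
     ''tau'' ::= Var ''tau'' div\<^sub>e Var ''p'')"

definition count_step :: com where
  "count_step = (step_init ;; For ''b'' ''n'' block_step ;; step_value ;; step_update)"

definition scale_body :: com where
  "scale_body =
    (Store ''a2'' (Var ''b'') (Var ''q'' *\<^sub>e Arr ''a'' (Var ''b'')) ;;
     Store ''b2'' (Var ''b'') (Var ''q'' *\<^sub>e Arr ''b'' (Var ''b'')) ;;
     Store ''c2'' (Var ''b'') (Var ''q'' *\<^sub>e Arr ''c'' (Var ''b'')))"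

text \<open>\<open>Rp\<close> starts at 0 because before the first round nothing has been counted
  that would have to be cancelled.\<close>

definition count_init :: com where
  "count_init =
    (''tau'' ::= Num 0 -\<^sub>e Var ''p'' *\<^sub>e Var ''p'' *\<^sub>e Var ''t'' ;;
     ''W'' ::= Num 1 ;; ''Rp'' ::= Num 0 ;; ''acc'' ::= Num 0 ;; ''R'' ::= Var ''R0'')"

definition count_run :: com where
  "count_run = (For ''b'' ''n'' scale_body ;; count_init ;; For ''s'' ''S'' count_step)"

lemma vars_steps [simp]:
  "svars step_init = {''W2'', ''DA'', ''DB'', ''DC''}" "avars step_init = {''D''}" "straight step_init"
  "svars step_value = {''F1'', ''F0''}" "avars step_value = {}" "straight step_value"
  "svars step_update = {''acc'', ''Rp'', ''R'', ''W'', ''tau''}" "avars step_update = {}" "straight step_update"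
  "svars scale_body = {}" "avars scale_body = {''a2'', ''b2'', ''c2''}" "straight scale_body"
  "svars count_init = {''tau'', ''W'', ''Rp'', ''acc'', ''R''}" "avars count_init = {}" "straight count_init"
  by (auto simp: step_init_def step_value_def step_update_def scale_body_def count_init_def)

lemma vars_count_step [simp]:
  "svars count_step = {''W2'', ''DA'', ''DB'', ''DC'', ''b'', ''xa'', ''xb'', ''xc'', ''r'', ''xt'', ''F1'', ''F0'',
     ''acc'', ''Rp'', ''R'', ''W'', ''tau''}"
  "avars count_step = {''D'', ''a2'', ''b2'', ''c2''}"
  by (auto simp: count_step_def)

lemma vars_count_run [simp]:
  "svars count_run = {''W2'', ''DA'', ''DB'', ''DC'', ''b'', ''xa'', ''xb'', ''xc'', ''r'', ''xt'', ''F1'', ''F0'',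
     ''acc'', ''Rp'', ''R'', ''W'', ''tau'', ''s''}"
  "avars count_run = {''D'', ''a2'', ''b2'', ''c2''}"
  by (auto simp: count_run_def)

definition hensel_exponent :: "int \<Rightarrow> nat" where
  "hensel_exponent p = (if p = 2 then 3 else 1)"

definition count_consts :: "int \<Rightarrow> nat \<Rightarrow> nat \<Rightarrow> mem \<Rightarrow> bool" where
  "count_consts p k n s \<longleftrightarrow> scalar s ''p'' = p \<and> scalar s ''n'' = int n \<and> scalar s ''eight'' = 8 \<and>
     scalar s ''pn2'' = p ^ (2 * n) \<and> scalar s ''pq'' = p ^ (2 * n - 1) \<and>
     (p \<noteq> 2 \<longrightarrow> scalar s ''ep'' = Legendre (-1) p \<and> scalar s ''ct'' = Legendre (scalar s ''tu'') p) \<and>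
     (\<not> p dvd scalar s ''tu'' \<or> scalar s ''tu'' = 0)"

text \<open>After \<open>tau\<close> has been a unit, dividing it by p breaks its relation to
  \<open>tu\<close>; by then \<open>W\<close> is 0, hence the disjunction.\<close>

definition outer_inv :: "int \<Rightarrow> nat \<Rightarrow> int \<Rightarrow> nat \<Rightarrow> mem \<Rightarrow> bool" where
  "outer_inv p n N r s \<longleftrightarrow>
     count_inv p (hensel_exponent p) N r (map (blk2 s) (rev [0..<n])) (scalar s ''tau'') (scalar s ''W'')
       (scalar s ''R'') (scalar s ''Rp'') (scalar s ''acc'') \<and>
     (scalar s ''W'' = 0 \<or> (\<exists>e. scalar s ''tau'' = p ^ e * scalar s ''tu'')) \<and>
     (\<forall>b<n. tagged p (arr s ''X'' (int b)) (blk2 s b))"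

lemma cnt_3_unit: "cnt 2 free 3 [] (int r) = (if r = 0 then 1 else 0)" if "r < 8"
proof -
  have "(8::int) dvd int r \<longleftrightarrow> r = 0"
    using that by (metis int_dvd_int_iff nat_dvd_not_less not_gr_zero dvd_0_right of_nat_numeral)
  then show ?thesis by (simp add: cnt_Nil)
qed

definition count_step_cost :: "nat \<Rightarrow> nat" where
  "count_step_cost n = ccost step_init + ((n * (block_step_cost + 8) + 6) + (ccost step_value + ccost step_update))"

lemma runs_count_step:
  assumes p: "prime p" and n: "1 \<le> n" and const: "count_consts p k n s" and inv: "outer_inv p n N (Suc r) s"
  shows "runs m count_step (count_step_cost n) s (outer_inv p n N r)"
  unfolding count_step_def count_step_cost_def
proof (rule runs_Seq_frame[OF runs_run])
  have p1: "p > 1" using p prime_gt_1_int by auto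
  define L where "L = map (blk2 s) (rev [0..<n])"
  define \<tau> where "\<tau> = scalar s ''tau''"
  let ?c = "hensel_exponent p"
  have tag: "tagged p (arr s ''X'' (int b)) (blk2 s b)" if "b < n" for b using inv that by (simp add: outer_inv_def)
  have good: "\<forall>B\<in>set L. good_block p B" using tag by (auto simp: L_def tagged_def)
  have L0: "L \<noteq> []" "length L = n" using n by (simp_all add: L_def)
  fix s1 assume s1: "s1 = run m step_init s"
  have f1: "frame {''W2'', ''DA'', ''DB'', ''DC''} {''D''} s s1"
    by (simp add: s1 step_init_def frame_def)
  have b1: "blk2 s1 = blk2 s" using f1 by (simp add: blk2_def fun_eq_iff frame_def)
  have inv1: "inner_inv p n s1 0 s1"
  proof -
    have "\<forall>r<8. arr s1 ''D'' (int r) = cnt 2 free 3 [] (int r)"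
    proof (intro allI impI)
      fix r :: nat assume "r < 8"
      then show "arr s1 ''D'' (int r) = cnt 2 free 3 [] (int r)"
        unfolding cnt_3_unit[OF \<open>r < 8\<close>] by (auto simp: s1 step_init_def less_Suc_eq numeral_eq_Suc)
    qed
    then show ?thesis by (simp add: inner_inv_def) (simp add: s1 step_init_def)
  qed
  have "runs m (For ''b'' ''n'' block_step) (n * (block_step_cost + 8) + 6) s1
    (\<lambda>s2. inner_inv p n s1 n s2 \<and> frame (insert ''b'' (svars block_step)) (avars block_step) s1 s2)"
  proof (rule runs_For[where I = "inner_inv p n s1"])
    have upd: "inner_inv p n s1 j (set_scalar ''b'' x s2) = inner_inv p n s1 j s2" for j x s2
      by (simp add: inner_inv_def blk2_def)
    show "inner_inv p n s1 0 (set_scalar ''b'' 0 s1)" using inv1 by (simp add: upd)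
    fix j s2 assume j: "j < n" "scalar s2 ''b'' = int j"
      and fr: "frame (insert ''b'' (svars block_step)) (avars block_step) s1 s2" and I: "inner_inv p n s1 j s2"
    have c2: "scalar s2 ''p'' = p" "scalar s2 ''eight'' = 8" "p \<noteq> 2 \<Longrightarrow> scalar s2 ''ep'' = Legendre (-1) p"
      "arr s2 ''X'' = arr s ''X''"
      using fr f1 const by (simp_all add: frame_def count_consts_def)
    have "tagged p (arr s2 ''X'' (int j)) (blk2 s1 j)" using tag[OF j(1)] c2 by (simp add: b1)
    then show "runs m block_step block_step_cost s2 (\<lambda>s3. inner_inv p n s1 (Suc j) (set_scalar ''b'' (int (Suc j)) s3))"
      unfolding upd using c2 j I by (intro runs_block_step[OF p])
  qed (use const f1 in \<open>auto simp: count_consts_def frame_def\<close>)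
  then show "runs m (For ''b'' ''n'' block_step ;; step_value ;; step_update)
    ((n * (block_step_cost + 8) + 6) + (ccost step_value + ccost step_update)) s1 (outer_inv p n N r)"
  proof (rule runs_Seq_frame)
    fix s2 assume A: "inner_inv p n s1 n s2 \<and> frame (insert ''b'' (svars block_step)) (avars block_step) s1 s2"
    then have I2: "inner_inv p n s1 n s2" and f2: "frame (insert ''b'' (svars block_step)) (avars block_step) s1 s2"
      by blast+
    have sc: "scalar s2 x = scalar s x" if "x \<notin> {''W2'', ''DA'', ''DB'', ''DC'', ''b'', ''xa'', ''xb'', ''xc'', ''r'', ''xt''}" for x
      using f1 f2 that by (simp add: frame_def)
    have X2: "arr s2 ''X'' = arr s ''X''" using f1 f2 by (simp add: frame_def)
    have c2: "scalar s2 ''p'' = p" "scalar s2 ''n'' = int n" "scalar s2 ''pn2'' = p ^ (2 * n)" "scalar s2 ''tau'' = \<tau>"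
       "scalar s2 ''pq'' = p ^ (2 * n - 1)"
      using const by (simp_all add: sc count_consts_def \<tau>_def)
    \<comment> \<open>If \<open>W\<close> is 0, the stored character may be wrong for the current
      \<open>tau\<close>, but \<open>F1\<close> enters the accumulator only multiplied by
      \<open>W\<close>.\<close>
    have F: "scalar (run m step_value s2) ''F1'' = cnt p free ?c L \<tau> \<or> scalar s ''W'' = 0"
      "scalar (run m step_value s2) ''F0'' = cnt p free (?c - 1) L \<tau>"
    proof -
      have "(scalar (run m step_value s2) ''F1'' = cnt p free ?c L \<tau> \<or> scalar s ''W'' = 0)
         \<and> scalar (run m step_value s2) ''F0'' = cnt p free (?c - 1) L \<tau>"
      proof (cases "p = 2")
        case True
        have D: "arr s2 ''D'' (8 * int n + x mod 8) = cnt 2 free 3 L x" for x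
        proof -
          have "nat (x mod 8) < 8" by (simp add: nat_less_iff)
          then have "arr s2 ''D'' (int (8 * n + nat (x mod 8))) = cnt 2 free 3 L (int (nat (x mod 8)))"
            using I2 True unfolding inner_inv_def b1 L_def by blast
          moreover have "cnt 2 free 3 L (x mod 8) = cnt 2 free 3 L x"
            by (rule cnt_cong) (simp add: cong_def)
          ultimately show ?thesis by simp
        qed
        have "cnt 2 free 3 L \<tau> + cnt 2 free 3 L (\<tau> + 4) = 2 ^ (2 * n) * cnt 2 free 2 L \<tau>"
          using cnt_2_from_3[of L \<tau>] L0 by (simp add: power_mult)
        then show ?thesis using True c2 by (simp add: step_value_def hensel_exponent_def D)
      next
        case False
        have FC: "(scalar s2 ''DA'', scalar s2 ''DB'', scalar s2 ''DC'') = foldr (class_step p) L (0, 1, 0)"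
          using I2 False by (simp add: inner_inv_def b1 L_def)
        have "cnt p free 1 L \<tau> = class_count p (foldr (class_step p) L (0, 1, 0)) \<tau>"
          using cnt_class[OF p False good] by simp
        then have F1: "cnt p free 1 L \<tau> = scalar s2 ''DA'' + scalar s2 ''DB'' * of_bool (p dvd \<tau>) + scalar s2 ''DC'' * Legendre \<tau> p"
          unfolding FC[symmetric] by (simp add: class_count.simps[OF p False])
        \<comment> \<open>As long as \<open>W\<close> is nonzero, \<tau> is a power of p times
          \<open>tu\<close>; if p does not divide \<tau>, the power is 1 and the stored character
          applies.\<close>
        have Lt: "Legendre \<tau> p = (if p dvd \<tau> then 0 else scalar s2 ''ct'')" if W: "scalar s ''W'' \<noteq> 0"
        proof (cases "p dvd \<tau>")
          case nd: False
          obtain e where e: "\<tau> = p ^ e * scalar s ''tu''" using inv W by (auto simp: outer_inv_def \<tau>_def)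
          have "e = 0" using nd e by (cases e) auto
          then show ?thesis using e nd const False by (simp add: count_consts_def sc)
        qed (simp add: Legendre_0)
        show ?thesis
          using F1 Lt False c2 by (auto simp: step_value_def hensel_exponent_def cnt_0 dvd_eq_mod_eq_0)
      qed
      then show "scalar (run m step_value s2) ''F1'' = cnt p free ?c L \<tau> \<or> scalar s ''W'' = 0"
        "scalar (run m step_value s2) ''F0'' = cnt p free (?c - 1) L \<tau>" by blast+
    qed
    define s3 where "s3 = run m step_value s2"
    have f3: "frame {''F1'', ''F0''} {} s2 s3" by (simp add: s3_def step_value_def frame_def)
    define s4 where "s4 = run m step_update s3"
    have c3: "scalar s3 x = scalar s2 x" if "x \<notin> {''F1'', ''F0''}" for x using f3 that by (simp add: frame_def)
    have W2: "scalar s2 ''W2'' = prod_list (map (low_factor p) L)"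
      using I2 by (simp add: inner_inv_def b1 L_def)
    have v4: "scalar s4 ''tau'' = \<tau> div p"
      "scalar s4 ''R'' = scalar s ''R'' div p ^ (2 * length L - 1)"
      "scalar s4 ''Rp'' = scalar s ''R''"
      "scalar s4 ''W'' = (if p dvd \<tau> then scalar s ''W'' * prod_list (map (low_factor p) L) else 0)"
      "scalar s4 ''acc'' = scalar s ''acc'' + scalar s ''W'' * (scalar s ''R'' * scalar s3 ''F1'' - scalar s ''Rp'' * scalar s3 ''F0'')"
      "scalar s4 ''tu'' = scalar s ''tu''"
      by (simp_all add: s4_def step_update_def c3 c2 sc W2 L0 dvd_eq_mod_eq_0)
    have acc4: "scalar s4 ''acc'' = scalar s ''acc'' + scalar s ''W'' * (scalar s ''R'' * cnt p free ?c L \<tau> - scalar s ''Rp'' * cnt p free (?c - 1) L \<tau>)"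
      unfolding v4 using F by (auto simp: s3_def)
    have arr4: "arr s4 = arr s2" by (simp add: s4_def s3_def step_update_def step_value_def)
    have b4: "blk2 s4 b = shift_block p (blk2 s b)" if "b < n" for b
    proof -
      have "blk2 s4 b = blk2 s2 b" by (simp add: blk2_def arr4)
      then show ?thesis using I2 that by (simp add: inner_inv_def b1)
    qed
    have L4: "map (blk2 s4) (rev [0..<n]) = map (shift_block p) L"
      using b4 by (simp add: L_def)
    have "count_inv p ?c N (Suc r) L \<tau> (scalar s ''W'') (scalar s ''R'') (scalar s ''Rp'') (scalar s ''acc'')"
      using inv by (simp add: outer_inv_def L_def \<tau>_def)
    from count_inv_step[OF this p _ _ L0(1)]
    have "count_inv p ?c N r (map (blk2 s4) (rev [0..<n])) (scalar s4 ''tau'') (scalar s4 ''W'') (scalar s4 ''R'') (scalar s4 ''Rp'') (scalar s4 ''acc'')"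
      unfolding acc4 unfolding L4 v4 by (simp add: hensel_exponent_def)
    moreover have "scalar s4 ''W'' = 0 \<or> (\<exists>e. scalar s4 ''tau'' = p ^ e * scalar s4 ''tu'')"
    proof (cases "scalar s ''W'' = 0 \<or> \<not> p dvd \<tau>")
      case False
      then obtain e where e: "\<tau> = p ^ e * scalar s ''tu''" using inv False by (auto simp: outer_inv_def \<tau>_def)
      show ?thesis
      proof (cases e)
        \<comment> \<open>Here p divides \<open>tu\<close>, which is a unit or 0; so this is the
          case t = 0.\<close>
        case 0
        then have "scalar s ''tu'' = 0" using e False const by (auto simp: count_consts_def)
        then have "scalar s4 ''tau'' = p ^ 0 * scalar s4 ''tu''" using e v4 by simp
        then show ?thesis by blast
      next
        case (Suc e')
        then have "scalar s4 ''tau'' = p ^ e' * scalar s4 ''tu''" using e v4 p1 by simp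
        then show ?thesis by blast
      qed
    qed (auto simp: v4)
    moreover have "tagged p (arr s4 ''X'' (int b)) (blk2 s4 b)" if "b < n" for b
      using tagged_shift[OF tag[OF that] p1] b4[OF that] by (simp add: arr4 X2)
    ultimately have "outer_inv p n N r s4" by (simp add: outer_inv_def)
    then show "runs m (step_value ;; step_update) (ccost step_value + ccost step_update) s2 (outer_inv p n N r)"
      using runs_straight[of "step_value ;; step_update" "outer_inv p n N r" m s2] by (simp add: s4_def s3_def)
  qed
qed simp

text \<open>The first round lifts from level \<open>hensel_exponent p\<close> by
  \<open>rounds p k - 1\<close> levels and has to arrive at k + 2.\<close>

definition rounds :: "int \<Rightarrow> nat \<Rightarrow> nat" where
  "rounds p k = (if p = 2 then k else k + 2)"

definition count_run_cost :: "nat \<Rightarrow> nat \<Rightarrow> nat" where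
  "count_run_cost n k = (n * (ccost scale_body + 8) + 6) + (ccost count_init + ((k + 2) * (count_step_cost n + 8) + 6))"

lemma runs_count_run:
  assumes p: "prime p" and n: "1 \<le> n" and k: "1 \<le> k" and const: "count_consts p k n s"
    and S: "scalar s ''S'' = int (rounds p k)" "scalar s ''R0'' = p ^ ((2 * n - 1) * (rounds p k - 1))"
    and q: "scalar s ''q'' = p ^ e"
    and tag: "\<And>b. b < n \<Longrightarrow> tagged p (arr s ''X'' (int b)) (blk s b)"
    and tu: "\<exists>e. - scalar s ''t'' = p ^ e * scalar s ''tu''"
  shows "runs m count_run (count_run_cost n k) s
    (\<lambda>s'. scalar s' ''acc'' = cnt p free (k + 2) (map (scale_block (p ^ e)) (map (blk s) (rev [0..<n]))) (- (p\<^sup>2 * scalar s ''t'')))"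
  unfolding count_run_def count_run_cost_def
proof (rule runs_Seq_frame)
  have p1: "p > 1" using p prime_gt_1_int by auto
  let ?J = "\<lambda>j s'. \<forall>b<j. blk2 s' b = scale_block (p ^ e) (blk s b)"
  show "runs m (For ''b'' ''n'' scale_body) (n * (ccost scale_body + 8) + 6) s
    (\<lambda>s'. ?J n s' \<and> frame (insert ''b'' (svars scale_body)) (avars scale_body) s s')"
  proof (rule runs_For[where I = ?J])
    fix j s' assume j: "j < n" "scalar s' ''b'' = int j" and J: "?J j s'"
      and fr: "frame (insert ''b'' (svars scale_body)) (avars scale_body) s s'"
    have "scalar s' ''q'' = p ^ e" "arr s' ''a'' = arr s ''a''" "arr s' ''b'' = arr s ''b''" "arr s' ''c'' = arr s ''c''"
      using fr q by (simp_all add: frame_def)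
    then have "blk2 (run m scale_body s') b = (if b = j then scale_block (p ^ e) (blk s b) else blk2 s' b)" for b
      using j by (auto simp: scale_body_def blk2_def blk_def)
    moreover have "blk2 (set_scalar ''b'' (int (Suc j)) s'') b = blk2 s'' b" for s'' b by (simp add: blk2_def)
    ultimately have "?J (Suc j) (set_scalar ''b'' (int (Suc j)) (run m scale_body s'))"
      using J by (simp add: less_Suc_eq)
    then show "runs m scale_body (ccost scale_body) s' (\<lambda>s''. ?J (Suc j) (set_scalar ''b'' (int (Suc j)) s''))"
      by (intro runs_straight) simp_all
  qed (use const in \<open>auto simp: count_consts_def\<close>)
next
  have p1: "p > 1" using p prime_gt_1_int by auto
  let ?L = "map (scale_block (p ^ e)) (map (blk s) (rev [0..<n]))"
  define \<tau> where "\<tau> = - (p\<^sup>2 * scalar s ''t'')"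
  define N where "N = cnt p free (k + 2) ?L \<tau>"
  fix s1 assume A: "(\<forall>b<n. blk2 s1 b = scale_block (p ^ e) (blk s b)) \<and> frame (insert ''b'' (svars scale_body)) (avars scale_body) s s1"
  have f1: "frame {''b''} {''a2'', ''b2'', ''c2''} s s1" using A by simp
  define s2 where "s2 = run m count_init s1"
  have f2: "frame {''b'', ''tau'', ''W'', ''Rp'', ''acc'', ''R''} {''a2'', ''b2'', ''c2''} s s2"
    using f1 by (simp add: s2_def count_init_def frame_def)
  have v2: "scalar s2 ''tau'' = \<tau>" "scalar s2 ''W'' = 1" "scalar s2 ''Rp'' = 0" "scalar s2 ''acc'' = 0"
     "scalar s2 ''R'' = p ^ ((2 * n - 1) * (rounds p k - 1))"
    using f1 const S by (simp_all add: s2_def count_init_def frame_def count_consts_def \<tau>_def power2_eq_square)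
  have const2: "count_consts p k n s2" using const f2 by (simp add: count_consts_def frame_def)
  have b2: "blk2 s2 b = scale_block (p ^ e) (blk s b)" if "b < n" for b
    using A that by (simp add: s2_def count_init_def blk2_def)
  have L2: "map (blk2 s2) (rev [0..<n]) = ?L" using b2 by simp
  have inv2: "outer_inv p n N (rounds p k) s2"
    unfolding outer_inv_def
  proof (intro conjI)
    have ex: "hensel_exponent p + rounds p k - 1 = k + 2" using k by (simp add: hensel_exponent_def rounds_def)
    have "\<forall>B\<in>set ?L. good_block p B"
      using tag good_scale_block by (auto simp: tagged_def)
    moreover have "rounds p k \<noteq> 0" using k by (simp add: rounds_def)
    ultimately show "count_inv p (hensel_exponent p) N (rounds p k) (map (blk2 s2) (rev [0..<n])) (scalar s2 ''tau'') (scalar s2 ''W'')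
       (scalar s2 ''R'') (scalar s2 ''Rp'') (scalar s2 ''acc'')"
      unfolding L2 v2 count_inv_def ex by (simp add: N_def)
    obtain i where "- scalar s ''t'' = p ^ i * scalar s ''tu''" using tu by blast
    moreover have "scalar s2 ''tu'' = scalar s ''tu''" using f2 by (simp add: frame_def)
    ultimately have "scalar s2 ''tau'' = p ^ (i + 2) * scalar s2 ''tu''"
      unfolding v2 \<tau>_def by (simp add: power_add power2_eq_square mult_ac flip: mult_minus_right)
    then show "scalar s2 ''W'' = 0 \<or> (\<exists>e. scalar s2 ''tau'' = p ^ e * scalar s2 ''tu'')" by blast
    have "arr s2 ''X'' = arr s ''X''" using f2 by (simp add: frame_def)
    then show "\<forall>b<n. tagged p (arr s2 ''X'' (int b)) (blk2 s2 b)"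
      using tag b2 p1 by (simp add: tagged_scale)
  qed
  let ?I = "\<lambda>j. outer_inv p n N (rounds p k - j)"
  have loop: "runs m (For ''s'' ''S'' count_step) (rounds p k * (count_step_cost n + 8) + 6) s2
    (\<lambda>s3. ?I (rounds p k) s3 \<and> frame (insert ''s'' (svars count_step)) (avars count_step) s2 s3)"
  proof (rule runs_For[where I = ?I])
    have upd: "outer_inv p n N r (set_scalar ''s'' x s3) = outer_inv p n N r s3" for r x s3
    proof -
      have "blk2 (set_scalar ''s'' x s3) = blk2 s3" by (simp add: blk2_def fun_eq_iff)
      then show ?thesis by (simp add: outer_inv_def)
    qed
    show "?I 0 (set_scalar ''s'' 0 s2)" using inv2 by (simp add: upd)
    fix j s3 assume j: "j < rounds p k" and fr: "frame (insert ''s'' (svars count_step)) (avars count_step) s2 s3"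
      and I: "?I j s3"
    have "count_consts p k n s3" using const2 fr by (simp add: count_consts_def frame_def)
    moreover have "rounds p k - j = Suc (rounds p k - Suc j)" using j by simp
    ultimately show "runs m count_step (count_step_cost n) s3 (\<lambda>s4. ?I (Suc j) (set_scalar ''s'' (int (Suc j)) s4))"
      unfolding upd using I by (intro runs_count_step[OF p n]) simp_all
  qed (use S f2 in \<open>auto simp: frame_def\<close>)
  show "runs m (count_init ;; For ''s'' ''S'' count_step) (ccost count_init + ((k + 2) * (count_step_cost n + 8) + 6)) s1
    (\<lambda>s'. scalar s' ''acc'' = cnt p free (k + 2) ?L (- (p\<^sup>2 * scalar s ''t'')))"
  proof (rule runs_Seq[OF runs_mono[OF runs_run]])
    fix s' assume "s' = run m count_init s1"
    then have "s' = s2" by (simp add: s2_def)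
    show "runs m (For ''s'' ''S'' count_step) ((k + 2) * (count_step_cost n + 8) + 6) s'
      (\<lambda>s'. scalar s' ''acc'' = cnt p free (k + 2) ?L (- (p\<^sup>2 * scalar s ''t'')))"
      unfolding \<open>s' = s2\<close>
    proof (rule runs_mono[OF loop])
      have "rounds p k \<le> k + 2" by (simp add: rounds_def)
      then show "rounds p k * (count_step_cost n + 8) + 6 \<le> (k + 2) * (count_step_cost n + 8) + 6"
        by (intro add_mono mult_mono) auto
    next
      fix s3 assume "?I (rounds p k) s3 \<and> frame (insert ''s'' (svars count_step)) (avars count_step) s2 s3"
      then have "scalar s3 ''acc'' = N" using count_inv_final by (auto simp: outer_inv_def)
      then show "scalar s3 ''acc'' = cnt p free (k + 2) ?L (- (p\<^sup>2 * scalar s ''t''))" by (simp add: N_def \<tau>_def)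
    qed
  qed simp_all
qed

section \<open>Preparation\<close>

definition char_body :: com where
  "char_body = (''pb'' ::= Arr ''u'' (Var ''b'') ;; character ;; Store ''X'' (Var ''b'') (Var ''ch''))"

definition strip_body :: com where
  "strip_body = Cond (Var ''tu'' mod\<^sub>e Var ''p'') Skip (''tu'' ::= Var ''tu'' div\<^sub>e Var ''p'')"

text \<open>Removes all factors p from - t. Since 0 <= t < p^k, k divisions suffice unless t = 0, in
  which case \<open>tu\<close> stays 0.\<close>

definition strip :: com where
  "strip = (''tu'' ::= Num 0 -\<^sub>e Var ''t'' ;; For ''r'' ''k'' strip_body ;;
     ''pb'' ::= Var ''tu'' ;; character ;; ''ct'' ::= Var ''ch'')"

text \<open>\<open>S\<close> is the number of rounds and \<open>pq = p ^ (2 * n - 1)\<close> the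
  lifting factor of one level. \<open>ep\<close> is -1 to the power (p - 1) / 2, the character of
  -1.\<close>

definition consts_body :: com where
  "consts_body =
    (''pn2'' ::= Var ''pn'' *\<^sub>e Var ''pn'' ;;
     ''pq'' ::= Var ''pn2'' div\<^sub>e Var ''p'' ;;
     ''S'' ::= Var ''k'' +\<^sub>e Num 2 *\<^sub>e (Num 1 -\<^sub>e (Var ''p'' =\<^sub>e Num 2)) ;;
     ''ep'' ::= Num 1 -\<^sub>e Num 2 *\<^sub>e (((Var ''p'' -\<^sub>e Num 1) div\<^sub>e Num 2) mod\<^sub>e Num 2) ;;
     ''eight'' ::= Num 8)"

text \<open>One factor \<open>pq\<close> is divided off again because the first of the
  \<open>S\<close> rounds lifts over S - 1 levels.\<close>

definition powers :: com where
  "powers = (pow_loop ''pn'' ''p'' ''n'' ;; pow_loop ''PN'' ''P'' ''n'' ;; consts_body ;;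
     pow_loop ''R0'' ''pq'' ''S'' ;; ''R0'' ::= Var ''R0'' div\<^sub>e Var ''pq'')"

lemma vars_prepare [simp]:
  "svars char_body = {''pb'', ''e'', ''ac'', ''ch''}" "avars char_body = {''X''}"
  "svars strip_body = {''tu''}" "avars strip_body = {}" "straight strip_body"
  "svars strip = {''tu'', ''r'', ''pb'', ''e'', ''ac'', ''ch'', ''ct''}" "avars strip = {}"
  "svars consts_body = {''pn2'', ''pq'', ''S'', ''ep'', ''eight''}" "avars consts_body = {}" "straight consts_body"
  "svars powers = {''pn'', ''PN'', ''pn2'', ''pq'', ''S'', ''ep'', ''eight'', ''R0'', ''r''}" "avars powers = {}"
  by (auto simp: char_body_def strip_body_def strip_def consts_body_def powers_def)

lemma runs_assign:
  assumes "R (set_scalar x (eval_expr m s e) s)" "1 + cost e \<le> B"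
  shows "runs m (x ::= e) B s R"
  using assms by (intro runs_mono[OF runs_run]) auto

lemma runs_assign_Seq:
  assumes "runs m c B (set_scalar x (eval_expr m s e) s) R" "1 + cost e \<le> B0"
  shows "runs m (x ::= e ;; c) (B0 + B) s R"
  using assms by (intro runs_Seq runs_assign)

lemma runs_chars:
  assumes p: "prime p" and s: "scalar s ''p'' = p" "scalar s ''n'' = int n" and j: "p \<le> 2 ^ j"
  shows "runs m (For ''b'' ''n'' char_body) (n * ((3 + (character_cost j + 3)) + 8) + 6) s
    (\<lambda>s'. \<forall>b<n. p \<noteq> 2 \<longrightarrow> arr s' ''X'' (int b) = Legendre (arr s ''u'' (int b)) p)"
proof -
  let ?J = "\<lambda>i s'. \<forall>b<i. p \<noteq> 2 \<longrightarrow> arr s' ''X'' (int b) = Legendre (arr s ''u'' (int b)) p"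
  have "runs m (For ''b'' ''n'' char_body) (n * ((3 + (character_cost j + 3)) + 8) + 6) s
    (\<lambda>s'. ?J n s' \<and> frame (insert ''b'' (svars char_body)) (avars char_body) s s')"
  proof (rule runs_For[where I = ?J])
    fix i s' assume i: "i < n" "scalar s' ''b'' = int i" and J: "?J i s'"
      and fr: "frame (insert ''b'' (svars char_body)) (avars char_body) s s'"
    have c: "scalar s' ''p'' = p" "arr s' ''u'' = arr s ''u''" using fr s by (simp_all add: frame_def)
    let ?s = "set_scalar ''pb'' (arr s ''u'' (int i)) s'"
    have ch: "runs m character (character_cost j) ?s (\<lambda>s''. p \<noteq> 2 \<longrightarrow> scalar s'' ''ch'' = Legendre (scalar ?s ''pb'') p)"
      using c j by (intro runs_character[OF p]) simp_all
    have "runs m (character ;; Store ''X'' (Var ''b'') (Var ''ch'')) (character_cost j + 3) ?s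
      (\<lambda>s''. ?J (Suc i) (set_scalar ''b'' (int (Suc i)) s''))"
    proof (rule runs_Seq_frame[OF ch])
      fix s2 assume C: "p \<noteq> 2 \<longrightarrow> scalar s2 ''ch'' = Legendre (scalar ?s ''pb'') p"
        and f2: "frame (svars character) (avars character) ?s s2"
      have "arr s2 ''X'' = arr s' ''X''" "scalar s2 ''b'' = int i" using f2 i by (simp_all add: frame_def)
      then have "?J (Suc i) (set_scalar ''b'' (int (Suc i)) (run m (Store ''X'' (Var ''b'') (Var ''ch'')) s2))"
        using J C by (auto simp: less_Suc_eq)
      then show "runs m (Store ''X'' (Var ''b'') (Var ''ch'')) 3 s2 (\<lambda>s''. ?J (Suc i) (set_scalar ''b'' (int (Suc i)) s''))"
        by (intro runs_mono[OF runs_run]) auto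
    qed
    then show "runs m char_body (3 + (character_cost j + 3)) s' (\<lambda>s''. ?J (Suc i) (set_scalar ''b'' (int (Suc i)) s''))"
      unfolding char_body_def by (intro runs_assign_Seq) (simp_all add: c i)
  qed (use s in auto)
  then show ?thesis by (rule runs_mono) auto
qed

definition strip_cost :: "nat \<Rightarrow> nat \<Rightarrow> nat" where
  "strip_cost k j = 4 + ((k * (ccost strip_body + 8) + 6) + (2 + (character_cost j + 2)))"

lemma runs_strip:
  assumes p: "prime p" and s: "scalar s ''p'' = p" "scalar s ''k'' = int k"
    and t: "0 \<le> scalar s ''t''" "scalar s ''t'' < p ^ k" and j: "p \<le> 2 ^ j"
  shows "runs m strip (strip_cost k j) s (\<lambda>s'. (\<exists>e. - scalar s ''t'' = p ^ e * scalar s' ''tu'') \<and>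
    (\<not> p dvd scalar s' ''tu'' \<or> scalar s' ''tu'' = 0) \<and> (p \<noteq> 2 \<longrightarrow> scalar s' ''ct'' = Legendre (scalar s' ''tu'') p))"
proof -
  have p1: "p > 1" using p prime_gt_1_int by auto
  define t where "t = scalar s ''t''"
  let ?R = "\<lambda>s'. (\<exists>e. - t = p ^ e * scalar s' ''tu'') \<and> (\<not> p dvd scalar s' ''tu'' \<or> scalar s' ''tu'' = 0) \<and>
    (p \<noteq> 2 \<longrightarrow> scalar s' ''ct'' = Legendre (scalar s' ''tu'') p)"
  let ?s1 = "set_scalar ''tu'' (- t) s"
  \<comment> \<open>While p still divides \<open>tu\<close>, all i divisions have taken place, which
    bounds \<open>tu\<close>; after k of them t < p^k leaves only 0.\<close>
  let ?J = "\<lambda>i s'. (\<exists>e. - t = p ^ e * scalar s' ''tu'') \<and> (\<not> p dvd scalar s' ''tu'' \<or> \<bar>scalar s' ''tu''\<bar> * p ^ i \<le> t)"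
  have loop: "runs m (For ''r'' ''k'' strip_body) (k * (ccost strip_body + 8) + 6) ?s1
    (\<lambda>s'. ?J k s' \<and> frame (insert ''r'' (svars strip_body)) (avars strip_body) ?s1 s')"
  proof (rule runs_For[where I = ?J])
    show "?J 0 (set_scalar ''r'' 0 ?s1)" using t by (auto simp: t_def intro!: exI[of _ 0])
    fix i s' assume J: "?J i s'" and fr: "frame (insert ''r'' (svars strip_body)) (avars strip_body) ?s1 s'"
    have c: "scalar s' ''p'' = p" using fr s by (simp add: frame_def)
    let ?x = "scalar s' ''tu''"
    obtain e where e: "- t = p ^ e * ?x" using J by blast
    have x: "scalar (run m strip_body s') ''tu'' = (if p dvd ?x then ?x div p else ?x)"
      by (simp add: strip_body_def c dvd_eq_mod_eq_0)
    have "?J (Suc i) (set_scalar ''r'' (int (Suc i)) (run m strip_body s'))"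
    proof (cases "p dvd ?x")
      case True
      then obtain y where y: "?x = p * y" by auto
      have "- t = p ^ Suc e * y" using e y by simp
      then have "\<exists>e. - t = p ^ e * y" by blast
      moreover have "\<bar>y\<bar> * p ^ Suc i \<le> t" using J True y p1 by (auto simp: abs_mult mult_ac)
      ultimately show ?thesis using x y p1 by simp
    next
      case False
      then show ?thesis using x e by auto
    qed
    then show "runs m strip_body (ccost strip_body) s' (\<lambda>s''. ?J (Suc i) (set_scalar ''r'' (int (Suc i)) s''))"
      by (intro runs_straight) simp_all
  qed (use s in \<open>auto simp: strip_body_def\<close>)
  have "runs m (For ''r'' ''k'' strip_body ;; ''pb'' ::= Var ''tu'' ;; character ;; ''ct'' ::= Var ''ch'')
    ((k * (ccost strip_body + 8) + 6) + (2 + (character_cost j + 2))) ?s1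
    ?R"
  proof (rule runs_Seq_frame[OF loop])
    fix s2 assume A: "?J k s2 \<and> frame (insert ''r'' (svars strip_body)) (avars strip_body) ?s1 s2"
    have c2: "scalar s2 ''p'' = p" using A s by (simp add: frame_def)
    have zero: "\<not> p dvd scalar s2 ''tu'' \<or> scalar s2 ''tu'' = 0"
    proof (rule ccontr)
      assume "\<not> ?thesis"
      then have "\<bar>scalar s2 ''tu''\<bar> * p ^ k \<le> t" "\<bar>scalar s2 ''tu''\<bar> \<ge> 1" using A by auto
      then have "p ^ k \<le> t" using p1 by (smt (verit) mult_le_cancel_right1 zero_less_power)
      then show False using t by (simp add: t_def)
    qed
    let ?s3 = "set_scalar ''pb'' (scalar s2 ''tu'') s2"
    have ch: "runs m character (character_cost j) ?s3 (\<lambda>s'. p \<noteq> 2 \<longrightarrow> scalar s' ''ch'' = Legendre (scalar ?s3 ''pb'') p)"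
      using c2 j by (intro runs_character[OF p]) simp_all
    have "runs m (character ;; ''ct'' ::= Var ''ch'') (character_cost j + 2) ?s3
      ?R"
    proof (rule runs_Seq_frame[OF ch])
      fix s4 assume C: "p \<noteq> 2 \<longrightarrow> scalar s4 ''ch'' = Legendre (scalar ?s3 ''pb'') p"
        and f4: "frame (svars character) (avars character) ?s3 s4"
      have "scalar s4 ''tu'' = scalar s2 ''tu''" using f4 by (simp add: frame_def)
      then show "runs m (''ct'' ::= Var ''ch'') 2 s4 ?R"
        using A C zero by (intro runs_assign) simp_all
    qed
    then show "runs m (''pb'' ::= Var ''tu'' ;; character ;; ''ct'' ::= Var ''ch'') (2 + (character_cost j + 2)) s2
      ?R"
      by (intro runs_assign_Seq) simp_all
  qed
  then show ?thesis unfolding strip_def strip_cost_def t_def by (intro runs_assign_Seq) simp_all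
qed

definition powers_cost :: "nat \<Rightarrow> nat \<Rightarrow> nat" where
  "powers_cost n k = (2 + (n * 12 + 6)) + ((2 + (n * 12 + 6)) + (ccost consts_body + ((2 + ((k + 2) * 12 + 6)) + 4)))"

lemma runs_powers:
  assumes p: "prime p" and n: "1 \<le> n" and k: "1 \<le> k"
    and s: "scalar s ''p'' = p" "scalar s ''n'' = int n" "scalar s ''k'' = int k"
  shows "runs m powers (powers_cost n k) s (\<lambda>s'. scalar s' ''pn'' = p ^ n \<and> scalar s' ''PN'' = scalar s ''P'' ^ n \<and>
     scalar s' ''eight'' = 8 \<and> scalar s' ''pn2'' = p ^ (2 * n) \<and> scalar s' ''pq'' = p ^ (2 * n - 1) \<and>
     (p \<noteq> 2 \<longrightarrow> scalar s' ''ep'' = Legendre (-1) p) \<and>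
     scalar s' ''S'' = int (rounds p k) \<and> scalar s' ''R0'' = p ^ ((2 * n - 1) * (rounds p k - 1)))"
    (is "runs _ _ _ _ ?R")
  unfolding powers_def powers_cost_def
proof (rule runs_Seq_frame[OF runs_pow_loop[OF s(2)]])
  have p1: "p > 1" using p prime_gt_1_int by auto
  fix s1 assume s1: "scalar s1 ''pn'' = scalar s ''p'' ^ n"
    and f1: "frame (svars (pow_loop ''pn'' ''p'' ''n'')) (avars (pow_loop ''pn'' ''p'' ''n'')) s s1"
  have c1: "scalar s1 ''p'' = p" "scalar s1 ''n'' = int n" "scalar s1 ''k'' = int k" "scalar s1 ''P'' = scalar s ''P''"
    "scalar s1 ''pn'' = p ^ n"
    using f1 s s1 by (simp_all add: frame_def)
  have pow: "p ^ n * p ^ n = p ^ (2 * n)" "p ^ (2 * n) div p = p ^ (2 * n - 1)"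
  proof -
    show "p ^ n * p ^ n = p ^ (2 * n)" by (simp add: power_add[symmetric] mult_2)
    have "p ^ (2 * n) = p * p ^ (2 * n - 1)" using n by (simp flip: power_Suc)
    then show "p ^ (2 * n) div p = p ^ (2 * n - 1)" using p1 by simp
  qed
  have ep: "1 - 2 * ((p - 1) div 2 mod 2) = Legendre (-1) p" if "p \<noteq> 2"
  proof -
    have "(p - 1) div 2 = int ((nat p - 1) div 2)" using p1 by (simp add: zdiv_int of_nat_diff)
    moreover have "int x mod 2 = (if even x then 0 else 1)" for x :: nat by (cases "even x") (auto elim!: evenE oddE)
    ultimately show ?thesis unfolding Legendre_minus_1[OF p that] by simp
  qed
  show "runs m (pow_loop ''PN'' ''P'' ''n'' ;; consts_body ;; pow_loop ''R0'' ''pq'' ''S'' ;; ''R0'' ::= Var ''R0'' div\<^sub>e Var ''pq'')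
    ((2 + (n * 12 + 6)) + (ccost consts_body + ((2 + ((k + 2) * 12 + 6)) + 4))) s1 ?R"
  proof (rule runs_Seq_frame[OF runs_pow_loop[OF c1(2)]])
    fix s2 assume s2: "scalar s2 ''PN'' = scalar s1 ''P'' ^ n"
      and f2: "frame (svars (pow_loop ''PN'' ''P'' ''n'')) (avars (pow_loop ''PN'' ''P'' ''n'')) s1 s2"
    have c2: "scalar s2 ''p'' = p" "scalar s2 ''k'' = int k" "scalar s2 ''PN'' = scalar s ''P'' ^ n" "scalar s2 ''pn'' = p ^ n"
      using f2 c1 s2 by (simp_all add: frame_def)
    show "runs m (consts_body ;; pow_loop ''R0'' ''pq'' ''S'' ;; ''R0'' ::= Var ''R0'' div\<^sub>e Var ''pq'')
      (ccost consts_body + ((2 + ((k + 2) * 12 + 6)) + 4)) s2 ?R"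
    proof (rule runs_Seq_frame[OF runs_run])
      fix s3 assume s3: "s3 = run m consts_body s2"
      have c3: "scalar s3 ''pn'' = p ^ n" "scalar s3 ''PN'' = scalar s ''P'' ^ n" "scalar s3 ''eight'' = 8"
        "scalar s3 ''pn2'' = p ^ (2 * n)" "scalar s3 ''pq'' = p ^ (2 * n - 1)" "scalar s3 ''S'' = int (rounds p k)"
        using c2 by (simp_all add: s3 consts_body_def pow rounds_def)
      have e3: "p \<noteq> 2 \<longrightarrow> scalar s3 ''ep'' = Legendre (-1) p"
        using c2 ep by (simp add: s3 consts_body_def)
      have "runs m (pow_loop ''R0'' ''pq'' ''S'') (2 + ((k + 2) * 12 + 6)) s3 (\<lambda>s'. scalar s' ''R0'' = scalar s3 ''pq'' ^ rounds p k)"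
        by (rule runs_mono[OF runs_pow_loop[OF c3(6)]]) (auto simp: rounds_def)
      then show "runs m (pow_loop ''R0'' ''pq'' ''S'' ;; ''R0'' ::= Var ''R0'' div\<^sub>e Var ''pq'') ((2 + ((k + 2) * 12 + 6)) + 4) s3 ?R"
      proof (rule runs_Seq_frame)
        fix s4 assume s4: "scalar s4 ''R0'' = scalar s3 ''pq'' ^ rounds p k"
          and f4: "frame (svars (pow_loop ''R0'' ''pq'' ''S'')) (avars (pow_loop ''R0'' ''pq'' ''S'')) s3 s4"
        have c4: "scalar s4 x = scalar s3 x" if "x \<notin> {''R0'', ''r''}" for x using f4 that by (simp add: frame_def)
        obtain i where i: "rounds p k = Suc i" using k by (cases "rounds p k") (auto simp: rounds_def split: if_splits)
        have "scalar s4 ''R0'' div scalar s4 ''pq'' = p ^ ((2 * n - 1) * (rounds p k - 1))"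
          using s4 c3 p1 by (simp add: c4 i power_mult[symmetric])
        then show "runs m (''R0'' ::= Var ''R0'' div\<^sub>e Var ''pq'') 4 s4 ?R"
          using c3 e3 by (intro runs_assign) (simp_all add: c4)
      qed
    qed simp
  qed simp
qed simp

section \<open>The algorithm\<close>

text \<open>The divisors undo the multiplicities: \<open>pn2 * pn2 = p ^ (4 * n)\<close> stems from
  raising the exponent by 2 for 2n variables, \<open>PN\<close> from the n dummy variables modulo
  p^k, and the extra \<open>pn\<close> from letting y run modulo p^k instead of p^(k-1) in the
  nonprimitive vectors p y.\<close>

definition count_program :: com where
  "count_program =
    (reduce ;; For ''b'' ''n'' char_body ;; strip ;; powers ;;
     ''q'' ::= Var ''p'' *\<^sub>e Var ''p'' ;; count_run ;;
     ''total'' ::= Var ''acc'' div\<^sub>e (Var ''pn2'' *\<^sub>e Var ''pn2'' *\<^sub>e Var ''PN'') ;;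
     ''q'' ::= (Var ''p'' *\<^sub>e Var ''p'') *\<^sub>e (Var ''p'' *\<^sub>e Var ''p'') ;; count_run ;;
     ''nonprimitive'' ::= Var ''acc'' div\<^sub>e (Var ''pn2'' *\<^sub>e Var ''pn2'' *\<^sub>e Var ''PN'' *\<^sub>e Var ''pn'') ;;
     ''primitive'' ::= Var ''total'' -\<^sub>e Var ''nonprimitive'')"

definition program_cost :: "nat \<Rightarrow> nat \<Rightarrow> nat \<Rightarrow> nat" where
  "program_cost n k j = reduce_cost n k + ((n * ((3 + (character_cost j + 3)) + 8) + 6) + (strip_cost k j + (powers_cost n k
     + (4 + (count_run_cost n k + (8 + (8 + (count_run_cost n k + (10 + 4)))))))))"

lemma runs_count_program:
  assumes p: "prime p" and k: "1 \<le> k" and n: "1 \<le> n" and t: "t \<in> {0..<int p ^ k}"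
    and Q: "Q \<in> carrier_mat n n" "transpose_mat Q = Q" and j: "int p \<le> 2 ^ j"
  shows "runs (int p ^ k) count_program (program_cost n k j) (count_input p k n Q t)
    (\<lambda>s. scalar s ''total'' = int (card (representations p k n Q t)) \<and>
        scalar s ''primitive'' = int (card {x \<in> representations p k n Q t. primitive p x}) \<and>
        scalar s ''nonprimitive'' = int (card {x \<in> representations p k n Q t. \<not> primitive p x}))"
    (is "runs ?m _ _ ?s0 ?R")
  unfolding count_program_def program_cost_def
proof (rule runs_Seq_frame[OF runs_reduce[OF p k Q]])
  let ?c8 = "''nonprimitive'' ::= Var ''acc'' div\<^sub>e (Var ''pn2'' *\<^sub>e Var ''pn2'' *\<^sub>e Var ''PN'' *\<^sub>e Var ''pn'') ;; ''primitive'' ::= Var ''total'' -\<^sub>e Var ''nonprimitive''"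
  let ?c7 = "count_run ;; ?c8"
  let ?c5 = "''total'' ::= Var ''acc'' div\<^sub>e (Var ''pn2'' *\<^sub>e Var ''pn2'' *\<^sub>e Var ''PN'') ;; ''q'' ::= (Var ''p'' *\<^sub>e Var ''p'') *\<^sub>e (Var ''p'' *\<^sub>e Var ''p'') ;; ?c7"
  let ?c4 = "count_run ;; ?c5"
  let ?c3 = "''q'' ::= Var ''p'' *\<^sub>e Var ''p'' ;; ?c4"
  let ?c2 = "powers ;; ?c3"
  let ?c1 = "strip ;; ?c2"
  let ?c0 = "For ''b'' ''n'' char_body ;; ?c1"
  have p': "prime (int p)" using p by simp
  have p0: "int p > 0" using p prime_gt_0_nat by simp
  fix s1 assume A1: "scalar s1 ''P'' = int p ^ k \<and> (\<forall>b<n. stored (int p) s1 b) \<and>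
       (\<forall>g v. periodic (int p ^ k) g \<longrightarrow>
         (int p ^ k) ^ n * form_sum (int p ^ k) {..<n} (\<lambda>l m. Q $$ (l, m)) g v
          = bsum free (int p ^ k) (map (blk s1) (rev [0..<n])) g v)"
    and f1: "frame (svars reduce) (avars reduce) ?s0 s1"
  define L where "L = map (blk s1) (rev [0..<n])"
  have P1: "scalar s1 ''P'' = int p ^ k" and st: "\<And>b. b < n \<Longrightarrow> stored (int p) s1 b"
    and dec: "\<And>g v. periodic (int p ^ k) g \<Longrightarrow> (int p ^ k) ^ n * form_sum (int p ^ k) {..<n} (\<lambda>l m. Q $$ (l, m)) g v = bsum free (int p ^ k) L g v"
    using A1 by (simp_all add: L_def)
  have L: "length L = n" by (simp add: L_def)
  define T where "T = int (card (representations p k n Q t))"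
  define U where "U = int (card {x \<in> representations p k n Q t. \<not> primitive p x})"
  define D where "D = int p ^ (4 * n) * (int p ^ k) ^ n"
  have D0: "D > 0" using p0 by (simp add: D_def)
  note cnts = cnt_representations[OF p k Q(1) L dec, where t = t, folded D_def T_def U_def]
  have prim: "int (card {x \<in> representations p k n Q t. primitive p x}) = T - U"
  proof -
    have "representations p k n Q t = {x \<in> representations p k n Q t. primitive p x} \<union> {x \<in> representations p k n Q t. \<not> primitive p x}"
      by auto
    then have "card (representations p k n Q t) = card {x \<in> representations p k n Q t. primitive p x} + card {x \<in> representations p k n Q t. \<not> primitive p x}"
      by (subst card_Un_disjoint[symmetric]) (use finite_representations[of p k n Q t] in auto)
    then show ?thesis by (simp add: T_def U_def)
  qed
  have c1: "scalar s1 ''p'' = int p" "scalar s1 ''n'' = int n" "scalar s1 ''k'' = int k" "scalar s1 ''t'' = t"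
    using f1 by (simp_all add: frame_def count_input_simps)
  show "runs ?m ?c0
    ((n * ((3 + (character_cost j + 3)) + 8) + 6) + (strip_cost k j + (powers_cost n k
     + (4 + (count_run_cost n k + (8 + (8 + (count_run_cost n k + (10 + 4))))))))) s1 ?R"
  proof (rule runs_Seq_frame[OF runs_chars[OF p' c1(1,2) j]])
    fix s2 assume X2: "\<forall>b<n. int p \<noteq> 2 \<longrightarrow> arr s2 ''X'' (int b) = Legendre (arr s1 ''u'' (int b)) (int p)"
      and f2: "frame (svars (For ''b'' ''n'' char_body)) (avars (For ''b'' ''n'' char_body)) s1 s2"
    have c2: "scalar s2 ''p'' = int p" "scalar s2 ''n'' = int n" "scalar s2 ''k'' = int k" "scalar s2 ''t'' = t" "scalar s2 ''P'' = int p ^ k"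
      using f2 c1 P1 by (simp_all add: frame_def)
    have t2: "0 \<le> scalar s2 ''t''" "scalar s2 ''t'' < int p ^ k" using t c2 by simp_all
    have b2: "blk s2 = blk s1" using f2 by (simp add: blk_def frame_def fun_eq_iff)
    have tag2: "tagged (int p) (arr s2 ''X'' (int b)) (blk s2 b)" if "b < n" for b
      using st[OF that] X2 that unfolding b2 by (auto simp: tagged_def stored_def blk_def)
    show "runs ?m ?c1
    (strip_cost k j + (powers_cost n k
     + (4 + (count_run_cost n k + (8 + (8 + (count_run_cost n k + (10 + 4)))))))) s2 ?R"
    proof (rule runs_Seq_frame[OF runs_strip[OF p' c2(1,3) t2 j]])
      fix s3 assume A3: "(\<exists>e. - scalar s2 ''t'' = int p ^ e * scalar s3 ''tu'') \<and>
          (\<not> int p dvd scalar s3 ''tu'' \<or> scalar s3 ''tu'' = 0) \<and> (int p \<noteq> 2 \<longrightarrow> scalar s3 ''ct'' = Legendre (scalar s3 ''tu'') (int p))"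
        and f3: "frame (svars strip) (avars strip) s2 s3"
      have c3: "scalar s3 ''p'' = int p" "scalar s3 ''n'' = int n" "scalar s3 ''k'' = int k" "scalar s3 ''t'' = t" "scalar s3 ''P'' = int p ^ k"
        using f3 c2 by (simp_all add: frame_def)
      have a3: "arr s3 = arr s2" using f3 by (simp add: frame_def fun_eq_iff)
      show "runs ?m ?c2
        (powers_cost n k + (4 + (count_run_cost n k + (8 + (8 + (count_run_cost n k + (10 + 4))))))) s3 ?R"
      proof (rule runs_Seq_frame[OF runs_powers[OF p' n k c3(1-3)]])
        fix s4 assume A4: "scalar s4 ''pn'' = int p ^ n \<and> scalar s4 ''PN'' = scalar s3 ''P'' ^ n \<and>
           scalar s4 ''eight'' = 8 \<and> scalar s4 ''pn2'' = int p ^ (2 * n) \<and> scalar s4 ''pq'' = int p ^ (2 * n - 1) \<and>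
           (int p \<noteq> 2 \<longrightarrow> scalar s4 ''ep'' = Legendre (-1) (int p)) \<and>
           scalar s4 ''S'' = int (rounds (int p) k) \<and> scalar s4 ''R0'' = int p ^ ((2 * n - 1) * (rounds (int p) k - 1))"
          and f4: "frame (svars powers) (avars powers) s3 s4"
        have c4: "scalar s4 ''p'' = int p" "scalar s4 ''n'' = int n" "scalar s4 ''t'' = t" "scalar s4 ''PN'' = (int p ^ k) ^ n"
          "scalar s4 ''tu'' = scalar s3 ''tu''" "scalar s4 ''ct'' = scalar s3 ''ct''"
          using f4 c3 A4 by (simp_all add: frame_def)
        have a4: "arr s4 = arr s2" using f4 a3 by (simp add: frame_def fun_eq_iff)
        have DD: "scalar s4 ''pn2'' * scalar s4 ''pn2'' * scalar s4 ''PN'' = D"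
          using A4 c4 by (simp add: D_def power_add[symmetric])
        \<comment> \<open>Only working variables have changed since the preparation; with K the
          second count finds the constants and the original blocks intact.\<close>
        define K where "K = (\<lambda>s. frame {''W2'', ''DA'', ''DB'', ''DC'', ''b'', ''xa'', ''xb'', ''xc'', ''r'', ''xt'', ''F1'', ''F0'',
           ''acc'', ''Rp'', ''R'', ''W'', ''tau'', ''s'', ''q'', ''total''} {''D'', ''a2'', ''b2'', ''c2''} s4 s)"
        have K4: "K s4" by (simp add: K_def frame_refl)
        have Kset: "K (set_scalar ''q'' v s)" "K (set_scalar ''total'' v s)" if "K s" for v s
          using that by (simp_all add: K_def frame_def)
        have run: "runs ?m count_run (count_run_cost n k) s
           (\<lambda>s'. scalar s' ''acc'' = cnt (int p) free (k + 2) (map (scale_block (int p ^ e)) L) (- ((int p)\<^sup>2 * t))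
              \<and> K s' \<and> scalar s' ''total'' = scalar s ''total'')"
          if K: "K s" and q: "scalar s ''q'' = int p ^ e" for s e
        proof -
          have cs: "count_consts (int p) k n s"
            using K A4 c4 A3 by (auto simp: K_def frame_def count_consts_def)
          have S: "scalar s ''S'' = int (rounds (int p) k)" "scalar s ''R0'' = int p ^ ((2 * n - 1) * (rounds (int p) k - 1))"
            using K A4 by (simp_all add: K_def frame_def)
          have bs: "blk s = blk s1" using K a4 b2 by (simp add: K_def frame_def blk_def fun_eq_iff)
          have tag: "tagged (int p) (arr s ''X'' (int b)) (blk s b)" if "b < n" for b
            using tag2[OF that] K a4 b2 bs by (simp add: K_def frame_def)
          have tu: "\<exists>e. - scalar s ''t'' = int p ^ e * scalar s ''tu''"
            using A3 K c4 c2 by (simp add: K_def frame_def)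
          have ts: "scalar s ''t'' = t" using K c4 by (simp add: K_def frame_def)
          show ?thesis
            using runs_frame[OF runs_count_run[OF p' n k cs S q tag tu, of ?m]]
          proof (rule runs_mono)
            fix s' assume "scalar s' ''acc'' = cnt (int p) free (k + 2) (map (scale_block (int p ^ e)) (map (blk s) (rev [0..<n])))
                (- ((int p)\<^sup>2 * scalar s ''t'')) \<and> frame (svars count_run) (avars count_run) s s'"
            then show "scalar s' ''acc'' = cnt (int p) free (k + 2) (map (scale_block (int p ^ e)) L) (- ((int p)\<^sup>2 * t))
              \<and> K s' \<and> scalar s' ''total'' = scalar s ''total''"
              using K by (simp add: L_def bs ts K_def frame_def)
          qed simp_all
        qed
        let ?s5 = "set_scalar ''q'' (int p * int p) s4"
        have "runs ?m ?c4
          (count_run_cost n k + (8 + (8 + (count_run_cost n k + (10 + 4))))) ?s5 ?R"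
        proof (rule runs_Seq[OF runs_mono[OF run[OF Kset(1)[OF K4], of "int p * int p" 2]]])
          fix s6 assume A6: "scalar s6 ''acc'' = cnt (int p) free (k + 2) (map (scale_block (int p ^ 2)) L) (- ((int p)\<^sup>2 * t))
              \<and> K s6 \<and> scalar s6 ''total'' = scalar ?s5 ''total''"
          then have K6: "K s6" and acc6: "scalar s6 ''acc'' = D * T" using cnts(1) by simp_all
          have D6: "scalar s6 ''pn2'' * scalar s6 ''pn2'' * scalar s6 ''PN'' = D" "scalar s6 ''p'' = int p"
            using K6 DD c4 by (simp_all add: K_def frame_def)
          let ?s7 = "set_scalar ''total'' T s6"
          let ?s8 = "set_scalar ''q'' ((int p * int p) * (int p * int p)) ?s7"
          have q8: "scalar ?s8 ''q'' = int p ^ 4" by (simp add: power4_eq_xxxx)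
          have "runs ?m ?c7 (count_run_cost n k + (10 + 4)) ?s8 ?R"
          proof (rule runs_Seq[OF runs_mono[OF run[OF Kset(1)[OF Kset(2)[OF K6]] q8]]])
            fix s9 assume A9: "scalar s9 ''acc'' = cnt (int p) free (k + 2) (map (scale_block (int p ^ 4)) L) (- ((int p)\<^sup>2 * t))
              \<and> K s9 \<and> scalar s9 ''total'' = scalar ?s8 ''total''"
            then have K9: "K s9" and acc9: "scalar s9 ''acc'' = D * int p ^ n * U" and tot9: "scalar s9 ''total'' = T"
              using cnts(2) by simp_all
            have D9: "scalar s9 ''pn2'' * scalar s9 ''pn2'' * scalar s9 ''PN'' * scalar s9 ''pn'' = D * int p ^ n"
              using K9 DD A4 by (simp add: K_def frame_def)
            have div9: "scalar s9 ''acc'' div (scalar s9 ''pn2'' * scalar s9 ''pn2'' * scalar s9 ''PN'' * scalar s9 ''pn'') = U"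
              unfolding acc9 D9 using D0 p0 by simp
            show "runs ?m ?c8 (10 + 4) s9 ?R"
              by (intro runs_assign_Seq runs_assign) (simp_all add: div9 tot9 prim, simp_all add: T_def U_def)
          qed simp_all
          moreover have "scalar s6 ''acc'' div (scalar s6 ''pn2'' * scalar s6 ''pn2'' * scalar s6 ''PN'') = T"
            unfolding acc6 D6 using D0 by simp
          ultimately show "runs ?m ?c5 (8 + (8 + (count_run_cost n k + (10 + 4)))) s6 ?R"
            by (intro runs_assign_Seq) (simp_all add: D6)
        qed (simp_all add: power2_eq_square)
        then show "runs ?m ?c3
        (4 + (count_run_cost n k + (8 + (8 + (count_run_cost n k + (10 + 4)))))) s4 ?R"
          by (intro runs_assign_Seq) (simp_all add: c4)
      qed
    qed
  qed
qed

section \<open>The running time\<close>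

text \<open>Only \<open>n * n * k\<close>, the price of the searches that raise the valuation, needs
  an argument: it is at most n^3 if k <= n, and at most n k^2, hence n k^3, otherwise.\<close>

lemma count_monomials:
  fixes n k j :: nat
  assumes "1 \<le> n" "1 \<le> k" "1 \<le> j"
  defines "Y \<equiv> n ^ 3 + n * k ^ 3 + n * j"
  shows "n * n \<le> Y" "n * n * n \<le> Y" "n * n * k \<le> Y" "n * k \<le> Y" "n * j \<le> Y" "n \<le> Y" "k \<le> Y" "j \<le> Y" "1 \<le> Y"
proof -
  have n3: "n ^ 3 = n * n * n" "k ^ 3 = k * k * k" by (simp_all add: power3_eq_cube)
  show c: "n * n * n \<le> Y" by (simp add: Y_def n3)
  show "n * j \<le> Y" by (simp add: Y_def)
  have nk3: "n * (k * k * k) \<le> Y" by (simp add: Y_def n3)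
  show nn: "n * n \<le> Y" using mult_le_mono2[OF assms(1), of "n * n"] c by linarith
  show n1: "n \<le> Y" using mult_le_mono2[OF assms(1), of n] nn by linarith
  show "1 \<le> Y" using n1 assms(1) by simp
  have k1: "1 \<le> k * k" using assms(2) by simp
  show nk: "n * k \<le> Y" using order_trans[OF mult_le_mono2[OF k1, of "n * k"], of Y] nk3 by (simp add: mult_ac)
  show "k \<le> Y" using mult_le_mono1[OF assms(1), of k] nk by linarith
  show "j \<le> Y" using mult_le_mono1[OF assms(1), of j] \<open>n * j \<le> Y\<close> by linarith
  show "n * n * k \<le> Y"
  proof (cases "k \<le> n")
    case True
    then show ?thesis using mult_le_mono2[OF True, of "n * n"] c by linarith
  next
    case False
    then have "n * (n * k) \<le> n * (k * k)" by (intro mult_le_mono2 mult_le_mono1) simp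
    also have "\<dots> \<le> n * (k * k * k)" using mult_le_mono2[OF assms(2), of "k * k"] by (intro mult_le_mono2) simp
    finally have "n * (n * k) \<le> Y" using nk3 by (rule order_trans)
    then show ?thesis by (simp only: mult.assoc)
  qed
qed

text \<open>The costs of the loop-free pieces and of \<open>block_step\<close> are constants
  independent of n, k and j; they are kept opaque, and the factor 100 is a generous common bound for
  their coefficients.\<close>

lemma program_cost_bound:
  "\<exists>C. \<forall>n k j. 1 \<le> n \<longrightarrow> 1 \<le> k \<longrightarrow> 1 \<le> j \<longrightarrow> program_cost n k j \<le> C * (n ^ 3 + n * k ^ 3 + n * j)"
proof -
  define c1 where "c1 = ccost search_body"
  define c2 where "c2 = ccost update_body"
  define c3 where "c3 = ccost setup_pivot"
  define c4 where "c4 = ccost reduce_init"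
  define c5 where "c5 = ccost mod_body"
  define c6 where "c6 = ccost power_body"
  define c7 where "c7 = ccost strip_body"
  define c8 where "c8 = ccost consts_body"
  define c9 where "c9 = ccost scale_body"
  define c10 where "c10 = ccost count_init"
  define c11 where "c11 = ccost step_init"
  define c12 where "c12 = ccost step_value"
  define c13 where "c13 = ccost step_update"
  define c14 where "c14 = block_step_cost"
  note cs = c1_def c2_def c3_def c4_def c5_def c6_def c7_def c8_def c9_def c10_def c11_def c12_def c13_def c14_def
  let ?C = "100 * (c1 + c2 + c3 + c4 + c5 + c6 + c7 + c8 + c9 + c10 + c11 + c12 + c13 + c14 + 10)"
  have "program_cost n k j \<le> ?C * (n ^ 3 + n * k ^ 3 + n * j)" if "1 \<le> n" "1 \<le> k" "1 \<le> j" for n k j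
  proof -
    define Y where "Y = n ^ 3 + n * k ^ 3 + n * j"
    note b = count_monomials[OF that, folded Y_def]
    have mul: "x * c \<le> c * Y" if "x \<le> Y" for x c :: nat
      using mult_le_mono[OF that, of c c] by (simp add: mult.commute)
    have mul1: "c \<le> c * Y" for c :: nat using mul[OF b(9), of c] by simp
    have round: "pivot_round_cost n = (c1 + c2 + 16) * (n * n) + c3 + 22"
      by (simp add: pivot_round_cost_def cs algebra_simps)
    have "reduce_cost n k = c4 + (n * n * (c5 + 8) + 6) + ((n * n * n) * (c1 + c2 + 16) + (n * n * k) * (c1 + c2 + 16) + n * (c3 + 30) + k * (c3 + 30) + 6)"
      unfolding reduce_cost_def round by (simp add: cs algebra_simps)
    also have "\<dots> \<le> (c4 * Y + ((c5 + 8) * Y + 6 * Y)) + (((c1 + c2 + 16) * Y + (c1 + c2 + 16) * Y + (c3 + 30) * Y + (c3 + 30) * Y + 6 * Y))"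
      by (intro add_mono mul mul1 b)
    finally have 1: "reduce_cost n k \<le> (c4 + c5 + 2 * c1 + 2 * c2 + 2 * c3 + 112) * Y" by (simp add: algebra_simps)
    have ch: "character_cost j = j * (c6 + 4) + 22" by (simp add: character_cost_def cs)
    have "n * ((3 + (character_cost j + 3)) + 8) + 6 = n * j * (c6 + 4) + n * 36 + 6"
      unfolding ch by (simp add: algebra_simps)
    also have "\<dots> \<le> (c6 + 4) * Y + 36 * Y + 6 * Y"
      by (intro add_mono mul mul1 b)
    finally have 2: "n * ((3 + (character_cost j + 3)) + 8) + 6 \<le> (c6 + 46) * Y" by (simp add: algebra_simps)
    have "strip_cost k j = k * (c7 + 8) + j * (c6 + 4) + 36" unfolding strip_cost_def ch by (simp add: cs)
    also have "\<dots> \<le> (c7 + 8) * Y + (c6 + 4) * Y + 36 * Y"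
      by (intro add_mono mul mul1 b)
    finally have 3: "strip_cost k j \<le> (c6 + c7 + 48) * Y" by (simp add: algebra_simps)
    have "powers_cost n k = n * 24 + k * 12 + (c8 + 52)" unfolding powers_cost_def by (simp add: cs)
    also have "\<dots> \<le> 24 * Y + 12 * Y + (c8 + 52) * Y"
      by (intro add_mono mul mul1 b)
    finally have 4: "powers_cost n k \<le> (c8 + 88) * Y" by (simp add: algebra_simps)
    have "count_run_cost n k = n * (c9 + 8) + n * k * (c14 + 8) + n * (2 * (c14 + 8)) + k * (c11 + c12 + c13 + 14)
        + (c10 + 12 + 2 * (c11 + c12 + c13 + 14))"
      unfolding count_run_cost_def count_step_cost_def by (simp add: cs algebra_simps)
    also have "\<dots> \<le> (c9 + 8) * Y + (c14 + 8) * Y + 2 * (c14 + 8) * Y + (c11 + c12 + c13 + 14) * Y + (c10 + 12 + 2 * (c11 + c12 + c13 + 14)) * Y"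
      by (intro add_mono mul mul1 b)
    finally have 5: "count_run_cost n k \<le> (c9 + c10 + 3 * c11 + 3 * c12 + 3 * c13 + 3 * c14 + 86) * Y"
      by (simp add: algebra_simps)
    have "program_cost n k j \<le> (c4 + c5 + 2 * c1 + 2 * c2 + 2 * c3 + 112) * Y + ((c6 + 46) * Y + ((c6 + c7 + 48) * Y + ((c8 + 88) * Y
       + (4 * Y + ((c9 + c10 + 3 * c11 + 3 * c12 + 3 * c13 + 3 * c14 + 86) * Y + (8 * Y + (8 * Y
       + ((c9 + c10 + 3 * c11 + 3 * c12 + 3 * c13 + 3 * c14 + 86) * Y + (10 * Y + 4 * Y)))))))))"
      unfolding program_cost_def by (intro add_mono 1 2 3 4 5 mul1)
    also have "\<dots> \<le> ?C * Y" by (simp add: algebra_simps)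
    finally show ?thesis by (simp add: Y_def)
  qed
  then show ?thesis by blast
qed

text \<open>The \<open>max\<close> keeps the first summand from vanishing at k = 1, where the
  elimination in this program still takes cubic time.\<close>

theorem theorem4:
  fixes \<omega> :: real
  assumes "matmul_exponent \<omega>"
  shows "\<exists>(prog :: com) (K :: real). \<forall>(p :: nat) (k :: nat) (n :: nat) (t :: int) (Q :: int mat).
     prime p \<longrightarrow> 1 \<le> k \<longrightarrow> 1 \<le> n \<longrightarrow> t \<in> {0..<int p ^ k} \<longrightarrow>
     Q \<in> carrier_mat n n \<longrightarrow> transpose_mat Q = Q \<longrightarrow>
     (\<exists>T s. exec (int p ^ k) prog (count_input p k n Q t) T s \<and>
        scalar s ''total'' = int (card (representations p k n Q t)) \<and>
        scalar s ''primitive'' = int (card {x \<in> representations p k n Q t. primitive p x}) \<and>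
        scalar s ''nonprimitive'' = int (card {x \<in> representations p k n Q t. \<not> primitive p x}) \<and>
        real T \<le> K * (real n powr (1 + \<omega>) * max 1 (log 2 (real k)) + real n * real k ^ 3
                      + real n * log 2 (real p)))"
proof -
  have \<omega>: "\<omega> \<ge> 2" using assms by (rule matmul_exponent_ge_2)
  obtain C where C: "\<And>n k j. 1 \<le> n \<Longrightarrow> 1 \<le> k \<Longrightarrow> 1 \<le> j \<Longrightarrow> program_cost n k j \<le> C * (n ^ 3 + n * k ^ 3 + n * j)"
    using program_cost_bound by blast
  show ?thesis
  proof (rule exI[of _ count_program], rule exI[of _ "real (2 * C)"], intro allI impI)
    fix p k n :: nat and t :: int and Q :: "int mat"
    assume p: "prime p" and k: "1 \<le> k" and n: "1 \<le> n" and t: "t \<in> {0..<int p ^ k}"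
      and Q: "Q \<in> carrier_mat n n" "transpose_mat Q = Q"
    define l where "l = log 2 (real p)"
    \<comment> \<open>Rounding log p up bounds the digits of p; since p >= 2 the logarithm is at
      least 1, so rounding at most doubles it. This is the 2 in the constant
      \<open>2 * C\<close>.\<close>
    define j where "j = nat \<lceil>l\<rceil>"
    have p2: "real p \<ge> 2" using prime_ge_2_nat[OF p] by simp
    then have l1: "l \<ge> 1" by (simp add: l_def)
    have jl: "l \<le> real j" "real j \<le> 2 * l" "1 \<le> j"
      using l1 unfolding j_def by linarith+
    have "real p = 2 powr l" using p2 by (simp add: l_def)
    also have "\<dots> \<le> 2 powr real j" using jl by simp
    also have "\<dots> = 2 ^ j" by (simp add: powr_realpow)
    finally have "real_of_int (int p) \<le> real_of_int (2 ^ j)" by simp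
    then have pj: "int p \<le> 2 ^ j" by (simp only: of_int_le_iff)
    obtain T s where ex: "exec (int p ^ k) count_program (count_input p k n Q t) T s" and T: "T \<le> program_cost n k j"
      and R: "scalar s ''total'' = int (card (representations p k n Q t))"
        "scalar s ''primitive'' = int (card {x \<in> representations p k n Q t. primitive p x})"
        "scalar s ''nonprimitive'' = int (card {x \<in> representations p k n Q t. \<not> primitive p x})"
      using runs_count_program[OF p k n t Q pj] unfolding runs_def by blast
    define A where "A = real n powr (1 + \<omega>) * max 1 (log 2 (real k))"
    \<comment> \<open>The lower bound on \<omega> enters here: the exponent
      \<open>1 + \<omega>\<close> is at least 3.\<close>
    have n3: "real n ^ 3 \<le> A"
    proof -
      have "real n ^ 3 = real n powr 3" using n by simp
      also have "\<dots> \<le> real n powr (1 + \<omega>)" using n \<omega> by (intro powr_mono) auto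
      also have "\<dots> \<le> real n powr (1 + \<omega>) * max 1 (log 2 (real k))"
        using mult_left_mono[of 1 "max 1 (log 2 (real k))" "real n powr (1 + \<omega>)"] by simp
      finally show ?thesis by (simp add: A_def)
    qed
    have "real T \<le> real (C * (n ^ 3 + n * k ^ 3 + n * j))"
      using T C[OF n k jl(3)] by linarith
    also have "\<dots> = real C * (real n ^ 3 + real n * real k ^ 3 + real n * real j)" by simp
    also have "\<dots> \<le> real C * (2 * (A + real n * real k ^ 3 + real n * l))"
    proof (rule mult_left_mono)
      have "real n * real j \<le> 2 * (real n * l)" using mult_left_mono[OF jl(2), of "real n"] by simp
      moreover have "0 \<le> real n * real k ^ 3" "0 \<le> real n ^ 3" by simp_all
      ultimately show "real n ^ 3 + real n * real k ^ 3 + real n * real j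
        \<le> 2 * (A + real n * real k ^ 3 + real n * l)"
        using n3 unfolding distrib_left by linarith
    qed simp
    also have "\<dots> = real (2 * C) * (A + real n * real k ^ 3 + real n * l)" by simp
    finally have "real T \<le> real (2 * C) * (real n powr (1 + \<omega>) * max 1 (log 2 (real k)) + real n * real k ^ 3 + real n * log 2 (real p))"
      unfolding l_def A_def .
    with ex R show "\<exists>T s. exec (int p ^ k) count_program (count_input p k n Q t) T s \<and>
        scalar s ''total'' = int (card (representations p k n Q t)) \<and>
        scalar s ''primitive'' = int (card {x \<in> representations p k n Q t. primitive p x}) \<and>
        scalar s ''nonprimitive'' = int (card {x \<in> representations p k n Q t. \<not> primitive p x}) \<and>
        real T \<le> real (2 * C) * (real n powr (1 + \<omega>) * max 1 (log 2 (real k)) + real n * real k ^ 3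
                      + real n * log 2 (real p))" by blast
  qed
qed

end
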